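(* Let $a>0$ and, for $z\in\mathbb C$, let $\eta_z=M\psi_z=\Phi\sum_{n\ge0}a_nz^n\eta_n$, with $\Phi=e^{-z\bar z/2}$, $a_n=(n!)^{-1/2}$, $\eta_n=M\psi_n$, and $M$, $\psi_n$, $\psi_z$ as in the context. Then the states $\eta_z$, $z\in\mathbb C$, are coherent states in the following sense: they belong to $H_1$, lie in the domain of the Hamiltonian $h_1=-\partial_x^2-2a^2\,\mathrm{sech}^2(ax)$ and solve $(i\partial_t-h_1)\eta_z=0$, and there is a measure $d\mu_\eta=d\mu_\eta(z,\bar z)$ on $\mathbb C$ realizing the resolution of the identity $\int_{\mathbb C}d\mu_\eta\,|\eta_z\rangle\langle\eta_z|=\mathbb I$ on $H_1$. This measure gives a solution of the moment problem in the complex plane $$a_na_k\int d\mu_\eta\,|\Phi|^2z^n\bar z^k=S_{nk},\qquad n,k=0,1,2,\dots,$$ and has the form $d\mu_\eta=\omega_\eta(x)\,dx\,dy$, where $z=x+iy$ and $\omega_\eta(x)=\frac1\pi\left(x^2+a^2-\frac14\right)$.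
   Context: Fix $a>0$; functions depend on $(x,t)$, Hilbert-space statements are at fixed $t$. $H_0=L^2(\mathbb R)$ with $\langle f|g\rangle_0=\int\bar f g\,dx$. Let $A=(i-t)\partial_x+ix/2$, $A^+=(i+t)\partial_x-ix/2$; $\psi_0$ the normalized solution of $i\partial_t\psi=-\partial_x^2\psi$ with $A\psi_0=0$; $\psi_n=(n!)^{-1/2}(A^+)^n\psi_0$ (orthonormal basis of $H_0$). The free-particle coherent states are $\psi_z=e^{-|z|^2/2}\sum_n(n!)^{-1/2}z^n\psi_n$ ($A\psi_z=z\psi_z$), which resolve the identity on $H_0$ with measure $dx\,dy/\pi$. $\mathcal L_0=\mathrm{span}\{\psi_n\}$. $\bar h_0$ is the closure of $-\partial_x^2$ on $\mathcal L_0$ (self-adjoint) with domain $D_0$; $\bar g_0=\bar h_0+a^2$ on $D_0$; $D_0'=D(\bar g_0^{1/2})$. $L=-a\tanh(ax)+\partial_x$, $\varphi_n=L\psi_n$, $\mathcal L_1=\mathrm{span}\{\varphi_n\}$ with scalar product $\langle L\psi_a|L\psi_b\rangle_1=\langle\psi_a|\bar g_0|\psi_b\rangle_0$ ($\psi_a,\psi_b\in\mathcal L_0$), and $H_1$ the completion of $\mathcal L_1$; bras $\langle\eta_z|$ are taken with respect to $\langle\cdot|\cdot\rangle_1$. $\bar L:D_0'\to H_1$ is the extension of $L$ by continuity with respect to the norm $\psi\mapsto\|\bar g_0^{1/2}\psi\|_0$. The operator $\bar L^+$ is defined on $D_1=\{\bar L\psi:\psi\in D_0\}\subset H_1$ by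 $\bar L^+(\bar L\psi)=\bar g_0\psi$; it is invertible and $M=(\bar L^+)^{-1}$. $S_{nk}$ denotes the matrix elements $S_{nk}=\langle\psi_n|\bar g_0|\psi_k\rangle_0=\langle\varphi_n|\varphi_k\rangle_1$. *)

theory Defs
  imports "HOL-Analysis.Analysis"
begin

text \<open>All objects are functions of the space variable x (and, where indicated,
  of the time t). Hilbert-space statements are made at a fixed time t.
  H_0 = L^2(R) is modelled by square-integrable functions real => complex
  (statements only see them up to a.e. equality through L^2 integrals).\<close>

definition L2 :: "(real \<Rightarrow> complex) \<Rightarrow> bool" where
  "L2 f \<longleftrightarrow> f \<in> borel_measurable lborel \<and> integrable lborel (\<lambda>x. (cmod (f x))\<^sup>2)"

definition inner0 :: "(real \<Rightarrow> complex) \<Rightarrow> (real \<Rightarrow> complex) \<Rightarrow> complex" where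
  "inner0 f g = (LINT x|lborel. cnj (f x) * g x)"

definition l2conv :: "(nat \<Rightarrow> real \<Rightarrow> complex) \<Rightarrow> (real \<Rightarrow> complex) \<Rightarrow> bool" where
  "l2conv fs f \<longleftrightarrow> (\<lambda>k. LINT x|lborel. (cmod (fs k x - f x))\<^sup>2) \<longlonglongrightarrow> 0"

definition dx :: "(real \<Rightarrow> complex) \<Rightarrow> real \<Rightarrow> complex" where
  "dx f x = vector_derivative f (at x)"

text \<open>normalized solution of i psi_t = - psi_xx with A psi_0 = 0 (constant phase fixed)\<close>
definition psi0 :: "real \<Rightarrow> real \<Rightarrow> complex" where
  "psi0 x t = complex_of_real ((2 * pi) powr (-1/4)) / csqrt (1 + \<i> * complex_of_real t)
      * exp (- (complex_of_real x)\<^sup>2 / (4 * (1 + \<i> * complex_of_real t)))"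

definition Aplus :: "real \<Rightarrow> (real \<Rightarrow> complex) \<Rightarrow> real \<Rightarrow> complex" where
  "Aplus t f = (\<lambda>x. (\<i> + complex_of_real t) * dx f x - \<i> * complex_of_real x / 2 * f x)"

definition psi :: "nat \<Rightarrow> real \<Rightarrow> real \<Rightarrow> complex" where
  "psi n x t = ((Aplus t ^^ n) (\<lambda>y. psi0 y t)) x / complex_of_real (sqrt (fact n))"

definition psiz :: "complex \<Rightarrow> real \<Rightarrow> real \<Rightarrow> complex" where
  "psiz z x t = complex_of_real (exp (- (cmod z)\<^sup>2 / 2))
      * (\<Sum>n. z ^ n / complex_of_real (sqrt (fact n)) * psi n x t)"

definition L0 :: "real \<Rightarrow> (real \<Rightarrow> complex) set" where
  "L0 t = {f. \<exists>N c. f = (\<lambda>x. \<Sum>n<N. c n * psi n x t)}"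

text \<open>graph of h_0-bar: closure in H_0 x H_0 of the graph of -d^2/dx^2 on L_0\<close>
definition h0bar :: "real \<Rightarrow> (real \<Rightarrow> complex) \<Rightarrow> (real \<Rightarrow> complex) \<Rightarrow> bool" where
  "h0bar t f g \<longleftrightarrow> L2 f \<and> L2 g \<and>
     (\<exists>fs. (\<forall>k. fs k \<in> L0 t) \<and> l2conv fs f \<and> l2conv (\<lambda>k x. - dx (dx (fs k)) x) g)"

definition g0bar :: "real \<Rightarrow> real \<Rightarrow> (real \<Rightarrow> complex) \<Rightarrow> (real \<Rightarrow> complex) \<Rightarrow> bool" where
  "g0bar a t f g \<longleftrightarrow> (\<exists>h. h0bar t f h \<and> g = (\<lambda>x. h x + complex_of_real (a\<^sup>2) * f x))"

definition D0 :: "real \<Rightarrow> real \<Rightarrow> (real \<Rightarrow> complex) set" where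
  "D0 a t = {f. \<exists>g. g0bar a t f g}"

text \<open>g_0 = -d^2/dx^2 + a^2 acting classically (this is g_0-bar on L_0)\<close>
definition g0 :: "real \<Rightarrow> (real \<Rightarrow> complex) \<Rightarrow> real \<Rightarrow> complex" where
  "g0 a f x = - dx (dx f) x + complex_of_real (a\<^sup>2) * f x"

definition Lop :: "real \<Rightarrow> (real \<Rightarrow> complex) \<Rightarrow> real \<Rightarrow> complex" where
  "Lop a f x = - complex_of_real (a * tanh (a * x)) * f x + dx f x"

definition L1 :: "real \<Rightarrow> real \<Rightarrow> (real \<Rightarrow> complex) set" where
  "L1 a t = {f. \<exists>N c. f = (\<lambda>x. \<Sum>n<N. c n * Lop a (\<lambda>y. psi n y t) x)}"

definition H1 :: "real \<Rightarrow> real \<Rightarrow> (real \<Rightarrow> complex) set" where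
  "H1 a t = {f. L2 f \<and> (\<exists>fs. (\<forall>k. fs k \<in> L1 a t) \<and> l2conv fs f)}"

definition inner1 :: "(real \<Rightarrow> complex) \<Rightarrow> (real \<Rightarrow> complex) \<Rightarrow> complex" where
  "inner1 f g = (LINT x|lborel. cnj (f x) * g x)"

text \<open>graph of L-bar restricted to D_0: L-bar psi = H_1-limit of L psi_k for psi_k in L_0
  converging to psi in the norm psi |-> ||g_0-bar^(1/2) psi||_0; for differences of elements
  of D_0 the square of this norm is <v|g_0-bar v>_0.\<close>
definition Lbar :: "real \<Rightarrow> real \<Rightarrow> (real \<Rightarrow> complex) \<Rightarrow> (real \<Rightarrow> complex) \<Rightarrow> bool" where
  "Lbar a t f e \<longleftrightarrow> L2 e \<and>
     (\<exists>gf fs. g0bar a t f gf \<and> (\<forall>k. fs k \<in> L0 t) \<and>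
        (\<lambda>k. cmod (inner0 (\<lambda>x. fs k x - f x) (\<lambda>x. g0 a (fs k) x - gf x))) \<longlonglongrightarrow> 0 \<and>
        l2conv (\<lambda>k. Lop a (fs k)) e)"

text \<open>graph of M = (L-bar^+)^(-1), where L-bar^+ (L-bar psi) = g_0-bar psi on D_1 = L-bar(D_0):
  M phi = e  iff  e = L-bar psi for some psi in D_0 with g_0-bar psi = phi.\<close>
definition Mrel :: "real \<Rightarrow> real \<Rightarrow> (real \<Rightarrow> complex) \<Rightarrow> (real \<Rightarrow> complex) \<Rightarrow> bool" where
  "Mrel a t p e \<longleftrightarrow> (\<exists>f. g0bar a t f p \<and> Lbar a t f e)"

definition h1 :: "real \<Rightarrow> (real \<Rightarrow> complex) \<Rightarrow> real \<Rightarrow> complex" where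
  "h1 a f x = - dx (dx f) x - complex_of_real (2 * a\<^sup>2 * (1 / cosh (a * x))\<^sup>2) * f x"

definition dom_h1 :: "real \<Rightarrow> real \<Rightarrow> (real \<Rightarrow> complex) set" where
  "dom_h1 a t = {f. f \<in> H1 a t \<and> (\<forall>y. f differentiable (at y)) \<and>
                    (\<forall>y. dx f differentiable (at y)) \<and> L2 (h1 a f)}"

definition solves_schroedinger1 :: "real \<Rightarrow> (real \<Rightarrow> real \<Rightarrow> complex) \<Rightarrow> bool" where
  "solves_schroedinger1 a e \<longleftrightarrow> (\<forall>x t.
     (\<lambda>s. e x s) differentiable (at t) \<and>
     (\<forall>y. (\<lambda>w. e w t) differentiable (at y)) \<and>
     dx (\<lambda>w. e w t) differentiable (at x) \<and>
     \<i> * vector_derivative (\<lambda>s. e x s) (at t) = h1 a (\<lambda>w. e w t) x)"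

definition omega :: "real \<Rightarrow> complex \<Rightarrow> real" where
  "omega a z = ((Re z)\<^sup>2 + a\<^sup>2 - 1/4) / pi"

definition S :: "real \<Rightarrow> real \<Rightarrow> nat \<Rightarrow> nat \<Rightarrow> complex" where
  "S a t n k = inner0 (\<lambda>x. psi n x t) (g0 a (\<lambda>x. psi k x t))"

end

(*
Since the ladder operators satisfy A + A^+ = 2 i d/dx, the operator -d^2/dx^2 has the antinormal symbol
x^2 - 1/4, z = x + i y, so that - d^2/dx^2 + a^2 is resolved by the coherent states psi_z with the density
(x^2 + a^2 - 1/4) / pi. If g_0 f_z = psi_z then eta_z = L f_z, and <L u | eta_z>_1 = <u | g_0 f_z>_0 = <u | psi_z>_0
turns this into the resolution of the identity for the states eta_z, first on L_1. The density can be negative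
when a < 1/2, so the passage to H_1 uses the positive density (x^2 + a^2) / pi, for which the overlaps
<f | eta_z> are bounded in L^2 by a multiple of the norm of f.

Concretely f_z is the convolution of psi_z with exp (- a |y|) / (2 a). That it lies in the domain of the closure of
g_0 on L_0 holds because translates of coherent states are multiples of coherent states, which are limits of
their partial sums in the norm sup_x exp (b |x|) |f x|, together with two derivatives and locally uniformly in z.
*)
theory Submission
  imports Defs "HOL-Complex_Analysis.Complex_Analysis" "HOL-Probability.Distributions"
begin

section \<open>Differentiation under the integral sign\<close>

text \<open>Elements of \<open>L0\<close> are polynomials times a Gaussian, while f_z decays only
  exponentially. Approximation is therefore measured with a weight exp (- b |x|), where b = a/2:
  half of the kernel exp (- a u) pays for moving the weight under a translation, the other half
  keeps the integral convergent.

  The states are handled through a generating function that is entire in z. Up to normalization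
  \<open>psi n\<close> is a Taylor coefficient, ladder identities become Leibniz rules at z = 0, and
  Cauchy's estimates give bounds uniform in x.

  The product on \<open>L1\<close> is the plain L^2 product because L^+ = - d/dx - a tanh (a x)
  satisfies L^+ L = - d^2/dx^2 + a^2. This also gives the first-order equation L^+ eta_z = psi_z,
  and L L^+ = h_1 + a^2 then gives the Schroedinger equation.

  The resolution of the identity is proved weakly, for matrix elements. The map from states to
  overlaps is extended from \<open>L1\<close> to \<open>H1\<close> by Fatou's lemma; the signed
  density enters the limit only through its quotient by the positive one, a bounded
  multiplier.\<close>

lemma has_vector_derivative_iff_quotient:
  fixes f :: "real \<Rightarrow> 'b::real_normed_vector"
  shows "(f has_vector_derivative D) (at x) \<longleftrightarrow>
    ((\<lambda>h. (1 / (h - x)) *\<^sub>R (f h - f x)) \<longlongrightarrow> D) (at x)"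
proof -
  have eq: "norm ((1 / (h - x)) *\<^sub>R (f h - f x) - D) = norm (f h - f x - (h - x) *\<^sub>R D) / norm (h - x)"
    if "h \<noteq> x" for h
  proof -
    have "(1 / (h - x)) *\<^sub>R (f h - f x) - D = (1 / (h - x)) *\<^sub>R (f h - f x - (h - x) *\<^sub>R D)"
      using that by (simp add: scaleR_diff_right)
    then show ?thesis by (simp add: divide_inverse)
  qed
  have "(f has_vector_derivative D) (at x) \<longleftrightarrow>
      ((\<lambda>h. norm (f h - f x - (h - x) *\<^sub>R D) / norm (h - x)) \<longlongrightarrow> 0) (at x)"
    by (simp add: has_vector_derivative_def has_derivative_iff_norm bounded_linear_scaleR_left)
  also have "\<dots> \<longleftrightarrow> ((\<lambda>h. norm ((1 / (h - x)) *\<^sub>R (f h - f x) - D)) \<longlongrightarrow> 0) (at x)"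
    by (intro filterlim_cong refl) (auto simp: eventually_at_filter eq)
  also have "\<dots> \<longleftrightarrow> ((\<lambda>h. (1 / (h - x)) *\<^sub>R (f h - f x)) \<longlongrightarrow> D) (at x)"
    by (simp only: tendsto_norm_zero_iff LIM_zero_iff)
  finally show ?thesis .
qed

text \<open>The mean value inequality turns a bound on the derivative into a dominating function for
  the difference quotients.\<close>

lemma norm_quotient_le:
  fixes f :: "real \<Rightarrow> 'b::real_normed_vector"
  assumes der: "\<And>h. \<bar>h - x\<bar> < e \<Longrightarrow> (f has_vector_derivative f' h) (at h)"
    and bd: "\<And>h. \<bar>h - x\<bar> < e \<Longrightarrow> norm (f' h) \<le> B"
    and h: "\<bar>h - x\<bar> < e" "h \<noteq> x"
  shows "norm ((1 / (h - x)) *\<^sub>R (f h - f x)) \<le> B"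
proof -
  have "norm (f h - f x) \<le> B * norm (h - x)"
  proof (rule differentiable_bound[where S="ball x e" and f'="\<lambda>h v. v *\<^sub>R f' h"])
    show "(f has_derivative (\<lambda>v. v *\<^sub>R f' y)) (at y within ball x e)" if "y \<in> ball x e" for y
      using der[of y] that
      by (auto simp: has_vector_derivative_def dist_real_def abs_minus_commute intro: has_derivative_at_withinI)
    show "onorm (\<lambda>v. v *\<^sub>R f' y) \<le> B" if "y \<in> ball x e" for y
      using bd[of y] that by (simp add: onorm_scaleR_left onorm_id dist_real_def abs_minus_commute)
  qed (use h in \<open>auto simp: dist_real_def abs_minus_commute\<close>)
  then have "norm (f h - f x) / \<bar>h - x\<bar> \<le> B"
    using h by (simp add: pos_divide_le_eq)
  moreover have "norm ((1 / (h - x)) *\<^sub>R (f h - f x)) = norm (f h - f x) / \<bar>h - x\<bar>"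
    by (simp only: norm_scaleR) simp
  ultimately show ?thesis by simp
qed

lemma has_vector_derivative_integral_dominated:
  fixes F :: "real \<Rightarrow> 'a \<Rightarrow> 'b::{banach, second_countable_topology}"
  assumes "e > 0"
    and int: "\<And>h. \<bar>h - h0\<bar> < e \<Longrightarrow> integrable M (F h)"
    and der: "\<And>h y. \<bar>h - h0\<bar> < e \<Longrightarrow> ((\<lambda>h. F h y) has_vector_derivative F' h y) (at h)"
    and bound: "\<And>h y. \<bar>h - h0\<bar> < e \<Longrightarrow> norm (F' h y) \<le> g y"
    and g: "integrable M g"
  shows "((\<lambda>h. integral\<^sup>L M (F h)) has_vector_derivative (LINT y|M. F' h0 y)) (at h0)"
  unfolding has_vector_derivative_iff_quotient tendsto_at_iff_sequentially
proof (intro allI impI)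
  fix X :: "nat \<Rightarrow> real"
  assume X0: "\<forall>i. X i \<in> UNIV - {h0}" and X: "X \<longlonglongrightarrow> h0"
  obtain N where N: "\<And>n. n \<ge> N \<Longrightarrow> \<bar>X n - h0\<bar> < e"
    using X \<open>e > 0\<close> by (auto simp: LIMSEQ_def dist_real_def)
  define Y where "Y n = X (n + N)" for n
  have Y: "\<bar>Y n - h0\<bar> < e" "Y n \<noteq> h0" for n
    using N[of "n + N"] X0 by (auto simp: Y_def)
  have Ylim: "Y \<longlonglongrightarrow> h0"
    unfolding Y_def using X by (rule LIMSEQ_ignore_initial_segment)
  have h0: "\<bar>h0 - h0\<bar> < e" using \<open>e > 0\<close> by simp
  have Yat: "filterlim Y (at h0) sequentially"
    using Ylim Y(2) by (simp add: filterlim_at)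
  have lim: "(\<lambda>n. (1 / (Y n - h0)) *\<^sub>R (F (Y n) y - F h0 y)) \<longlonglongrightarrow> F' h0 y" for y
    using filterlim_compose[OF der[OF h0, of y, unfolded has_vector_derivative_iff_quotient] Yat] .
  have ints: "integrable M (\<lambda>y. (1 / (Y n - h0)) *\<^sub>R (F (Y n) y - F h0 y))" for n
    using int[OF Y(1)] int[OF h0] by (intro integrable_scaleR_right Bochner_Integration.integrable_diff)
  \<comment> \<open>Measurability of the derivative is inherited from the quotients, of which it is
    the pointwise limit.\<close>
  have meas: "F' h0 \<in> borel_measurable M"
    by (rule borel_measurable_LIMSEQ_metric[OF borel_measurable_integrable[OF ints] lim])
  have "(\<lambda>n. LINT y|M. (1 / (Y n - h0)) *\<^sub>R (F (Y n) y - F h0 y)) \<longlonglongrightarrow> (LINT y|M. F' h0 y)"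
  proof (rule integral_dominated_convergence[where w=g])
    show "AE y in M. norm ((1 / (Y n - h0)) *\<^sub>R (F (Y n) y - F h0 y)) \<le> g y" for n
    proof (rule AE_I2)
      fix y
      show "norm ((1 / (Y n - h0)) *\<^sub>R (F (Y n) y - F h0 y)) \<le> g y"
        by (rule norm_quotient_le[where e=e and f'="\<lambda>h. F' h y", OF der bound Y])
    qed
  qed (rule meas borel_measurable_integrable[OF ints] g AE_I2 lim)+
  also have "(\<lambda>n. LINT y|M. (1 / (Y n - h0)) *\<^sub>R (F (Y n) y - F h0 y)) =
      (\<lambda>n. (1 / (Y n - h0)) *\<^sub>R (integral\<^sup>L M (F (Y n)) - integral\<^sup>L M (F h0)))"
    by (simp only: integral_scaleR_right Bochner_Integration.integral_diff[OF int[OF Y(1)] int[OF h0]])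
  finally have "(\<lambda>n. (1 / (X (n+N) - h0)) *\<^sub>R (integral\<^sup>L M (F (X (n+N))) - integral\<^sup>L M (F h0)))
      \<longlonglongrightarrow> (LINT y|M. F' h0 y)" by (simp add: Y_def)
  then show "((\<lambda>h. (1 / (h - h0)) *\<^sub>R (integral\<^sup>L M (F h) - integral\<^sup>L M (F h0))) \<circ> X)
      \<longlonglongrightarrow> (LINT y|M. F' h0 y)"
    unfolding comp_def
    by (rule LIMSEQ_offset[where k=N and
          f="\<lambda>n. (1 / (X n - h0)) *\<^sub>R (integral\<^sup>L M (F (X n)) - integral\<^sup>L M (F h0))"])
qed

text \<open>Translation invariance: the integral of \<open>F (y + h v)\<close> does not depend on \<open>h\<close>.\<close>

lemma integral_directional_derivative_eq_0:
  fixes F :: "'a::euclidean_space \<Rightarrow> 'b::{banach, second_countable_topology}"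
  assumes int: "integrable lborel F"
    and der: "\<And>y h. ((\<lambda>h. F (y + h *\<^sub>R v)) has_vector_derivative F' (y + h *\<^sub>R v)) (at h)"
    and bound: "\<And>y h. \<bar>h\<bar> < 1 \<Longrightarrow> norm (F' (y + h *\<^sub>R v)) \<le> g y"
    and g: "integrable lborel g"
  shows "(LINT y|lborel. F' y) = 0"
proof -
  have tr: "integrable lborel (\<lambda>y. F (y + w))" "(LINT y|lborel. F (y + w)) = (LINT y|lborel. F y)" for w
  proof -
    have m: "F \<in> borel_measurable borel" using borel_measurable_integrable[OF int] by simp
    have "integrable (distr lborel borel ((+) w)) F"
      unfolding lborel_distr_plus by (rule int)
    then show "integrable lborel (\<lambda>y. F (y + w))"
      using m by (subst (asm) integrable_distr_eq) (auto simp: add.commute)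
    have "(LINT y|lborel. F y) = (LINT y|distr lborel borel ((+) w). F y)"
      by (simp add: lborel_distr_plus)
    also have "\<dots> = (LINT y|lborel. F (y + w))"
      using m by (subst integral_distr) (auto simp: add.commute)
    finally show "(LINT y|lborel. F (y + w)) = (LINT y|lborel. F y)" by simp
  qed
  have "((\<lambda>h. LINT y|lborel. F (y + h *\<^sub>R v)) has_vector_derivative
      (LINT y|lborel. F' (y + 0 *\<^sub>R v))) (at 0)"
    by (rule has_vector_derivative_integral_dominated[where e=1 and g=g]) (use tr der bound g in auto)
  moreover have "((\<lambda>h::real. LINT y|lborel. F (y + h *\<^sub>R v)) has_vector_derivative 0) (at 0)"
    by (simp add: tr)
  ultimately show ?thesis
    using vector_derivative_unique_at by fastforce
qed

section \<open>Exponential integrals over half-lines and the line\<close>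

lemma integral_Ici_FTC:
  fixes F :: "real \<Rightarrow> 'b::euclidean_space"
  assumes der: "\<And>u. (F has_vector_derivative f u) (at u)"
    and cont: "continuous_on UNIV f"
    and int: "set_integrable lborel {0..} f"
    and lim: "(F \<longlongrightarrow> 0) at_top"
  shows "(LINT u:{0..}|lborel. f u) = - F 0"
proof -
  have "((\<lambda>b. LINT u:{0..b}|lborel. f u) \<longlongrightarrow> (LINT u:{0..}|lborel. f u)) at_top"
    by (rule tendsto_set_lebesgue_integral_at_top) (use int in auto)
  moreover have "eventually (\<lambda>b. (LINT u:{0..b}|lborel. f u) = F b - F 0) at_top"
    using eventually_ge_at_top[of 0]
  proof eventually_elim
    case (elim b)
    then show ?case
      unfolding set_lebesgue_integral_def
      by (intro integral_FTC_atLeastAtMost)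
         (use der cont in \<open>auto intro: has_vector_derivative_at_within continuous_on_subset\<close>)
  qed
  ultimately have "((\<lambda>b. F b - F 0) \<longlongrightarrow> (LINT u:{0..}|lborel. f u)) at_top"
    by (rule Lim_transform_eventually)
  moreover have "((\<lambda>b. F b - F 0) \<longlongrightarrow> 0 - F 0) at_top"
    by (intro tendsto_diff lim tendsto_const)
  ultimately show ?thesis
    using tendsto_unique by (metis diff_0 trivial_limit_at_top_linorder)
qed

lemma exp_neg_Ici:
  fixes b R :: real
  assumes "b > 0"
  shows "set_integrable lborel {R..} (\<lambda>u. exp (- b * u))"
    and "(LINT u:{R..}|lborel. exp (- b * u)) = exp (- b * R) / b"
proof -
  have "has_bochner_integral lborel (\<lambda>u. exp (- b * u) * indicator {R..} u) (0 - (- exp (- b * R) / b))"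
  proof (rule has_bochner_integral_nn_integral)
    have "((\<lambda>u. - exp (- b * u) / b) \<longlongrightarrow> - 0 / b) at_top"
      using assms by (intro tendsto_intros filterlim_compose[OF exp_at_bot])
        (auto simp: filterlim_uminus_at_top[symmetric] intro!: filterlim_tendsto_pos_mult_at_top filterlim_ident
          simp flip: filterlim_uminus_at_bot)
    then have "(\<integral>\<^sup>+u. ennreal (exp (- b * u)) * indicator {R..} u \<partial>lborel) = ennreal (0 - (- exp (- b * R) / b))"
      using assms by (intro nn_integral_FTC_atLeast) (auto intro!: derivative_eq_intros)
    then show "(\<integral>\<^sup>+u. ennreal (exp (- b * u) * indicator {R..} u) \<partial>lborel) = ennreal (0 - (- exp (- b * R) / b))"
      by (simp add: ennreal_mult' ennreal_indicator)
  qed (use assms in auto)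
  then show "set_integrable lborel {R..} (\<lambda>u. exp (- b * u))"
    and "(LINT u:{R..}|lborel. exp (- b * u)) = exp (- b * R) / b"
    by (auto simp: set_integrable_def set_lebesgue_integral_def has_bochner_integral_iff mult.commute)
qed

lemma integrable_exp_neg_abs:
  fixes b :: real
  assumes "b > 0"
  shows "integrable lborel (\<lambda>x. exp (- b * \<bar>x\<bar>))"
proof -
  have 1: "integrable lborel (\<lambda>u. indicator {0..} u *\<^sub>R exp (- b * u))"
    using exp_neg_Ici(1)[OF assms, of 0] by (simp add: set_integrable_def)
  have 2: "integrable lborel (\<lambda>u. indicator {0..} (0 + (-1) * u) *\<^sub>R exp (- b * (0 + (-1) * u)))"
    by (rule lborel_integrable_real_affine[OF 1]) simp
  show ?thesis
    by (rule Bochner_Integration.integrable_bound[OF Bochner_Integration.integrable_add[OF 1 2]])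
       (auto simp: indicator_def)
qed

section \<open>Taylor expansions of entire functions\<close>

lemma entire_Taylor_sums:
  assumes "f holomorphic_on UNIV"
  shows "(\<lambda>n. z ^ n / fact n * (deriv ^^ n) f 0) sums f z"
proof -
  have "f holomorphic_on ball 0 (cmod z + 1)"
    using assms holomorphic_on_subset by blast
  then have "(\<lambda>n. (deriv ^^ n) f 0 / fact n * (z - 0) ^ n) sums f z"
    by (rule holomorphic_power_series) simp
  moreover have "(\<lambda>n. (deriv ^^ n) f 0 / fact n * (z - 0) ^ n) = (\<lambda>n. z ^ n / fact n * (deriv ^^ n) f 0)"
    by (rule ext) simp
  ultimately show ?thesis by simp
qed

text \<open>Cauchy's estimate on the circle of radius 2 rho bounds the n-th term on the disc of
  radius rho by B / 2^n, so the tail is geometric. The bound is linear in B: applied at fixed x with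
  B a multiple of exp (- b |x|), it carries the decay in x over to the remainder.\<close>

lemma entire_Taylor_partial_sum_bound:
  assumes hol: "f holomorphic_on UNIV" and "\<rho> > 0"
    and B: "\<And>z. cmod z \<le> 2 * \<rho> \<Longrightarrow> cmod (f z) \<le> B"
    and z: "cmod z \<le> \<rho>"
  shows "cmod ((\<Sum>n<N. z ^ n / fact n * (deriv ^^ n) f 0) - f z) \<le> 2 * B / 2 ^ N"
proof -
  have hol': "f holomorphic_on S" for S using hol holomorphic_on_subset by blast
  have co: "cmod ((deriv ^^ n) f 0) \<le> fact n * B / (2 * \<rho>) ^ n" for n
  proof (rule Cauchy_inequality)
    show "cmod (f x) \<le> B" if "cmod (0 - x) = 2 * \<rho>" for x
      using that by (intro B) simp
  qed (use \<open>\<rho> > 0\<close> in \<open>simp_all add: hol' holomorphic_on_imp_continuous_on\<close>)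
  have B0: "0 \<le> B" using order_trans[OF norm_ge_zero B[of 0]] \<open>\<rho> > 0\<close> by simp
  have le: "cmod (z ^ n / fact n * (deriv ^^ n) f 0) \<le> B * (1/2) ^ n" for n
  proof -
    have "cmod (z ^ n / fact n * (deriv ^^ n) f 0) = cmod z ^ n / fact n * cmod ((deriv ^^ n) f 0)"
      by (simp add: norm_mult norm_divide norm_power)
    also have "\<dots> \<le> \<rho> ^ n / fact n * (fact n * B / (2 * \<rho>) ^ n)"
      by (intro mult_mono divide_right_mono power_mono co z) (use \<open>\<rho> > 0\<close> in auto)
    also have "\<dots> = B * (1/2) ^ n"
      using \<open>\<rho> > 0\<close> by (simp add: power_mult_distrib power_divide field_simps)
    finally show ?thesis .
  qed
  have sums: "(\<lambda>n. z ^ n / fact n * (deriv ^^ n) f 0) sums f z"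
    by (rule entire_Taylor_sums[OF hol])
  have s2: "(\<lambda>n. z ^ (n + N) / fact (n + N) * (deriv ^^ (n + N)) f 0) sums
      (f z - (\<Sum>n<N. z ^ n / fact n * (deriv ^^ n) f 0))"
    using sums by (subst sums_iff_shift) simp
  have "(\<lambda>n. (1/2::real) ^ n) sums (1 / (1 - 1/2))"
    by (rule geometric_sums) simp
  from sums_mult[OF this, of "B * (1/2) ^ N"]
  have g: "(\<lambda>n. B * (1/2) ^ N * (1/2) ^ n) sums (2 * B / 2 ^ N)"
    by (simp add: power_divide mult_ac)
  have "cmod (\<Sum>n. z ^ (n + N) / fact (n + N) * (deriv ^^ (n + N)) f 0) \<le>
     (\<Sum>n. B * (1/2) ^ N * (1/2) ^ n)"
  proof (rule norm_suminf_le)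
    fix n
    show "cmod (z ^ (n + N) / fact (n + N) * (deriv ^^ (n + N)) f 0) \<le> B * (1/2) ^ N * (1/2) ^ n"
      using le[of "n + N"] by (simp only: power_add[of "1/2::real"] mult.assoc mult.commute[of "(1/2) ^ N"])
  qed (rule sums_summable[OF g])
  then show ?thesis
    unfolding sums_unique[OF g, symmetric] sums_unique[OF s2, symmetric]
    by (simp only: norm_minus_commute)
qed

text \<open>Leibniz' rule stops after two terms for an affine factor; for \<open>n = 0\<close> the
  factor \<open>of_nat n\<close> removes the term with the truncated index. The recurrences of the
  states come from this, since the logarithmic derivatives of the generating function in x and in z
  are affine in z.\<close>

lemma higher_deriv_affine_mult:
  assumes hol: "g holomorphic_on UNIV"
  shows "(deriv ^^ n) (\<lambda>z. (p + q * z) * g z) 0 =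
    p * (deriv ^^ n) g 0 + q * of_nat n * (deriv ^^ (n - 1)) g 0"
proof -
  have "(deriv ^^ n) (\<lambda>z. (p + q * z) * g z) z =
      (p + q * z) * (deriv ^^ n) g z + q * of_nat n * (deriv ^^ (n - 1)) g z" for z
  proof (induction n arbitrary: z)
    case 0 show ?case by simp
  next
    case (Suc n)
    have d: "((deriv ^^ k) g has_field_derivative (deriv ^^ Suc k) g z) (at z)" for k z
      using holomorphic_derivI[OF holomorphic_higher_deriv[OF hol open_UNIV, of k] open_UNIV, of z] by simp
    have eq: "(deriv ^^ n) (\<lambda>z. (p + q * z) * g z) =
      (\<lambda>z. (p + q * z) * (deriv ^^ n) g z + q * of_nat n * (deriv ^^ (n - 1)) g z)"
      by (rule ext) (rule Suc.IH)
    have d2: "((deriv ^^ (n - 1)) g has_field_derivative (if n = 0 then deriv g z else (deriv ^^ n) g z)) (at z)"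
      using d[of "n - 1"] by (cases n) auto
    have "((\<lambda>z. (p + q * z) * (deriv ^^ n) g z + q * of_nat n * (deriv ^^ (n - 1)) g z)
       has_field_derivative (p + q * z) * (deriv ^^ Suc n) g z + q * of_nat (Suc n) * (deriv ^^ n) g z) (at z)"
      using d[of n z] d2 by (auto intro!: derivative_eq_intros simp: algebra_simps)
    then show ?case using eq by (simp add: DERIV_imp_deriv)
  qed
  then show ?thesis by simp
qed

section \<open>Exponentially decaying functions\<close>

text \<open>A class stable under sums, products, conjugation and bounded continuous factors.
  Integrability, square integrability and the vanishing of boundary terms all reduce to membership
  in it.\<close>

definition edec :: "real \<Rightarrow> (real \<Rightarrow> complex) \<Rightarrow> bool" where
  "edec b f \<longleftrightarrow> continuous_on UNIV f \<and> (\<exists>C. \<forall>x. cmod (f x) \<le> C * exp (- b * \<bar>x\<bar>))"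

lemma edecI:
  assumes "continuous_on UNIV f" "\<And>x. cmod (f x) \<le> C * exp (- b * \<bar>x\<bar>)"
  shows "edec b f"
  using assms by (auto simp: edec_def)

lemma edecE:
  assumes "edec b f"
  obtains C where "C \<ge> 0" "\<And>x. cmod (f x) \<le> C * exp (- b * \<bar>x\<bar>)" "continuous_on UNIV f"
proof -
  from assms obtain C where C: "\<And>x. cmod (f x) \<le> C * exp (- b * \<bar>x\<bar>)" "continuous_on UNIV f"
    by (auto simp: edec_def)
  have "0 \<le> C" using C(1)[of 0] by (auto intro: order_trans[OF norm_ge_zero])
  then show thesis using C that by blast
qed

lemma edec_bounded_mult:
  assumes "edec b f" "continuous_on UNIV g" "\<And>x. cmod (g x) \<le> K"
  shows "edec b (\<lambda>x. g x * f x)"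
proof -
  from assms(1) obtain C where C: "C \<ge> 0" "\<And>x. cmod (f x) \<le> C * exp (- b * \<bar>x\<bar>)" "continuous_on UNIV f"
    by (rule edecE) blast
  have "0 \<le> K" using assms(3)[of 0] by (rule order_trans[OF norm_ge_zero])
  then have "cmod (g x * f x) \<le> (K * C) * exp (- b * \<bar>x\<bar>)" for x
    using mult_mono[OF assms(3)[of x] C(2)[of x]] by (simp add: norm_mult mult.assoc)
  then show ?thesis using assms(2) C(3) by (intro edecI continuous_intros)
qed

lemma edec_cmult: "edec b f \<Longrightarrow> edec b (\<lambda>x. c * f x)"
  by (rule edec_bounded_mult[where K="cmod c"]) auto

lemma edec_add:
  assumes "edec b f" "edec b g"
  shows "edec b (\<lambda>x. f x + g x)"
proof -
  obtain C where C: "\<And>x. cmod (f x) \<le> C * exp (- b * \<bar>x\<bar>)" "continuous_on UNIV f"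
    using assms(1) by (rule edecE) blast
  obtain D where D: "\<And>x. cmod (g x) \<le> D * exp (- b * \<bar>x\<bar>)" "continuous_on UNIV g"
    using assms(2) by (rule edecE) blast
  have "cmod (f x + g x) \<le> (C + D) * exp (- b * \<bar>x\<bar>)" for x
    using C(1)[of x] D(1)[of x] norm_triangle_ineq[of "f x" "g x"] by (simp add: distrib_right)
  then show ?thesis using C D by (intro edecI continuous_intros)
qed

lemma edec_diff: "edec b f \<Longrightarrow> edec b g \<Longrightarrow> edec b (\<lambda>x. f x - g x)"
  using edec_add[of b f "\<lambda>x. (-1) * g x"] edec_cmult[of b g "-1"] by simp

lemma edec_zero: "edec b (\<lambda>x. 0)"
  by (rule edecI[where C=0]) auto

lemma edec_sum:
  assumes "\<And>i. i \<in> A \<Longrightarrow> edec b (f i)"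
  shows "edec b (\<lambda>x. \<Sum>i\<in>A. f i x)"
  using assms by (induction A rule: infinite_finite_induct) (auto intro: edec_add edec_zero)

lemma edec_cnj: "edec b f \<Longrightarrow> edec b (\<lambda>x. cnj (f x))"
  by (auto simp: edec_def intro!: continuous_intros)

text \<open>One factor is used only as a bounded function, so that the product stays in the class of
  the same rate \<open>b\<close>.\<close>

lemma edec_mult:
  assumes "edec b f" "edec b g" "b \<ge> 0"
  shows "edec b (\<lambda>x. f x * g x)"
proof -
  obtain C where C: "C \<ge> 0" "\<And>x. cmod (f x) \<le> C * exp (- b * \<bar>x\<bar>)" "continuous_on UNIV f"
    using assms(1) by (rule edecE) blast
  have "cmod (f x) \<le> C" for x
  proof -
    have "C * exp (- b * \<bar>x\<bar>) \<le> C * 1" using C(1) \<open>b \<ge> 0\<close> by (intro mult_left_mono) auto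
    then show ?thesis using C(2)[of x] by simp
  qed
  then show ?thesis using assms(2) C(3) by (intro edec_bounded_mult)
qed

lemma edec_tanh:
  assumes "edec b f"
  shows "edec b (\<lambda>x. complex_of_real (tanh (a * x)) * f x)"
  by (rule edec_bounded_mult[OF assms, where K=1])
     (auto intro!: continuous_intros simp: abs_le_iff less_imp_le tanh_real_lt_1
        minus_le_iff[of "tanh _"] tanh_real_gt_neg1 cosh_real_nonzero simp flip: tanh_minus)

lemma edec_integrable:
  assumes "edec b f" "b > 0"
  shows "integrable lborel f"
proof -
  obtain C where C: "\<And>x. cmod (f x) \<le> C * exp (- b * \<bar>x\<bar>)" "continuous_on UNIV f"
    using assms(1) by (rule edecE) blast
  show ?thesis
  proof (rule Bochner_Integration.integrable_bound[OF integrable_mult_right[OF integrable_exp_neg_abs[OF \<open>b > 0\<close>], of C]])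
    show "f \<in> borel_measurable lborel" using borel_measurable_continuous_onI[OF C(2)] by simp
    show "AE x in lborel. cmod (f x) \<le> norm (C * exp (- b * \<bar>x\<bar>))"
      by (rule AE_I2) (rule order_trans[OF C(1)], simp)
  qed
qed

lemma edec_L2:
  assumes "edec b f" "b > 0"
  shows "L2 f"
proof -
  have "edec b (\<lambda>x. cnj (f x) * f x)" using assms by (intro edec_mult edec_cnj) auto
  then have "integrable lborel (\<lambda>x. cmod (cnj (f x) * f x))"
    using assms by (intro integrable_norm edec_integrable[where b=b])
  moreover have "f \<in> borel_measurable lborel"
    using borel_measurable_continuous_onI[of f] assms(1) by (simp add: edec_def)
  ultimately show ?thesis
    by (simp add: L2_def norm_mult power2_eq_square)
qed

lemma exp_abs_shift: "b \<ge> 0 \<Longrightarrow> \<bar>u\<bar> \<le> r \<Longrightarrow> exp (- b * \<bar>x + u\<bar>) \<le> exp (b * r) * exp (- b * \<bar>x\<bar>)" for b x u r :: real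
proof -
  assume b: "b \<ge> 0" and "\<bar>u\<bar> \<le> r"
  then have "b * \<bar>x\<bar> \<le> b * (r + \<bar>x + u\<bar>)" by (intro mult_left_mono) auto
  then show ?thesis by (simp add: exp_add[symmetric] distrib_left)
qed

text \<open>Integration by parts on the whole line without boundary terms. A translation by less
  than 1 costs only the factor exp b, which supplies the dominating function.\<close>

lemma edec_integral_derivative:
  assumes F: "edec b F" and F': "edec b F'" and b: "b > 0"
    and der: "\<And>x. (F has_vector_derivative F' x) (at x)"
  shows "(LINT x|lborel. F' x) = 0"
proof -
  obtain C where C: "C \<ge> 0" "\<And>x. cmod (F' x) \<le> C * exp (- b * \<bar>x\<bar>)"
    using F' by (rule edecE) blast
  show ?thesis
  proof (rule integral_directional_derivative_eq_0[where F=F and v=1 and g="\<lambda>x. C * exp b * exp (- b * \<bar>x\<bar>)"])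
    show "((\<lambda>h. F (y + h *\<^sub>R 1)) has_vector_derivative F' (y + h *\<^sub>R 1)) (at h)" for y h
    proof -
      have "((\<lambda>h. y + h) has_vector_derivative 1) (at h)"
        by (auto intro!: derivative_eq_intros)
      from vector_diff_chain_at[OF this der] show ?thesis by (simp add: comp_def)
    qed
    show "norm (F' (y + h *\<^sub>R 1)) \<le> C * exp b * exp (- b * \<bar>y\<bar>)" if "\<bar>h\<bar> < 1" for y h
    proof -
      have "C * exp (- b * \<bar>y + h\<bar>) \<le> C * (exp (b * 1) * exp (- b * \<bar>y\<bar>))"
        using that b C(1) by (intro mult_left_mono exp_abs_shift) auto
      then show ?thesis using C(2)[of "y + h"] by (simp add: mult.assoc)
    qed
  qed (use edec_integrable[OF F b] integrable_exp_neg_abs[OF b] in auto)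
qed

section \<open>One-sided exponential convolutions\<close>

definition Jt :: "real \<Rightarrow> real \<Rightarrow> (real \<Rightarrow> complex) \<Rightarrow> real \<Rightarrow> complex" where
  "Jt a \<sigma> h x = (LINT u:{0..}|lborel. exp (- a * u) *\<^sub>R h (x - \<sigma> * u))"

text \<open>By the triangle inequality, half of the decay in \<open>u\<close> is traded for decay in
  \<open>x\<close>, and the other half is left for the integration over \<open>u\<close>. This is
  the origin of the rate a/2.\<close>

lemma weighted_decay:
  fixes a u x \<sigma> :: real
  assumes "u \<ge> 0" "\<bar>\<sigma>\<bar> = 1" "a > 0"
  shows "exp (- a * u) * exp (- (a/2) * \<bar>x - \<sigma> * u\<bar>) \<le> exp (- (a/2) * \<bar>x\<bar>) * exp (- (a/2) * u)"
proof -
  have "\<bar>\<sigma> * u\<bar> = u" using assms by (simp add: abs_mult)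
  then have "(a/2) * \<bar>x\<bar> \<le> (a/2) * (\<bar>x - \<sigma> * u\<bar> + u)" using assms by (intro mult_left_mono) auto
  then show ?thesis by (simp add: exp_add[symmetric] field_simps)
qed

lemma Jt_integrable:
  assumes "continuous_on UNIV h" "\<And>x. cmod (h x) \<le> C * exp (- (a/2) * \<bar>x\<bar>)" "a > 0" "\<bar>\<sigma>\<bar> = 1"
  shows "set_integrable lborel {0..} (\<lambda>u. exp (- a * u) *\<^sub>R h (x - \<sigma> * u))"
proof -
  have C: "0 \<le> C" using assms(2)[of 0] by (auto intro: order_trans[OF norm_ge_zero])
  have m: "(\<lambda>u. exp (- a * u) *\<^sub>R h (x - \<sigma> * u)) \<in> borel_measurable borel"
    by (intro borel_measurable_continuous_onI continuous_intros continuous_on_compose2[OF assms(1)]) auto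
  show ?thesis
    unfolding set_integrable_def
  proof (rule Bochner_Integration.integrable_bound)
    show "integrable lborel (\<lambda>u. indicator {0..} u *\<^sub>R (C * exp (- (a/2) * u)))"
      using set_integrable_mult_right[OF exp_neg_Ici(1)[of "a/2" 0], of C] \<open>a > 0\<close>
      by (simp add: set_integrable_def)
    show "AE u in lborel. norm (indicator {0..} u *\<^sub>R exp (- a * u) *\<^sub>R h (x - \<sigma> * u))
       \<le> norm (indicator {0..} u *\<^sub>R (C * exp (- (a/2) * u)))"
    proof (rule AE_I2)
      fix u :: real
      show "norm (indicator {0..} u *\<^sub>R exp (- a * u) *\<^sub>R h (x - \<sigma> * u))
       \<le> norm (indicator {0..} u *\<^sub>R (C * exp (- (a/2) * u)))"
      proof (cases "u \<ge> 0")
        case True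
        have "exp (- a * u) * cmod (h (x - \<sigma> * u)) \<le> exp (- a * u) * (C * exp (- (a/2) * \<bar>x - \<sigma> * u\<bar>))"
          by (intro mult_left_mono assms(2)) auto
        also have "\<dots> \<le> C * (exp (- (a/2) * \<bar>x\<bar>) * exp (- (a/2) * u))"
          using mult_left_mono[OF weighted_decay[OF True assms(4,3), of x] C] by (simp add: mult_ac)
        also have "\<dots> \<le> C * (1 * exp (- (a/2) * u))"
          using C \<open>a > 0\<close> by (intro mult_left_mono mult_right_mono) auto
        finally show ?thesis using True C by (simp add: abs_mult)
      qed simp
    qed
    show "(\<lambda>u. indicat_real {0..} u *\<^sub>R exp (- a * u) *\<^sub>R h (x - \<sigma> * u)) \<in> borel_measurable lborel"
      using borel_measurable_scaleR[OF _ m, of "indicator {0..}"] by simp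
  qed
qed

text \<open>The lower limit \<open>R\<close> serves two purposes: \<open>R = 0\<close> bounds
  \<open>Jt\<close> itself, and a large \<open>R\<close> makes the truncated tail small in the
  weighted sup norm.\<close>

lemma Jt_bound:
  assumes "continuous_on UNIV h" "\<And>x. cmod (h x) \<le> C * exp (- (a/2) * \<bar>x\<bar>)" "a > 0" "\<bar>\<sigma>\<bar> = 1" "R \<ge> 0"
  shows "cmod (LINT u:{R..}|lborel. exp (- a * u) *\<^sub>R h (x - \<sigma> * u))
      \<le> C * (2 / a) * exp (- (a/2) * R) * exp (- (a/2) * \<bar>x\<bar>)"
proof -
  have C: "0 \<le> C" using assms(2)[of 0] by (auto intro: order_trans[OF norm_ge_zero])
  have i: "set_integrable lborel {R..} (\<lambda>u. exp (- a * u) *\<^sub>R h (x - \<sigma> * u))"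
    by (rule set_integrable_subset[OF Jt_integrable[OF assms(1-4), of x]]) (use \<open>R \<ge> 0\<close> in auto)
  have e: "set_integrable lborel {R..} (\<lambda>u. exp (- (a/2) * u))"
    by (rule exp_neg_Ici) (use \<open>a > 0\<close> in auto)
  have "cmod (LINT u:{R..}|lborel. exp (- a * u) *\<^sub>R h (x - \<sigma> * u))
     \<le> (LINT u:{R..}|lborel. norm (exp (- a * u) *\<^sub>R h (x - \<sigma> * u)))"
    by (rule set_integral_norm_bound[OF i])
  also have "\<dots> \<le> (LINT u:{R..}|lborel. C * exp (- (a/2) * \<bar>x\<bar>) * exp (- (a/2) * u))"
  proof (rule set_integral_mono)
    show "set_integrable lborel {R..} (\<lambda>u. C * exp (- (a/2) * \<bar>x\<bar>) * exp (- (a/2) * u))"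
      using e by simp
    fix u assume "u \<in> {R..}"
    then have u: "u \<ge> 0" using \<open>R \<ge> 0\<close> by auto
    have "exp (- a * u) * cmod (h (x - \<sigma> * u)) \<le> exp (- a * u) * (C * exp (- (a/2) * \<bar>x - \<sigma> * u\<bar>))"
      by (intro mult_left_mono assms(2)) auto
    also have "\<dots> \<le> C * (exp (- (a/2) * \<bar>x\<bar>) * exp (- (a/2) * u))"
      using mult_left_mono[OF weighted_decay[OF u assms(4,3), of x] C] by (simp add: mult_ac)
    finally show "norm (exp (- a * u) *\<^sub>R h (x - \<sigma> * u)) \<le> C * exp (- (a/2) * \<bar>x\<bar>) * exp (- (a/2) * u)"
      by (simp add: mult.assoc)
  qed (use i in \<open>rule set_integrable_norm\<close>)
  also have "\<dots> = C * exp (- (a/2) * \<bar>x\<bar>) * (exp (- (a/2) * R) / (a/2))"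
    using exp_neg_Ici(2)[of "a/2" R] \<open>a > 0\<close> by simp
  finally show ?thesis by (simp add: mult_ac)
qed

text \<open>Integrate the u-derivative of exp (- a u) h (x - sigma u) over the half-line. As
  \<open>Jt\<close> commutes with d/dx, this is the first-order equation J' = sigma (h - a J); the
  two signs belong to the two factors of a^2 - d^2/dx^2.\<close>

lemma Jt_derivative_eq:
  assumes h: "edec (a/2) h" and h': "edec (a/2) h'" and "a > 0" "\<bar>\<sigma>\<bar> = 1"
    and der: "\<And>x. (h has_vector_derivative h' x) (at x)"
  shows "Jt a \<sigma> h' x = complex_of_real \<sigma> * (h x - complex_of_real a * Jt a \<sigma> h x)"
proof -
  obtain C where C: "C \<ge> 0" "\<And>x. cmod (h x) \<le> C * exp (- (a/2) * \<bar>x\<bar>)" "continuous_on UNIV h"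
    using h by (rule edecE) blast
  obtain D where D: "D \<ge> 0" "\<And>x. cmod (h' x) \<le> D * exp (- (a/2) * \<bar>x\<bar>)" "continuous_on UNIV h'"
    using h' by (rule edecE) blast
  have s2: "\<sigma> * \<sigma> = 1" using \<open>\<bar>\<sigma>\<bar> = 1\<close> by (auto simp: abs_if split: if_splits)
  have i1: "set_integrable lborel {0..} (\<lambda>u. exp (- a * u) *\<^sub>R h (x - \<sigma> * u))"
    by (rule Jt_integrable[OF C(3,2)]) fact+
  have i2: "set_integrable lborel {0..} (\<lambda>u. exp (- a * u) *\<^sub>R h' (x - \<sigma> * u))"
    by (rule Jt_integrable[OF D(3,2)]) fact+
  let ?F = "\<lambda>u. exp (- a * u) *\<^sub>R h (x - \<sigma> * u)"
  let ?f = "\<lambda>u. (- complex_of_real a) * (exp (- a * u) *\<^sub>R h (x - \<sigma> * u)) + (- complex_of_real \<sigma>) * (exp (- a * u) *\<^sub>R h' (x - \<sigma> * u))"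
  have "(LINT u:{0..}|lborel. ?f u) = - ?F 0"
  proof (rule integral_Ici_FTC)
    show "(?F has_vector_derivative ?f u) (at u)" for u
    proof -
      have "((\<lambda>u. h (x - \<sigma> * u)) has_vector_derivative (- \<sigma>) *\<^sub>R h' (x - \<sigma> * u)) (at u)"
      proof -
        have "((\<lambda>u. x - \<sigma> * u) has_vector_derivative - \<sigma>) (at u)"
          by (auto intro!: derivative_eq_intros)
        from vector_diff_chain_at[OF this der] show ?thesis by (simp add: comp_def)
      qed
      moreover have "((\<lambda>u. exp (- a * u)) has_field_derivative exp (- a * u) * (- a)) (at u)"
        by (auto intro!: derivative_eq_intros)
      ultimately show ?thesis
        by (intro has_vector_derivative_eq_rhs[OF has_vector_derivative_scaleR])
           (auto simp: scaleR_conv_of_real algebra_simps)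
    qed
    show "continuous_on UNIV ?f"
      by (intro continuous_intros continuous_on_compose2[OF C(3)] continuous_on_compose2[OF D(3)]) auto
    show "set_integrable lborel {0..} ?f"
      using i1 i2 by (intro set_integral_add set_integrable_mult_right) auto
    show "(?F \<longlongrightarrow> 0) at_top"
    proof (rule Lim_null_comparison)
      show "\<forall>\<^sub>F u in at_top. norm (?F u) \<le> C * exp (- (a * u))"
      proof (rule always_eventually, rule allI)
        fix u
        have "C * exp (- (a/2) * \<bar>x - \<sigma> * u\<bar>) \<le> C * 1"
          using C(1) \<open>a > 0\<close> by (intro mult_left_mono) auto
        then have "cmod (h (x - \<sigma> * u)) \<le> C" using C(2)[of "x - \<sigma> * u"] by simp
        then show "norm (?F u) \<le> C * exp (- (a * u))" by (simp add: mult.commute)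
      qed
      have "((\<lambda>u. exp (- (a * u))) \<longlongrightarrow> 0) at_top"
        using \<open>a > 0\<close>
        by (intro filterlim_compose[OF exp_at_bot])
           (auto simp: filterlim_uminus_at_bot intro!: filterlim_tendsto_pos_mult_at_top filterlim_ident)
      then show "((\<lambda>u. C * exp (- (a * u))) \<longlongrightarrow> 0) at_top"
        by (rule tendsto_mult_right_zero)
    qed
  qed
  moreover have "(LINT u:{0..}|lborel. ?f u) = - complex_of_real a * Jt a \<sigma> h x - complex_of_real \<sigma> * Jt a \<sigma> h' x"
    unfolding Jt_def
    by (subst set_integral_add(2)[OF set_integrable_mult_right[OF i1] set_integrable_mult_right[OF i2]])
       (simp only: set_integral_mult_right, simp)
  ultimately have "complex_of_real \<sigma> * Jt a \<sigma> h' x = h x - complex_of_real a * Jt a \<sigma> h x"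
    by (simp add: algebra_simps)
  then have "complex_of_real (\<sigma> * \<sigma>) * Jt a \<sigma> h' x = complex_of_real \<sigma> * (h x - complex_of_real a * Jt a \<sigma> h x)"
    by (simp add: mult.assoc)
  then show ?thesis by (simp add: s2)
qed

text \<open>Serves two kinds of parameter: a translation of the argument, which yields the space
  derivative, and the time.\<close>

lemma Jt_param_derivative:
  assumes cont: "\<And>\<tau>. \<bar>\<tau> - \<tau>0\<bar> < 1 \<Longrightarrow> continuous_on UNIV (H \<tau>)"
    and bd: "\<And>\<tau> x. \<bar>\<tau> - \<tau>0\<bar> < 1 \<Longrightarrow> cmod (H \<tau> x) \<le> C * exp (- (a/2) * \<bar>x\<bar>)"
    and bd': "\<And>\<tau> x. \<bar>\<tau> - \<tau>0\<bar> < 1 \<Longrightarrow> cmod (H' \<tau> x) \<le> C * exp (- (a/2) * \<bar>x\<bar>)"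
    and der: "\<And>\<tau> x. \<bar>\<tau> - \<tau>0\<bar> < 1 \<Longrightarrow> ((\<lambda>\<tau>. H \<tau> x) has_vector_derivative H' \<tau> x) (at \<tau>)"
    and "a > 0" "\<bar>\<sigma>\<bar> = 1"
  shows "((\<lambda>\<tau>. Jt a \<sigma> (H \<tau>) x) has_vector_derivative Jt a \<sigma> (H' \<tau>0) x) (at \<tau>0)"
  unfolding Jt_def set_lebesgue_integral_def
proof (rule has_vector_derivative_integral_dominated[where e=1 and g="\<lambda>u. indicator {0..} u *\<^sub>R (C * exp (- a * u))"])
  have C: "0 \<le> C" using bd[of \<tau>0 0] by (auto intro: order_trans[OF norm_ge_zero])
  show "integrable lborel (\<lambda>u. indicat_real {0..} u *\<^sub>R exp (- a * u) *\<^sub>R H h (x - \<sigma> * u))" if "\<bar>h - \<tau>0\<bar> < 1" for h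
    using Jt_integrable[OF cont[OF that] bd[OF that] \<open>a > 0\<close> \<open>\<bar>\<sigma>\<bar> = 1\<close>] by (simp add: set_integrable_def)
  show "((\<lambda>h. indicat_real {0..} y *\<^sub>R exp (- a * y) *\<^sub>R H h (x - \<sigma> * y)) has_vector_derivative
       indicat_real {0..} y *\<^sub>R exp (- a * y) *\<^sub>R H' h (x - \<sigma> * y)) (at h)" if "\<bar>h - \<tau>0\<bar> < 1" for h y
    using bounded_linear.has_vector_derivative[OF bounded_linear_scaleR_right
        bounded_linear.has_vector_derivative[OF bounded_linear_scaleR_right der[OF that]]] .
  show "norm (indicat_real {0..} y *\<^sub>R exp (- a * y) *\<^sub>R H' h (x - \<sigma> * y))
       \<le> indicat_real {0..} y *\<^sub>R (C * exp (- a * y))" if "\<bar>h - \<tau>0\<bar> < 1" for h y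
  proof -
    have "C * exp (- (a/2) * \<bar>x - \<sigma> * y\<bar>) \<le> C * 1"
      using C \<open>a > 0\<close> by (intro mult_left_mono) auto
    then have "cmod (H' h (x - \<sigma> * y)) \<le> C" using bd'[OF that, of "x - \<sigma> * y"] by simp
    then show ?thesis by (auto simp: indicator_def mult.commute)
  qed
  show "integrable lborel (\<lambda>u. indicat_real {0..} u *\<^sub>R (C * exp (- a * u)))"
    using set_integrable_mult_right[OF exp_neg_Ici(1)[OF \<open>a > 0\<close>, of 0], of C]
    by (simp add: set_integrable_def)
qed simp

section \<open>The generating function of the states\<close>

text \<open>With this factor A = i sc d/dx + i x / 2 and A^+ = i cnj sc d/dx - i x / 2. It is also
  the complex time in which the Gaussian solves the heat equation.\<close>

definition sc :: "real \<Rightarrow> complex" where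
  "sc t = 1 + \<i> * complex_of_real t"

text \<open>In closed form the sum of z^n / n! (A^+)^n psi_0, that is, the coherent state without
  its factor exp (- |z|^2 / 2), which would spoil holomorphy in z.\<close>

definition gen :: "complex \<Rightarrow> real \<Rightarrow> real \<Rightarrow> complex" where
  "gen z x t = psi0 x t * exp (- (\<i> * complex_of_real x * z) / sc t + (2 / sc t - 1) * z\<^sup>2 / 2)"

text \<open>The logarithmic derivative of \<open>gen\<close> in x; its own x-derivative is - 1 / (2
  sc t).\<close>

definition lgen :: "complex \<Rightarrow> real \<Rightarrow> real \<Rightarrow> complex" where
  "lgen z x t = - complex_of_real x / (2 * sc t) + (- \<i> / sc t) * z"

text \<open>\<open>gend j\<close> is the \<open>j\<close>-th space derivative of \<open>gen\<close>, for \<open>j = 0, 1, 2\<close>.\<close>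

definition gend :: "nat \<Rightarrow> complex \<Rightarrow> real \<Rightarrow> real \<Rightarrow> complex" where
  "gend j z x t = (if j = 0 then 1 else if j = 1 then lgen z x t
     else (lgen z x t)\<^sup>2 - 1 / (2 * sc t)) * gen z x t"

lemma gend_simps:
  "gend 0 z x t = gen z x t"
  "gend 1 z x t = lgen z x t * gen z x t"
  "gend (Suc 0) z x t = lgen z x t * gen z x t"
  "gend 2 z x t = ((lgen z x t)\<^sup>2 - 1 / (2 * sc t)) * gen z x t"
  by (simp_all add: gend_def)

lemma sc_nonzero [simp]: "sc t \<noteq> 0"
  by (simp add: sc_def complex_eq_iff)

lemma norm_sc_ge_1: "1 \<le> cmod (sc t)"
  by (simp add: sc_def cmod_def)

lemma cnj_sc: "cnj (sc t) = 2 - sc t"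
  by (simp add: sc_def)

text \<open>The coefficient equals cnj (sc t) / sc t, so the quadratic term in z is bounded
  uniformly in time.\<close>

lemma norm_sc_coefficient: "cmod (2 / sc t - 1) = 1"
proof -
  have "2 / sc t - 1 = cnj (sc t) / sc t" by (simp add: cnj_sc diff_divide_distrib)
  then show ?thesis by (simp add: norm_divide)
qed

lemma gen_eq_exp:
  "gen z x t = complex_of_real ((2 * pi) powr (-1/4)) / csqrt (sc t)
     * exp (- (complex_of_real x)\<^sup>2 / (4 * sc t) - \<i> * complex_of_real x * z / sc t + (2 / sc t - 1) * z\<^sup>2 / 2)"
  by (simp add: gen_def psi0_def sc_def mult.assoc exp_add[symmetric] algebra_simps)

lemma gend_has_vector_derivative_space:
  "((\<lambda>x. gen z x t) has_vector_derivative gend 1 z x t) (at x)"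
  "((\<lambda>x. gend 1 z x t) has_vector_derivative gend 2 z x t) (at x)"
proof -
  let ?l = "\<lambda>w. - w / (2 * sc t) + (- \<i> / sc t) * z"
  let ?g = "\<lambda>w. complex_of_real ((2 * pi) powr (-1/4)) / csqrt (sc t)
     * exp (- w\<^sup>2 / (4 * sc t) - \<i> * w * z / sc t + (2 / sc t - 1) * z\<^sup>2 / 2)"
  have e: "((\<lambda>w. - w\<^sup>2 / (4 * sc t) - \<i> * w * z / sc t + (2 / sc t - 1) * z\<^sup>2 / 2) has_field_derivative ?l w) (at w)" for w
    by (auto intro!: derivative_eq_intros simp: field_simps)
  have g: "(?g has_field_derivative ?l w * ?g w) (at w)" for w
    by (rule DERIV_cong[OF DERIV_cmult[OF DERIV_fun_exp[OF e]]]) simp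
  have l: "(?l has_field_derivative - 1 / (2 * sc t)) (at w)" for w
    by (auto intro!: derivative_eq_intros)
  show "((\<lambda>x. gen z x t) has_vector_derivative gend 1 z x t) (at x)"
    using has_vector_derivative_real_field[OF g, of x] by (simp add: gen_eq_exp gend_simps lgen_def)
  have "((\<lambda>w. ?l w * ?g w) has_field_derivative ((?l w)\<^sup>2 - 1 / (2 * sc t)) * ?g w) (at w)" for w
  proof (rule DERIV_cong[OF DERIV_mult[OF l g]])
    have "- 1 / (2 * sc t) * G + L * G * L = (L\<^sup>2 - 1 / (2 * sc t)) * G" for L G
      by (simp add: power2_eq_square algebra_simps)
    then show "- 1 / (2 * sc t) * ?g w + ?l w * ?g w * ?l w = ((?l w)\<^sup>2 - 1 / (2 * sc t)) * ?g w" .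
  qed
  from has_vector_derivative_real_field[OF this, of x]
  show "((\<lambda>x. gend 1 z x t) has_vector_derivative gend 2 z x t) (at x)"
    by (simp add: gen_eq_exp gend_simps lgen_def)
qed

text \<open>As a function of x and of a complex time s the Gaussian solves the heat equation: the
  s-derivative has the prefactor of the second x-derivative. Setting s = 1 + i t gives the free
  Schroedinger equation, and Re s = 1 stays away from the branch cut of the square root.\<close>

lemma csqrt_exp_has_field_derivative:
  assumes "s \<notin> \<real>\<^sub>\<le>\<^sub>0"
  shows "((\<lambda>s. K / csqrt s * exp (- X\<^sup>2 / (4 * s) - \<i> * X * z / s + (2 / s - 1) * z\<^sup>2 / 2)) has_field_derivative
    ((- X / (2 * s) + (- \<i> / s) * z)\<^sup>2 - 1 / (2 * s)) *
      (K / csqrt s * exp (- X\<^sup>2 / (4 * s) - \<i> * X * z / s + (2 / s - 1) * z\<^sup>2 / 2))) (at s)"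
proof -
  have nz: "s \<noteq> 0" using assms by auto
  have e: "((\<lambda>s. - A / (4 * s) - B / s + (2 / s - 1) * C / 2) has_field_derivative
      (A / 4 + B - C) / s\<^sup>2) (at s)" for A B C
    using nz by (auto intro!: derivative_eq_intros simp: field_simps power2_eq_square)
  have sq: "(- X / (2 * s) + (- \<i> / s) * z)\<^sup>2 = (X\<^sup>2 / 4 + \<i> * X * z - z\<^sup>2) / s\<^sup>2"
  proof -
    have "- X / (2 * s) + (- \<i> / s) * z = - (X / 2 + \<i> * z) / s" using nz by (simp add: field_simps)
    then show ?thesis by (simp add: power_divide power2_eq_square algebra_simps)
  qed
  have "((\<lambda>s. K / csqrt s) has_field_derivative - (K / csqrt s * (1 / (2 * s)))) (at s)"
  proof (rule DERIV_cong[OF DERIV_divide[OF DERIV_const has_field_derivative_csqrt[OF assms]]])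
    show "csqrt s \<noteq> 0" using nz by simp
    show "(0 * csqrt s - K * inverse (2 * csqrt s)) / (csqrt s * csqrt s) = - (K / csqrt s * (1 / (2 * s)))"
      using nz by (simp add: power2_eq_square[symmetric] field_simps)
  qed
  from DERIV_mult[OF this DERIV_fun_exp[OF e[of "X\<^sup>2" "\<i> * X * z" "z\<^sup>2"]]]
  show ?thesis
  proof (rule DERIV_cong)
    have "- (G * H) * E + E * L * G = (L - H) * (G * E)" for G H E L :: complex
      by (simp add: algebra_simps)
    then show "- (K / csqrt s * (1 / (2 * s))) * exp (- X\<^sup>2 / (4 * s) - \<i> * X * z / s + (2 / s - 1) * z\<^sup>2 / 2) +
      exp (- X\<^sup>2 / (4 * s) - \<i> * X * z / s + (2 / s - 1) * z\<^sup>2 / 2) * ((X\<^sup>2 / 4 + \<i> * X * z - z\<^sup>2) / s\<^sup>2) * (K / csqrt s) =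
      ((- X / (2 * s) + (- \<i> / s) * z)\<^sup>2 - 1 / (2 * s)) *
      (K / csqrt s * exp (- X\<^sup>2 / (4 * s) - \<i> * X * z / s + (2 / s - 1) * z\<^sup>2 / 2))"
      unfolding sq .
  qed
qed

lemma gen_has_vector_derivative_time:
  "((\<lambda>t. gen z x t) has_vector_derivative \<i> * gend 2 z x t) (at t)"
proof -
  have ns: "sc t \<notin> \<real>\<^sub>\<le>\<^sub>0" by (simp add: complex_nonpos_Reals_iff sc_def)
  have s: "(sc has_vector_derivative \<i>) (at t)"
  proof -
    have "((\<lambda>w. 1 + \<i> * w) has_field_derivative \<i>) (at (complex_of_real t))"
      by (auto intro!: derivative_eq_intros)
    from has_vector_derivative_real_field[OF this] show ?thesis by (simp add: sc_def[abs_def])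
  qed
  have "(\<lambda>t. gen z x t) = (\<lambda>s. complex_of_real ((2 * pi) powr (-1/4)) / csqrt s * exp (- (complex_of_real x)\<^sup>2 / (4 * s)
      - \<i> * complex_of_real x * z / s + (2 / s - 1) * z\<^sup>2 / 2)) \<circ> sc"
    by (simp add: fun_eq_iff gen_eq_exp)
  then show ?thesis
    using field_vector_diff_chain_at[OF s csqrt_exp_has_field_derivative[OF ns, of "complex_of_real ((2 * pi) powr (-1/4))" "complex_of_real x" z]]
    by (simp add: gend_simps lgen_def gen_eq_exp)
qed

section \<open>Decay and regularity of the generating function and its Taylor coefficients\<close>

lemma gend_continuous: "j \<le> 2 \<Longrightarrow> continuous_on UNIV (\<lambda>x. gend j z x t)"
  unfolding gend_def lgen_def gen_eq_exp by (cases "j = 0"; cases "j = 1") (auto intro!: continuous_intros)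

lemma gend_bound:
  fixes b T r :: real
  obtains C where "C \<ge> 0" "\<And>j z x t. cmod z \<le> r \<Longrightarrow> \<bar>t\<bar> \<le> T \<Longrightarrow> cmod (gend j z x t) \<le> C * exp (- b * \<bar>x\<bar>)"
proof -
  \<comment> \<open>The smallest Gaussian rate Re (1 / (4 sc t)) over |t| \<le> T.\<close>
  define q where "q = 1 / (4 * (1 + T\<^sup>2))"
  \<comment> \<open>Collects the linear rates in |x|: r from the cross term with z, b from the
    desired weight, 2 from bounding the quadratic prefactor by exp (2 |x|). Completing the square
    against q x^2 then costs m^2 / (4 q).\<close>
  define m where "m = \<bar>r\<bar> + \<bar>b\<bar> + 2"
  have q: "q > 0" by (simp add: q_def add_pos_nonneg)
  define C where "C = ((1 + \<bar>r\<bar>)\<^sup>2 + 1) * exp (m\<^sup>2 / (4 * q) + r\<^sup>2 / 2)"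
  have "cmod (gend j z x t) \<le> C * exp (- b * \<bar>x\<bar>)" if z: "cmod z \<le> r" and t: "\<bar>t\<bar> \<le> T" for j z x t
  proof -
    have r: "r \<ge> 0" using z norm_ge_zero order_trans by blast
    have "(2 * pi) powr (-1/4) \<le> 1"
      using powr_mono[of "-1/4" 0 "2 * pi"] pi_ge_two by simp
    moreover have "1 \<le> cmod (csqrt (sc t))"
      using norm_sc_ge_1[of t] by (simp add: norm_csqrt)
    ultimately have "(2 * pi) powr (-1/4) / cmod (csqrt (sc t)) \<le> 1"
      by (subst divide_le_eq_1_pos) linarith+
    then have k: "cmod (complex_of_real ((2 * pi) powr (-1/4)) / csqrt (sc t)) \<le> 1"
      by (simp add: norm_divide)
    have re: "Re (1 / sc t) = 1 / (1 + t\<^sup>2)" by (simp add: sc_def Re_divide power2_eq_square)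
    have "Re (- (complex_of_real x)\<^sup>2 / (4 * sc t)) = - x\<^sup>2 / 4 * Re (1 / sc t)"
    proof -
      have "- (complex_of_real x)\<^sup>2 / (4 * sc t) = complex_of_real (- x\<^sup>2 / 4) * (1 / sc t)" by simp
      moreover have "Re (complex_of_real u * w) = u * Re w" for u w by simp
      ultimately show ?thesis by (simp only:)
    qed
    also have "\<dots> \<le> - q * x\<^sup>2"
    proof -
      have "1 / (1 + T\<^sup>2) \<le> 1 / (1 + t\<^sup>2)"
        using t by (intro divide_left_mono) (auto simp: abs_le_square_iff[symmetric] add_pos_nonneg)
      then have "x\<^sup>2 / 4 * (1 / (1 + T\<^sup>2)) \<le> x\<^sup>2 / 4 * (1 / (1 + t\<^sup>2))" by (intro mult_left_mono) auto
      then show ?thesis unfolding re q_def by (simp add: mult_ac)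
    qed
    finally have r1: "Re (- (complex_of_real x)\<^sup>2 / (4 * sc t)) \<le> - q * x\<^sup>2" .
    have r2: "- Re (\<i> * complex_of_real x * z / sc t) \<le> r * \<bar>x\<bar>"
    proof -
      have "cmod (\<i> * complex_of_real x * z / sc t) = \<bar>x\<bar> * cmod z / cmod (sc t)" by (simp add: norm_mult norm_divide)
      also have "\<dots> \<le> \<bar>x\<bar> * cmod z / 1" using norm_sc_ge_1[of t] by (intro divide_left_mono) auto
      also have "\<dots> \<le> r * \<bar>x\<bar>" using mult_right_mono[OF z, of "\<bar>x\<bar>"] by (simp add: mult.commute)
      finally show ?thesis using abs_Re_le_cmod[of "\<i> * complex_of_real x * z / sc t"] by linarith
    qed
    have r3: "Re ((2 / sc t - 1) * z\<^sup>2 / 2) \<le> r\<^sup>2 / 2"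
    proof -
      have "cmod ((2 / sc t - 1) * z\<^sup>2 / 2) = (cmod z)\<^sup>2 / 2" by (simp add: norm_mult norm_divide norm_power norm_sc_coefficient)
      also have "\<dots> \<le> r\<^sup>2 / 2" using z by (simp add: power_mono)
      finally show ?thesis using complex_Re_le_cmod order_trans by blast
    qed
    have g: "cmod (gen z x t) \<le> exp (- q * x\<^sup>2 + r * \<bar>x\<bar> + r\<^sup>2 / 2)"
    proof -
      have "cmod (gen z x t) \<le> 1 * exp (- q * x\<^sup>2 + r * \<bar>x\<bar> + r\<^sup>2 / 2)"
        unfolding gen_eq_exp norm_mult
      proof (rule mult_mono[OF k])
        show "cmod (exp (- (complex_of_real x)\<^sup>2 / (4 * sc t) - \<i> * complex_of_real x * z / sc t + (2 / sc t - 1) * z\<^sup>2 / 2))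
          \<le> exp (- q * x\<^sup>2 + r * \<bar>x\<bar> + r\<^sup>2 / 2)"
          unfolding norm_exp_eq_Re exp_le_cancel_iff plus_complex.sel minus_complex.sel using r1 r2 r3 by linarith
      qed auto
      then show ?thesis by simp
    qed
    have l: "cmod (lgen z x t) \<le> (1 + r) * exp \<bar>x\<bar>"
    proof -
      have "cmod (- complex_of_real x / (2 * sc t)) = \<bar>x\<bar> / (2 * cmod (sc t))" by (simp add: norm_divide norm_mult)
      also have "\<dots> \<le> \<bar>x\<bar> / 1" using norm_sc_ge_1[of t] by (intro divide_left_mono) auto
      finally have 1: "cmod (- complex_of_real x / (2 * sc t)) \<le> \<bar>x\<bar>" by simp
      have "cmod (- \<i> / sc t * z) = cmod z / cmod (sc t)" by (simp add: norm_divide norm_mult)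
      also have "\<dots> \<le> cmod z / 1" using norm_sc_ge_1[of t] by (intro divide_left_mono) auto
      finally have 2: "cmod (- \<i> / sc t * z) \<le> r" using z by simp
      have 3: "\<bar>x\<bar> \<le> exp \<bar>x\<bar>" "1 \<le> exp \<bar>x\<bar>" using exp_ge_add_one_self[of "\<bar>x\<bar>"] abs_ge_zero[of x] by linarith+
      have "r * 1 \<le> r * exp \<bar>x\<bar>" by (rule mult_left_mono[OF 3(2) r])
      then show ?thesis using norm_triangle_ineq[of "- complex_of_real x / (2 * sc t)" "- \<i> / sc t * z"] 1 2 3
        by (simp add: lgen_def distrib_right)
    qed
    have f: "cmod (if j = 0 then 1 else if j = 1 then lgen z x t else (lgen z x t)\<^sup>2 - 1 / (2 * sc t))
        \<le> ((1 + \<bar>r\<bar>)\<^sup>2 + 1) * exp (2 * \<bar>x\<bar>)"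
    proof -
      have e: "exp (2 * \<bar>x\<bar>) = (exp \<bar>x\<bar>)\<^sup>2" by (simp add: exp_double)
      have e1: "1 \<le> exp \<bar>x\<bar>" by simp
      have big: "1 \<le> (1 + r) * exp \<bar>x\<bar>" using mult_mono[of 1 "1 + r" 1 "exp \<bar>x\<bar>"] r by simp
      have sq: "(cmod (lgen z x t))\<^sup>2 \<le> ((1 + r) * exp \<bar>x\<bar>)\<^sup>2" by (rule power_mono[OF l]) simp
      have e2: "1 \<le> (exp \<bar>x\<bar>)\<^sup>2" using e1 by (simp add: one_le_power)
      have bb: "(1 + r) * exp \<bar>x\<bar> \<le> ((1 + r) * exp \<bar>x\<bar>)\<^sup>2" using mult_left_mono[OF big, of "(1 + r) * exp \<bar>x\<bar>"] big by (simp only: power2_eq_square mult_1_right)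
      have s: "cmod (1 / (2 * sc t)) \<le> 1" using norm_sc_ge_1[of t] by (simp add: norm_divide norm_mult divide_le_eq)
      have R: "((1 + \<bar>r\<bar>)\<^sup>2 + 1) * exp (2 * \<bar>x\<bar>) = ((1 + r) * exp \<bar>x\<bar>)\<^sup>2 + (exp \<bar>x\<bar>)\<^sup>2"
        by (simp only: e abs_of_nonneg[OF r] distrib_right[of _ 1] power_mult_distrib mult_1)
      have tri: "cmod ((lgen z x t)\<^sup>2 - 1 / (2 * sc t)) \<le> (cmod (lgen z x t))\<^sup>2 + 1"
        using norm_triangle_ineq4[of "(lgen z x t)\<^sup>2" "1 / (2 * sc t)"] s by (simp add: norm_power)
      consider "j = 0" | "j = 1" | "j \<noteq> 0 \<and> j \<noteq> 1" by blast
      then show ?thesis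
      proof cases
        case 1
        then show ?thesis unfolding R using e2 zero_le_power2[of "(1 + r) * exp \<bar>x\<bar>"] by (simp only: if_True refl norm_one) 
      next
        case 2
        then show ?thesis unfolding R using l bb zero_le_power2[of "exp \<bar>x\<bar>"] by (simp only: if_True if_False refl one_neq_zero)
      next
        case 3
        then show ?thesis unfolding R using tri sq e2 by (simp only: if_False)
      qed
    qed
    have "cmod (gend j z x t) \<le> ((1 + \<bar>r\<bar>)\<^sup>2 + 1) * exp (2 * \<bar>x\<bar>) * exp (- q * x\<^sup>2 + r * \<bar>x\<bar> + r\<^sup>2 / 2)"
      unfolding gend_def norm_mult by (rule mult_mono[OF f g]) auto
    also have "\<dots> = ((1 + \<bar>r\<bar>)\<^sup>2 + 1) * exp (2 * \<bar>x\<bar> + (- q * x\<^sup>2 + r * \<bar>x\<bar> + r\<^sup>2 / 2))"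
      by (simp add: exp_add)
    also have "\<dots> \<le> ((1 + \<bar>r\<bar>)\<^sup>2 + 1) * exp (m\<^sup>2 / (4 * q) + r\<^sup>2 / 2 - b * \<bar>x\<bar>)"
    proof -
      have "0 \<le> (m / (2 * q) - \<bar>x\<bar>)\<^sup>2 * q" using q by simp
      also have "\<dots> = m\<^sup>2 / (4 * q) - m * \<bar>x\<bar> + q * x\<^sup>2"
        using q by (simp add: power2_diff power_divide field_simps power2_eq_square)
      finally have "m * \<bar>x\<bar> - q * x\<^sup>2 \<le> m\<^sup>2 / (4 * q)" by simp
      moreover have "(r + 2 + b) * \<bar>x\<bar> \<le> m * \<bar>x\<bar>" unfolding m_def by (intro mult_right_mono) auto
      ultimately have "2 * \<bar>x\<bar> + (- q * x\<^sup>2 + r * \<bar>x\<bar> + r\<^sup>2 / 2) \<le> m\<^sup>2 / (4 * q) + r\<^sup>2 / 2 - b * \<bar>x\<bar>"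
        by (simp add: algebra_simps)
      then show ?thesis by (intro mult_left_mono) auto
    qed
    also have "\<dots> = C * exp (- b * \<bar>x\<bar>)" by (simp only: C_def diff_conv_add_uminus exp_add mult.assoc minus_mult_left)
    finally show ?thesis .
  qed
  moreover have "C \<ge> 0" by (simp add: C_def)
  ultimately show thesis using that by blast
qed

lemma gend_edec: "j \<le> 2 \<Longrightarrow> edec b (\<lambda>x. gend j z x t)"
proof -
  assume "j \<le> 2"
  obtain C where "C \<ge> 0" "\<And>j w x s. cmod w \<le> cmod z \<Longrightarrow> \<bar>s\<bar> \<le> \<bar>t\<bar> \<Longrightarrow> cmod (gend j w x s) \<le> C * exp (- b * \<bar>x\<bar>)"
    by (rule gend_bound) blast
  then show ?thesis using gend_continuous[OF \<open>j \<le> 2\<close>] by (intro edecI) auto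
qed

lemma gend_holomorphic: "(\<lambda>z. gend j z x t) holomorphic_on A"
  unfolding gend_def lgen_def gen_def by (cases "j = 0"; cases "j = 1") (auto intro!: holomorphic_intros)

text \<open>Up to the factor \<open>sqrt (fact n)\<close>, \<open>wn 0 n\<close> is \<open>psi n\<close>, and \<open>wn j n\<close> is its \<open>j\<close>-th space derivative.\<close>

definition wn :: "nat \<Rightarrow> nat \<Rightarrow> real \<Rightarrow> real \<Rightarrow> complex" where
  "wn j n x t = (deriv ^^ n) (\<lambda>z. gend j z x t) 0"

lemma wn_1: "wn 1 n x t = - complex_of_real x / (2 * sc t) * wn 0 n x t + (- \<i> / sc t) * of_nat n * wn 0 (n - 1) x t"
proof -
  have "(\<lambda>z. gend 1 z x t) = (\<lambda>z. (- complex_of_real x / (2 * sc t) + (- \<i> / sc t) * z) * gend 0 z x t)"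
    by (simp add: gend_simps lgen_def fun_eq_iff)
  then show ?thesis
    by (simp only: wn_def higher_deriv_affine_mult[OF gend_holomorphic])
qed

lemma wn_2: "wn 2 n x t = - complex_of_real x / (2 * sc t) * wn 1 n x t + (- \<i> / sc t) * of_nat n * wn 1 (n - 1) x t
    - 1 / (2 * sc t) * wn 0 n x t"
proof -
  have eq: "(\<lambda>z. gend 2 z x t) = (\<lambda>z. (- complex_of_real x / (2 * sc t) + (- \<i> / sc t) * z) * gend 1 z x t
      + (- 1 / (2 * sc t) + 0 * z) * gend 0 z x t)"
    by (simp add: gend_simps lgen_def fun_eq_iff power2_eq_square algebra_simps)
  have "(deriv ^^ n) (\<lambda>z. gend 2 z x t) 0 =
    (deriv ^^ n) (\<lambda>z. (- complex_of_real x / (2 * sc t) + (- \<i> / sc t) * z) * gend 1 z x t) 0 +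
    (deriv ^^ n) (\<lambda>z. (- 1 / (2 * sc t) + 0 * z) * gend 0 z x t) 0"
    unfolding eq by (rule higher_deriv_add[where S=UNIV]) (auto intro!: holomorphic_intros gend_holomorphic)
  then show ?thesis
    unfolding wn_def higher_deriv_affine_mult[OF gend_holomorphic] by simp
qed

lemma wn_zero: "wn 0 0 x t = psi0 x t"
  by (simp add: wn_def gend_simps gen_def)

text \<open>A three-term recurrence of Hermite type: the z-derivative of \<open>gen\<close> is
  \<open>gen\<close> times an affine function of z.\<close>

lemma wn_Suc: "wn 0 (Suc n) x t = (- \<i> * complex_of_real x / sc t) * wn 0 n x t + (2 / sc t - 1) * of_nat n * wn 0 (n - 1) x t"
proof -
  have "deriv (\<lambda>z. gend 0 z x t) z = (- \<i> * complex_of_real x / sc t + (2 / sc t - 1) * z) * gend 0 z x t" for z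
  proof -
    have e: "((\<lambda>z. - (\<i> * complex_of_real x * z) / sc t + c * z\<^sup>2 / 2) has_field_derivative
        - \<i> * complex_of_real x / sc t + c * z) (at z)" for c
      by (auto intro!: derivative_eq_intros)
    show ?thesis
      unfolding gend_simps gen_def
      by (rule DERIV_imp_deriv, rule DERIV_cong[OF DERIV_cmult[OF DERIV_fun_exp[OF e]]]) (simp only: mult_ac)
  qed
  then have "deriv (\<lambda>z. gend 0 z x t) = (\<lambda>z. (- \<i> * complex_of_real x / sc t + (2 / sc t - 1) * z) * gend 0 z x t)" ..
  then show ?thesis
    unfolding wn_def funpow_Suc_right comp_def by (simp only: higher_deriv_affine_mult[OF gend_holomorphic])
qed

text \<open>Interchanging the derivatives in z and x is avoided. Induction differentiates the
  recurrence \<open>wn_Suc\<close> in x and matches the outcome with the formula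
  \<open>wn_1\<close>, which came from differentiating in x before expanding in z.\<close>

lemma wn_has_vector_derivative_0: "((\<lambda>x. wn 0 n x t) has_vector_derivative wn 1 n x t) (at x)"
proof (induction n arbitrary: x rule: less_induct)
  case (less n)
  show ?case
  proof (cases n)
    case 0
    have "(\<lambda>x. wn 0 0 x t) = (\<lambda>x. gen 0 x t)" by (simp add: wn_def gend_simps fun_eq_iff)
    moreover have "wn 1 0 x t = gend 1 0 x t" by (simp add: wn_def)
    ultimately show ?thesis using gend_has_vector_derivative_space(1) 0 by simp
  next
    case (Suc m)
    let ?q = "- \<i> / sc t" and ?c = "2 / sc t - 1" and ?X = "complex_of_real x"
    have eq: "(\<lambda>x. wn 0 n x t) = (\<lambda>x. (?q * complex_of_real x) * wn 0 m x t + ?c * of_nat m * wn 0 (m - 1) x t)"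
      using wn_Suc[of m _ t] Suc by (simp add: fun_eq_iff)
    have d1: "((\<lambda>x. wn 0 m x t) has_vector_derivative wn 1 m x t) (at x)"
      and d2: "((\<lambda>x. wn 0 (m - 1) x t) has_vector_derivative wn 1 (m - 1) x t) (at x)"
      using less Suc by auto
    have X: "((\<lambda>x. ?q * complex_of_real x) has_vector_derivative ?q) (at x)"
      by (auto intro!: derivative_eq_intros)
    have "((\<lambda>x. wn 0 n x t) has_vector_derivative
       (?q * ?X) * wn 1 m x t + ?q * wn 0 m x t + ?c * of_nat m * wn 1 (m - 1) x t) (at x)"
      unfolding eq by (intro has_vector_derivative_add has_vector_derivative_mult X d1 has_vector_derivative_mult_right d2)
    moreover have "(?q * ?X) * wn 1 m x t + ?q * wn 0 m x t + ?c * of_nat m * wn 1 (m - 1) x t = wn 1 n x t"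
    proof (cases m)
      case 0
      then show ?thesis using Suc wn_1[of 0 x t] wn_1[of 1 x t] wn_Suc[of 0 x t] by (simp add: algebra_simps)
    next
      case (Suc k)
      have n: "n = Suc (Suc k)" using Suc \<open>n = Suc m\<close> by simp
      have a: "wn 1 n x t = - ?X / (2 * sc t) * (?q * ?X * wn 0 m x t + ?c * of_nat m * wn 0 k x t) + ?q * of_nat n * wn 0 m x t"
        using wn_1[of n x t] wn_Suc[of m x t] n Suc by simp
      have b: "wn 1 m x t = - ?X / (2 * sc t) * wn 0 m x t + ?q * of_nat m * wn 0 k x t"
        using wn_1[of m x t] Suc by simp
      have c: "wn 1 k x t = - ?X / (2 * sc t) * wn 0 k x t + ?q * of_nat k * wn 0 (k - 1) x t"
        by (rule wn_1)
      have d: "wn 0 m x t = ?q * ?X * wn 0 k x t + ?c * of_nat k * wn 0 (k - 1) x t"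
        using wn_Suc[of k x t] Suc by simp
      \<comment> \<open>With the quotients by \<open>sc t\<close> abstracted to variables, the
        matching is a polynomial identity.\<close>
      have "q * X * (p * u + q * m * v) + q * u + cc * m * (p * v + q * k * w)
         = p * (q * X * u + cc * m * v) + q * u + q * m * (q * X * v + cc * k * w)" for q X p u v w m k cc :: complex
        by (simp add: algebra_simps)
      from this[of ?q ?X "- ?X / (2 * sc t)" "wn 0 m x t" "of_nat m" "wn 0 k x t" ?c "of_nat k" "wn 0 (k - 1) x t"]
      have "(?q * ?X) * wn 1 m x t + ?q * wn 0 m x t + ?c * of_nat m * wn 1 k x t =
         - ?X / (2 * sc t) * (?q * ?X * wn 0 m x t + ?c * of_nat m * wn 0 k x t) + ?q * wn 0 m x t + ?q * of_nat m * wn 0 m x t"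
        unfolding b[symmetric] c[symmetric] d[symmetric] .
      also have "\<dots> = wn 1 n x t" unfolding a using \<open>n = Suc m\<close> by (simp add: algebra_simps add_divide_distrib)
      finally show ?thesis using Suc by simp
    qed
    ultimately show ?thesis by simp
  qed
qed

lemma wn_has_vector_derivative_1: "((\<lambda>x. wn 1 n x t) has_vector_derivative wn 2 n x t) (at x)"
proof -
  have X: "((\<lambda>x. - complex_of_real x / (2 * sc t)) has_vector_derivative - 1 / (2 * sc t)) (at x)"
    by (rule has_vector_derivative_real_field[where f="\<lambda>w. - w / (2 * sc t)"]) (auto intro!: derivative_eq_intros)
  have "((\<lambda>x. wn 1 n x t) has_vector_derivative
     - complex_of_real x / (2 * sc t) * wn 1 n x t + - 1 / (2 * sc t) * wn 0 n x t + (- \<i> / sc t) * of_nat n * wn 1 (n - 1) x t) (at x)"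
    unfolding wn_1[abs_def]
    by (intro has_vector_derivative_add has_vector_derivative_mult X wn_has_vector_derivative_0[unfolded wn_1] has_vector_derivative_mult_right)
  then show ?thesis by (rule has_vector_derivative_eq_rhs) (simp add: wn_2 algebra_simps)
qed

lemma wn_continuous: "j \<le> 2 \<Longrightarrow> continuous_on UNIV (\<lambda>x. wn j n x t)"
proof -
  have 0: "continuous_on UNIV (\<lambda>x. wn 0 n x t)" and 1: "continuous_on UNIV (\<lambda>x. wn 1 n x t)" for n
    using wn_has_vector_derivative_0 wn_has_vector_derivative_1
    by (auto intro!: continuous_at_imp_continuous_on has_vector_derivative_continuous)
  have 2: "continuous_on UNIV (\<lambda>x. wn 2 n x t)"
    unfolding wn_2 by (intro continuous_intros 0 1) auto
  assume "j \<le> 2"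
  then consider "j = 0" | "j = 1" | "j = 2" by linarith
  then show ?thesis using 0 1 2 by cases auto
qed

text \<open>Cauchy's estimate on the unit circle transfers the decay of the generating function, at
  any rate \<open>b\<close>, to its Taylor coefficients.\<close>

lemma wn_edec: "j \<le> 2 \<Longrightarrow> edec b (\<lambda>x. wn j n x t)"
proof -
  assume j: "j \<le> 2"
  obtain C where C: "C \<ge> 0" "\<And>j z x s. cmod z \<le> 1 \<Longrightarrow> \<bar>s\<bar> \<le> \<bar>t\<bar> \<Longrightarrow> cmod (gend j z x s) \<le> C * exp (- b * \<bar>x\<bar>)"
    by (rule gend_bound) blast
  have "cmod (wn j n x t) \<le> fact n * (C * exp (- b * \<bar>x\<bar>)) / 1 ^ n" for x
    unfolding wn_def
  proof (rule Cauchy_inequality)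
    show "cmod (gend j z x t) \<le> C * exp (- b * \<bar>x\<bar>)" if "cmod (0 - z) = 1" for z
      using that by (intro C) auto
  qed (auto intro: gend_holomorphic holomorphic_on_imp_continuous_on)
  then show ?thesis using wn_continuous[OF j] by (intro edecI[where C="fact n * C"]) (auto simp: mult.assoc)
qed

text \<open>The constant is common to all z in the disc, to all x and to all derivatives
  \<open>j\<close>. This uniformity is what later permits integrating the truncated expansion over a
  family of parameters z.\<close>

lemma wn_partial_sum_bound:
  assumes "\<rho> > 0"
  obtains C where "C \<ge> 0" "\<And>j z x N. cmod z \<le> \<rho> \<Longrightarrow>
    cmod ((\<Sum>n<N. z ^ n / fact n * wn j n x t) - gend j z x t) \<le> C / 2 ^ N * exp (- b * \<bar>x\<bar>)"
proof -
  obtain C where C: "C \<ge> 0" "\<And>j z x s. cmod z \<le> 2 * \<rho> \<Longrightarrow> \<bar>s\<bar> \<le> \<bar>t\<bar> \<Longrightarrow> cmod (gend j z x s) \<le> C * exp (- b * \<bar>x\<bar>)"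
    by (rule gend_bound) blast
  have "cmod ((\<Sum>n<N. z ^ n / fact n * wn j n x t) - gend j z x t) \<le> (2 * C) / 2 ^ N * exp (- b * \<bar>x\<bar>)"
    if "cmod z \<le> \<rho>" for j z x N
  proof -
    have "cmod ((\<Sum>n<N. z ^ n / fact n * wn j n x t) - gend j z x t) \<le> 2 * (C * exp (- b * \<bar>x\<bar>)) / 2 ^ N"
      unfolding wn_def
      by (rule entire_Taylor_partial_sum_bound[OF gend_holomorphic assms C(2) that]) auto
    then show ?thesis by simp
  qed
  then show thesis using that[of "2 * C"] C(1) by auto
qed

section \<open>Ladder operators, normalization and orthogonality\<close>

lemma vector_derivative_dx: "(f has_vector_derivative D) (at x) \<Longrightarrow> dx f x = D"
  by (simp add: dx_def vector_derivative_at)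

lemma wn_raise: "(\<i> + complex_of_real t) * wn 1 n x t - \<i> * complex_of_real x / 2 * wn 0 n x t = wn 0 (Suc n) x t"
proof -
  have "(\<i> + complex_of_real t) = \<i> * (2 - sc t)" by (simp add: sc_def algebra_simps)
  then have "(\<i> + complex_of_real t) * wn 1 n x t = \<i> * (2 - sc t) * (- complex_of_real x / (2 * sc t) * wn 0 n x t + (- \<i> / sc t) * of_nat n * wn 0 (n - 1) x t)"
    by (simp only: wn_1)
  also have "\<dots> = (- \<i> * complex_of_real x / sc t + \<i> * complex_of_real x / 2) * wn 0 n x t + (2 / sc t - 1) * of_nat n * wn 0 (n - 1) x t"
    by (simp add: field_simps)
  finally show ?thesis unfolding wn_Suc by (simp add: algebra_simps)
qed

lemma wn_lower: "(\<i> - complex_of_real t) * wn 1 n x t + \<i> * complex_of_real x / 2 * wn 0 n x t = of_nat n * wn 0 (n - 1) x t"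
proof -
  have "(\<i> - complex_of_real t) = \<i> * sc t" by (simp add: sc_def algebra_simps)
  then have "(\<i> - complex_of_real t) * wn 1 n x t = \<i> * sc t * (- complex_of_real x / (2 * sc t) * wn 0 n x t + (- \<i> / sc t) * of_nat n * wn 0 (n - 1) x t)"
    by (simp only: wn_1)
  also have "\<dots> = - (\<i> * complex_of_real x / 2) * wn 0 n x t + of_nat n * wn 0 (n - 1) x t"
    by (simp add: field_simps)
  finally show ?thesis by (simp add: algebra_simps)
qed

lemma wn_derivative_ladder: "2 * \<i> * wn 1 n x t = wn 0 (Suc n) x t + of_nat n * wn 0 (n - 1) x t"
  unfolding wn_raise[symmetric] wn_lower[symmetric] by (simp add: algebra_simps)

text \<open>A + A^+ = 2 i d/dx applied twice. Hence the matrix of the second derivative has only a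
  diagonal and two off-diagonals at distance 2.\<close>

lemma wn_derivative_ladder2:
  "- 4 * wn 2 n x t = wn 0 (n + 2) x t + (2 * of_nat n + 1) * wn 0 n x t + of_nat n * of_nat (n - 1) * wn 0 (n - 2) x t"
proof -
  have "((\<lambda>x. 2 * \<i> * wn 1 n x t) has_vector_derivative wn 1 (Suc n) x t + of_nat n * wn 1 (n - 1) x t) (at x)"
    unfolding wn_derivative_ladder
    by (intro has_vector_derivative_add has_vector_derivative_mult_right wn_has_vector_derivative_0)
  moreover have "((\<lambda>x. 2 * \<i> * wn 1 n x t) has_vector_derivative 2 * \<i> * wn 2 n x t) (at x)"
    by (intro has_vector_derivative_mult_right wn_has_vector_derivative_1)
  ultimately have "2 * \<i> * wn 2 n x t = wn 1 (Suc n) x t + of_nat n * wn 1 (n - 1) x t"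
    by (rule vector_derivative_unique_at[symmetric])
  then have "2 * \<i> * (2 * \<i> * wn 2 n x t) = 2 * \<i> * wn 1 (Suc n) x t + of_nat n * (2 * \<i> * wn 1 (n - 1) x t)"
    by (simp only: distrib_left mult.left_commute)
  also have "\<dots> = wn 0 (Suc (Suc n)) x t + of_nat (Suc n) * wn 0 n x t
      + of_nat n * (wn 0 (Suc (n - 1)) x t + of_nat (n - 1) * wn 0 (n - 1 - 1) x t)"
    by (simp only: wn_derivative_ladder diff_Suc_1)
  finally show ?thesis by (cases n) (simp_all add: algebra_simps numeral_2_eq_2)
qed

lemma Aplus_power: "(Aplus t ^^ n) (\<lambda>y. psi0 y t) = (\<lambda>x. wn 0 n x t)"
proof (induction n)
  case 0 show ?case by (simp add: wn_zero)
next
  case (Suc n)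
  have "dx (\<lambda>x. wn 0 n x t) = (\<lambda>x. wn 1 n x t)"
    using vector_derivative_dx[OF wn_has_vector_derivative_0] by (rule ext)
  then have "Aplus t (\<lambda>x. wn 0 n x t) = (\<lambda>x. wn 0 (Suc n) x t)"
    unfolding Aplus_def by (simp only: wn_raise)
  then show ?case by (simp add: Suc.IH)
qed

lemma psi_eq_wn: "psi n x t = wn 0 n x t / complex_of_real (sqrt (fact n))"
  by (simp add: psi_def Aplus_power)

text \<open>The two factors sqrt (n!), one from \<open>psiz\<close> and one from the normalization
  of \<open>psi\<close>, combine to the n! of the Taylor series.\<close>

lemma psiz_eq_gen: "psiz z x t = complex_of_real (exp (- (cmod z)\<^sup>2 / 2)) * gen z x t"
proof -
  have "(\<lambda>n. z ^ n / fact n * wn 0 n x t) sums gend 0 z x t"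
    unfolding wn_def by (rule entire_Taylor_sums) (rule gend_holomorphic)
  moreover have "z ^ n / complex_of_real (sqrt (fact n)) * psi n x t = z ^ n / fact n * wn 0 n x t" for n
  proof -
    have "complex_of_real (sqrt (fact n)) * complex_of_real (sqrt (fact n)) = fact n"
      by (simp flip: of_real_mult)
    then show ?thesis by (simp add: psi_eq_wn)
  qed
  ultimately show ?thesis by (simp add: psiz_def sums_iff gend_simps)
qed

text \<open>A^+ is the adjoint of A by integration by parts. Moving one raising operator across
  lowers the index on the other side, and the recursion ends at the norm of psi_0.\<close>

lemma inner0_wn: "inner0 (\<lambda>x. wn 0 m x t) (\<lambda>x. wn 0 n x t) = (if m = n then fact n else 0)"
proof -
  have int: "integrable lborel (\<lambda>x. cnj (wn j m x t) * wn k n x t)" if "j \<le> 2" "k \<le> 2" for j k m n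
    by (rule edec_integrable[of 1]) (use that in \<open>auto intro!: edec_mult edec_cnj wn_edec\<close>)
  have step: "inner0 (\<lambda>x. wn 0 (Suc m) x t) (\<lambda>x. wn 0 n x t) = of_nat n * inner0 (\<lambda>x. wn 0 m x t) (\<lambda>x. wn 0 (n - 1) x t)" for m n
  proof -
    \<comment> \<open>The factor t - i is the conjugate of i + t and the negative of i - t, so the
      total derivative splits into a raised left factor and a lowered right factor; the terms with x
      / 2 cancel.\<close>
    have "(LINT x|lborel. (complex_of_real t - \<i>) * (cnj (wn 0 m x t) * wn 1 n x t + cnj (wn 1 m x t) * wn 0 n x t)) = 0"
    proof (rule edec_integral_derivative[of 1 "\<lambda>x. (complex_of_real t - \<i>) * (cnj (wn 0 m x t) * wn 0 n x t)"])
      show "((\<lambda>x. (complex_of_real t - \<i>) * (cnj (wn 0 m x t) * wn 0 n x t)) has_vector_derivative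
         (complex_of_real t - \<i>) * (cnj (wn 0 m x t) * wn 1 n x t + cnj (wn 1 m x t) * wn 0 n x t)) (at x)" for x
        by (intro has_vector_derivative_mult_right has_vector_derivative_mult has_vector_derivative_cnj wn_has_vector_derivative_0)
    qed (auto intro!: edec_cmult edec_add edec_mult edec_cnj wn_edec)
    moreover have "(complex_of_real t - \<i>) * (cnj (wn 0 m x t) * wn 1 n x t + cnj (wn 1 m x t) * wn 0 n x t)
      = cnj (wn 0 (Suc m) x t) * wn 0 n x t - of_nat n * (cnj (wn 0 m x t) * wn 0 (n - 1) x t)" for x
      unfolding wn_raise[symmetric] mult.left_commute[of "of_nat n"] wn_lower[symmetric] by (simp add: algebra_simps)
    ultimately have "(LINT x|lborel. cnj (wn 0 (Suc m) x t) * wn 0 n x t - of_nat n * (cnj (wn 0 m x t) * wn 0 (n - 1) x t)) = 0"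
      by (simp only:)
    then show ?thesis
      unfolding inner0_def
      by (subst (asm) Bochner_Integration.integral_diff) (auto intro!: integrable_mult_right int)
  qed
  have cnjc: "inner0 f g = cnj (inner0 g f)" for f g
    using Bochner_Integration.integral_cnj[of lborel "\<lambda>x. cnj (g x) * f x"]
    by (simp add: inner0_def mult.commute del: Bochner_Integration.integral_cnj)
  have z: "inner0 (\<lambda>x. wn 0 0 x t) (\<lambda>x. wn 0 0 x t) = 1"
  proof -
    \<comment> \<open>|psi_0|^2 is the centred normal density with standard deviation |sc
      t|.\<close>
    have "cnj (psi0 x t) * psi0 x t = complex_of_real (normal_density 0 (cmod (sc t)) x)" for x
    proof -
      have c: "(cmod (sc t))\<^sup>2 = 1 + t\<^sup>2" by (simp add: sc_def cmod_power2)
      have re: "Re (- (complex_of_real x)\<^sup>2 / (4 * (1 + \<i> * complex_of_real t))) = - x\<^sup>2 / (4 * (1 + t\<^sup>2))"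
      proof -
        have "- (complex_of_real x)\<^sup>2 / (4 * (1 + \<i> * complex_of_real t)) = complex_of_real (- x\<^sup>2 / 4) * (1 / (1 + \<i> * complex_of_real t))" by simp
        moreover have "Re (complex_of_real u * w) = u * Re w" for u w by simp
        moreover have "Re (1 / (1 + \<i> * complex_of_real t)) = 1 / (1 + t\<^sup>2)" by (simp add: Re_divide power2_eq_square)
        ultimately have "Re (- (complex_of_real x)\<^sup>2 / (4 * (1 + \<i> * complex_of_real t))) = - x\<^sup>2 / 4 * (1 / (1 + t\<^sup>2))"
          by (simp only:)
        then show ?thesis by simp
      qed
      have p: "((2 * pi) powr - (1/4))\<^sup>2 = 1 / sqrt (2 * pi)"
        by (simp add: power2_eq_square powr_add[symmetric] powr_minus_divide powr_half_sqrt)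
      have n2: "(cmod (psi0 x t))\<^sup>2 = 1 / sqrt (2 * pi) / cmod (sc t) * exp (2 * (- x\<^sup>2 / (4 * (1 + t\<^sup>2))))"
        unfolding psi0_def norm_mult norm_divide norm_exp_eq_Re re power_mult_distrib power_divide exp_double[symmetric]
        by (simp add: p norm_csqrt sc_def del: power_divide)
      have "sqrt (2 * pi * (cmod (sc t))\<^sup>2) = sqrt (2 * pi) * cmod (sc t)" by (simp add: real_sqrt_mult)
      then have "(cmod (psi0 x t))\<^sup>2 = normal_density 0 (cmod (sc t)) x"
        unfolding n2 normal_density_def c[symmetric] by (simp add: field_simps)
      then show ?thesis by (metis complex_norm_square mult.commute)
    qed
    then have "inner0 (\<lambda>x. wn 0 0 x t) (\<lambda>x. wn 0 0 x t) = complex_of_real (LINT x|lborel. normal_density 0 (cmod (sc t)) x)"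
      by (simp add: inner0_def wn_zero)
    also have "\<dots> = 1" using norm_sc_ge_1[of t] by (subst integral_normal_density) auto
    finally show ?thesis .
  qed
  show ?thesis
  proof (induction m arbitrary: n)
    case 0
    show ?case
    proof (cases n)
      case 0 then show ?thesis using z by simp
    next
      case (Suc k)
      then show ?thesis using step[of k 0] cnjc[of "\<lambda>x. wn 0 0 x t" "\<lambda>x. wn 0 n x t"] by simp
    qed
  next
    case (Suc m)
    show ?case using step[of m n] Suc.IH[of "n - 1"] by (cases n) auto
  qed
qed

section \<open>Approximation by finite linear combinations\<close>

text \<open>The coefficients refer to the unnormalized states, and \<open>j\<close> selects the
  derivative, so that one family of coefficients describes a function together with its
  derivatives.\<close>

definition lcomb :: "nat \<Rightarrow> nat \<Rightarrow> (nat \<Rightarrow> complex) \<Rightarrow> real \<Rightarrow> real \<Rightarrow> complex" where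
  "lcomb j N d t x = (\<Sum>n<N. d n * wn j n x t)"

lemma lcomb_has_vector_derivative:
  "(lcomb 0 N d t has_vector_derivative lcomb 1 N d t x) (at x)"
  "(lcomb 1 N d t has_vector_derivative lcomb 2 N d t x) (at x)"
  unfolding lcomb_def[abs_def]
  by (intro has_vector_derivative_sum has_vector_derivative_mult_right
        wn_has_vector_derivative_0 wn_has_vector_derivative_1)+

lemma lcomb_edec: "j \<le> 2 \<Longrightarrow> edec b (lcomb j N d t)"
  unfolding lcomb_def[abs_def] by (intro edec_sum edec_cmult wn_edec)

lemma dx_lcomb: "dx (lcomb 0 N d t) = lcomb 1 N d t" "dx (lcomb 1 N d t) = lcomb 2 N d t"
  using vector_derivative_dx[OF lcomb_has_vector_derivative(1)] vector_derivative_dx[OF lcomb_has_vector_derivative(2)]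
  by (auto simp: fun_eq_iff)

lemma sqrt_fact_mult_psi: "complex_of_real (sqrt (fact n)) * psi n x t = wn 0 n x t"
  by (simp add: psi_eq_wn)

lemma lcomb_in_L0: "lcomb 0 N d t \<in> L0 t"
proof -
  have eq: "lcomb 0 N d t = (\<lambda>x. \<Sum>n<N. (d n * complex_of_real (sqrt (fact n))) * psi n x t)"
    by (simp add: lcomb_def[abs_def] sqrt_fact_mult_psi mult.assoc)
  show ?thesis
    unfolding L0_def
    by (intro CollectI exI[of _ N] exI[of _ "\<lambda>n. d n * complex_of_real (sqrt (fact n))"]) (rule eq)
qed

lemma Lop_lcomb: "Lop a (lcomb 0 N d t) = (\<lambda>x. lcomb 1 N d t x - complex_of_real (a * tanh (a * x)) * lcomb 0 N d t x)"
  by (simp add: fun_eq_iff Lop_def dx_lcomb)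

lemma Lop_psi: "Lop a (\<lambda>y. psi n y t) x =
    (wn 1 n x t - complex_of_real (a * tanh (a * x)) * wn 0 n x t) / complex_of_real (sqrt (fact n))"
proof -
  have "((\<lambda>y. psi n y t) has_vector_derivative wn 1 n x t / complex_of_real (sqrt (fact n))) (at x)"
    unfolding psi_eq_wn by (intro has_vector_derivative_divide wn_has_vector_derivative_0)
  then show ?thesis
    by (simp add: Lop_def vector_derivative_dx psi_eq_wn diff_divide_distrib)
qed

lemma L1_eq_Lop_lcomb: "L1 a t = {f. \<exists>N d. f = Lop a (lcomb 0 N d t)}"
proof -
  define r where "r n = complex_of_real (sqrt (fact n))" for n
  have r: "r n \<noteq> 0" for n by (simp add: r_def)
  have eq: "(\<lambda>x. \<Sum>n<N. c n * Lop a (\<lambda>y. psi n y t) x) = Lop a (lcomb 0 N (\<lambda>n. c n / r n) t)" for N c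
  proof
    fix x
    have "c n * Lop a (\<lambda>y. psi n y t) x =
        c n / r n * wn 1 n x t - complex_of_real (a * tanh (a * x)) * (c n / r n * wn 0 n x t)" for n
      unfolding Lop_psi r_def[symmetric] by (simp add: right_diff_distrib diff_divide_distrib)
    then show "(\<Sum>n<N. c n * Lop a (\<lambda>y. psi n y t) x) = Lop a (lcomb 0 N (\<lambda>n. c n / r n) t) x"
      unfolding Lop_lcomb lcomb_def by (simp only: sum_subtractf sum_distrib_left)
  qed
  show ?thesis
    unfolding L1_def eq
  proof (intro Collect_cong iffI; elim exE)
    fix f N d
    assume "f = Lop a (lcomb 0 N d t)"
    then show "\<exists>N c. f = Lop a (lcomb 0 N (\<lambda>n. c n / r n) t)"
      by (intro exI[of _ N] exI[of _ "\<lambda>n. d n * r n"]) (simp add: r)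
  qed auto
qed

lemma lcomb_add:
  obtains K e where "\<And>j x. lcomb j K e t x = lcomb j N d t x + lcomb j M c t x"
proof -
  define K where "K = max N M"
  define e where "e n = (if n < N then d n else 0) + (if n < M then c n else 0)" for n
  have "lcomb j K e t x = lcomb j N d t x + lcomb j M c t x" for j x
  proof -
    have "(\<Sum>n<K. (if n < N then d n else 0) * wn j n x t) = lcomb j N d t x"
      unfolding lcomb_def by (rule sum.mono_neutral_cong_right) (auto simp: K_def)
    moreover have "(\<Sum>n<K. (if n < M then c n else 0) * wn j n x t) = lcomb j M c t x"
      unfolding lcomb_def by (rule sum.mono_neutral_cong_right) (auto simp: K_def)
    ultimately show ?thesis
      unfolding lcomb_def[of j K] e_def by (simp only: distrib_right sum.distrib)
  qed
  then show thesis using that by blast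
qed

text \<open>\<open>F 1\<close> and \<open>F 2\<close> stand for the derivatives of
  \<open>F 0\<close>. The same coefficients have to serve all three, because the closure of an
  operator is a closure of its graph.\<close>

definition approximable :: "real \<Rightarrow> real \<Rightarrow> (nat \<Rightarrow> real \<Rightarrow> complex) \<Rightarrow> bool" where
  "approximable b t F \<longleftrightarrow> (\<forall>\<epsilon>>0. \<exists>N d. \<forall>j\<le>2. \<forall>x. cmod (lcomb j N d t x - F j x) \<le> \<epsilon> * exp (- b * \<bar>x\<bar>))"

lemma approximable_add:
  assumes "approximable b t F" "approximable b t G"
  shows "approximable b t (\<lambda>j x. F j x + G j x)"
  unfolding approximable_def
proof (intro allI impI)
  fix \<epsilon> :: real assume "\<epsilon> > 0"
  then have h: "\<epsilon> / 2 > 0" by simp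
  obtain N d where 1: "\<And>j x. j \<le> 2 \<Longrightarrow> cmod (lcomb j N d t x - F j x) \<le> \<epsilon> / 2 * exp (- b * \<bar>x\<bar>)"
    using assms(1) h unfolding approximable_def by blast
  obtain M c where 2: "\<And>j x. j \<le> 2 \<Longrightarrow> cmod (lcomb j M c t x - G j x) \<le> \<epsilon> / 2 * exp (- b * \<bar>x\<bar>)"
    using assms(2) h unfolding approximable_def by blast
  obtain K e where "\<And>j x. lcomb j K e t x = lcomb j N d t x + lcomb j M c t x"
    using lcomb_add by blast
  then have "cmod (lcomb j K e t x - (F j x + G j x)) \<le> \<epsilon> * exp (- b * \<bar>x\<bar>)" if "j \<le> 2" for j x
    using 1[OF that, of x] 2[OF that, of x] norm_triangle_ineq[of "lcomb j N d t x - F j x" "lcomb j M c t x - G j x"]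
    by (simp add: algebra_simps)
  then show "\<exists>N d. \<forall>j\<le>2. \<forall>x. cmod (lcomb j N d t x - (F j x + G j x)) \<le> \<epsilon> * exp (- b * \<bar>x\<bar>)"
    by blast
qed

lemma approximable_cmult:
  assumes "approximable b t F"
  shows "approximable b t (\<lambda>j x. k * F j x)"
  unfolding approximable_def
proof (intro allI impI)
  fix \<epsilon> :: real assume "\<epsilon> > 0"
  \<comment> \<open>The added 1 covers \<open>k = 0\<close>.\<close>
  have kp: "cmod k + 1 > 0" by (rule add_nonneg_pos) auto
  with \<open>\<epsilon> > 0\<close> have h: "\<epsilon> / (cmod k + 1) > 0" by simp
  obtain N d where 1: "\<And>j x. j \<le> 2 \<Longrightarrow> cmod (lcomb j N d t x - F j x) \<le> \<epsilon> / (cmod k + 1) * exp (- b * \<bar>x\<bar>)"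
    using assms(1) h unfolding approximable_def by blast
  have "cmod (lcomb j N (\<lambda>n. k * d n) t x - k * F j x) \<le> \<epsilon> * exp (- b * \<bar>x\<bar>)" if "j \<le> 2" for j x
  proof -
    have "lcomb j N (\<lambda>n. k * d n) t x - k * F j x = k * (lcomb j N d t x - F j x)"
      by (simp add: lcomb_def sum_distrib_left algebra_simps)
    then have "cmod (lcomb j N (\<lambda>n. k * d n) t x - k * F j x) = cmod k * cmod (lcomb j N d t x - F j x)"
      by (simp add: norm_mult)
    also have "\<dots> \<le> (cmod k + 1) * (\<epsilon> / (cmod k + 1) * exp (- b * \<bar>x\<bar>))"
      by (intro mult_mono 1[OF that]) auto
    also have "\<dots> = \<epsilon> * exp (- b * \<bar>x\<bar>)" using kp by simp
    finally show ?thesis .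
  qed
  then show "\<exists>N d. \<forall>j\<le>2. \<forall>x. cmod (lcomb j N d t x - k * F j x) \<le> \<epsilon> * exp (- b * \<bar>x\<bar>)"
    by blast
qed

lemma approximable_sequence:
  assumes "approximable b t F"
  obtains N d where "\<And>k j x. j \<le> 2 \<Longrightarrow> cmod (lcomb j (N k) (d k) t x - F j x) \<le> 1 / Suc k * exp (- b * \<bar>x\<bar>)"
proof -
  have "\<exists>N d. \<forall>j\<le>2. \<forall>x. cmod (lcomb j N d t x - F j x) \<le> 1 / real (Suc k) * exp (- b * \<bar>x\<bar>)" for k
    by (rule assms[unfolded approximable_def, THEN spec, THEN mp]) simp
  then have "\<forall>k. \<exists>N d. \<forall>j\<le>2. \<forall>x. cmod (lcomb j N d t x - F j x) \<le> 1 / real (Suc k) * exp (- b * \<bar>x\<bar>)"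
    by (rule allI)
  from choice[OF this] obtain N where
    "\<forall>k. \<exists>d. \<forall>j\<le>2. \<forall>x. cmod (lcomb j (N k) d t x - F j x) \<le> 1 / real (Suc k) * exp (- b * \<bar>x\<bar>)" ..
  from choice[OF this] obtain d where
    "\<forall>k. \<forall>j\<le>2. \<forall>x. cmod (lcomb j (N k) (d k) t x - F j x) \<le> 1 / real (Suc k) * exp (- b * \<bar>x\<bar>)" ..
  then show thesis using that by blast
qed

text \<open>A translated Gaussian is a multiple of the one with parameter z + i y / 2. The factor
  does not depend on \<open>j\<close>, since \<open>lgen\<close> is only shifted; derivatives are
  thus translated with the same factor.\<close>

lemma gend_translate:
  "gend j z (x - y) t = exp (- (complex_of_real y)\<^sup>2 / (4 * sc t) + \<i> * complex_of_real y * z / sc t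
      + (2 / sc t - 1) * (z\<^sup>2 - (z + \<i> * complex_of_real y / 2)\<^sup>2) / 2) * gend j (z + \<i> * complex_of_real y / 2) x t"
proof -
  have l: "lgen z (x - y) t = lgen (z + \<i> * complex_of_real y / 2) x t"
    by (simp add: lgen_def field_simps)
  have e: "- (X - Y)\<^sup>2 / (4 * s) - \<i> * (X - Y) * z / s + c * z\<^sup>2 / 2 =
      (- Y\<^sup>2 / (4 * s) + \<i> * Y * z / s + c * (z\<^sup>2 - (z + \<i> * Y / 2)\<^sup>2) / 2) +
      (- X\<^sup>2 / (4 * s) - \<i> * X * (z + \<i> * Y / 2) / s + c * (z + \<i> * Y / 2)\<^sup>2 / 2)" if "s \<noteq> 0" for X Y s c :: complex
    using that by (simp add: power2_eq_square field_simps)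
  have "gen z (x - y) t = exp (- (complex_of_real y)\<^sup>2 / (4 * sc t) + \<i> * complex_of_real y * z / sc t
      + (2 / sc t - 1) * (z\<^sup>2 - (z + \<i> * complex_of_real y / 2)\<^sup>2) / 2) * gen (z + \<i> * complex_of_real y / 2) x t"
    unfolding gen_eq_exp of_real_diff e[OF sc_nonzero] exp_add by (simp only: mult_ac times_divide_eq_right)
  then show ?thesis unfolding gend_def l by (simp only: mult_ac)
qed

text \<open>The tail of the convolution beyond \<open>R\<close> is small. On [0, R) the translates
  are multiples of generating functions with parameters in one disc, so a common \<open>N\<close>
  truncates all their expansions, and integrating over u leaves a finite linear combination.\<close>

lemma Jt_gend_approximable:
  assumes "a > 0" "\<bar>\<sigma>\<bar> = 1"
  shows "approximable (a/2) t (\<lambda>j x. Jt a \<sigma> (\<lambda>x. gend j z x t) x)"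
  unfolding approximable_def
proof (intro allI impI)
  fix \<epsilon> :: real assume \<epsilon>: "\<epsilon> > 0"
  obtain C where C: "C \<ge> 0" "\<And>j w x s. cmod w \<le> cmod z \<Longrightarrow> \<bar>s\<bar> \<le> \<bar>t\<bar> \<Longrightarrow> cmod (gend j w x s) \<le> C * exp (- (a/2) * \<bar>x\<bar>)"
    by (rule gend_bound) blast
  have "((\<lambda>R. C * (2 / a) * exp (- (a/2) * R)) \<longlongrightarrow> C * (2 / a) * 0) at_top"
  proof (intro tendsto_mult tendsto_const filterlim_compose[OF exp_at_bot])
    have "filterlim (\<lambda>R. (a/2) * R) at_top at_top"
      using \<open>a > 0\<close> by (intro filterlim_tendsto_pos_mult_at_top[OF tendsto_const]) (auto intro: filterlim_ident)
    then show "filterlim (\<lambda>R. - (a/2) * R) at_bot at_top"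
      by (simp add: filterlim_uminus_at_bot)
  qed
  then have "eventually (\<lambda>R. C * (2 / a) * exp (- (a/2) * R) < \<epsilon> / 2) at_top"
    using \<epsilon> by (intro order_tendstoD) auto
  then obtain R where R: "R \<ge> 0" "C * (2 / a) * exp (- (a/2) * R) < \<epsilon> / 2"
    using eventually_happens'[OF _ eventually_conj[OF _ eventually_ge_at_top[of 0]]] by (metis trivial_limit_at_top_linorder)
  define zu where "zu u = z + \<i> * complex_of_real (\<sigma> * u) / 2" for u
  define \<kappa> where "\<kappa> u = complex_of_real (exp (- a * u)) * exp (- (complex_of_real (\<sigma> * u))\<^sup>2 / (4 * sc t)
      + \<i> * complex_of_real (\<sigma> * u) * z / sc t + (2 / sc t - 1) * (z\<^sup>2 - (zu u)\<^sup>2) / 2)" for u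
  have shift: "exp (- a * u) *\<^sub>R gend j z (x - \<sigma> * u) t = \<kappa> u * gend j (zu u) x t" for u j x
    unfolding gend_translate[of j z x "\<sigma> * u"] \<kappa>_def zu_def scaleR_conv_of_real by (simp only: mult.assoc)
  have zuc: "continuous_on A zu" and \<kappa>c: "continuous_on A \<kappa>" for A
    unfolding \<kappa>_def zu_def by (auto intro!: continuous_intros)
  have si: "set_integrable lborel {0..<R} f" if "continuous_on {0..R} f" for f :: "real \<Rightarrow> complex"
    by (rule set_integrable_subset[OF borel_integrable_atLeastAtMost'[OF that]]) auto
  have si': "set_integrable lborel {0..<R} f" if "continuous_on {0..R} f" for f :: "real \<Rightarrow> real"
    by (rule set_integrable_subset[OF borel_integrable_atLeastAtMost'[OF that]]) auto
  \<comment> \<open>Contains all shifted parameters, as |sigma u / 2| \<le> R / 2; the 1 makes the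
    radius positive.\<close>
  define \<rho> where "\<rho> = cmod z + R / 2 + 1"
  have \<rho>: "\<rho> > 0" using R(1) by (simp add: \<rho>_def add_nonneg_pos)
  have zu\<rho>: "cmod (zu u) \<le> \<rho>" if "u \<in> {0..<R}" for u
  proof -
    have "cmod (\<i> * complex_of_real (\<sigma> * u) / 2) \<le> R / 2"
      using that assms(2) by (simp add: norm_mult norm_divide abs_mult)
    then show ?thesis unfolding zu_def \<rho>_def using norm_triangle_ineq[of z "\<i> * complex_of_real (\<sigma> * u) / 2"] by linarith
  qed
  obtain D where D: "D \<ge> 0" "\<And>j z x N. cmod z \<le> \<rho> \<Longrightarrow>
    cmod ((\<Sum>n<N. z ^ n / fact n * wn j n x t) - gend j z x t) \<le> D / 2 ^ N * exp (- (a/2) * \<bar>x\<bar>)"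
    using wn_partial_sum_bound[OF \<rho>, of t "a/2"] by blast
  define I where "I = (LINT u:{0..<R}|lborel. cmod (\<kappa> u))"
  have I0: "I \<ge> 0" unfolding I_def set_lebesgue_integral_def by (rule Bochner_Integration.integral_nonneg) (simp add: indicator_def)
  have "(\<lambda>N. I * D * (1/2) ^ N) \<longlonglongrightarrow> I * D * 0"
    by (intro tendsto_mult tendsto_const LIMSEQ_power_zero) simp
  then have "eventually (\<lambda>N. I * D * (1/2) ^ N < \<epsilon> / 2) sequentially"
    using \<epsilon> by (intro order_tendstoD) auto
  then obtain N where N: "I * D * (1/2) ^ N < \<epsilon> / 2"
    using eventually_happens'[OF sequentially_bot] by blast
  \<comment> \<open>The truncated expansion integrated over u; the coefficients are the same for
    every \<open>j\<close>, as \<open>approximable\<close> demands.\<close>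
  define d where "d n = (LINT u:{0..<R}|lborel. \<kappa> u * zu u ^ n / fact n)" for n
  have "cmod (lcomb j N d t x - Jt a \<sigma> (\<lambda>x. gend j z x t) x) \<le> \<epsilon> * exp (- (a/2) * \<bar>x\<bar>)" if j: "j \<le> 2" for j x
  proof -
    let ?h = "\<lambda>x. gend j z x t"
    let ?P = "\<lambda>u. \<Sum>n<N. zu u ^ n / fact n * wn j n x t"
    have int: "set_integrable lborel {0..} (\<lambda>u. exp (- a * u) *\<^sub>R ?h (x - \<sigma> * u))"
      by (rule Jt_integrable[where C=C]) (use gend_continuous[OF j] C(2) assms in auto)
    have i1: "set_integrable lborel {0..<R} (\<lambda>u. exp (- a * u) *\<^sub>R ?h (x - \<sigma> * u))"
      and i2: "set_integrable lborel {R..} (\<lambda>u. exp (- a * u) *\<^sub>R ?h (x - \<sigma> * u))"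
      by (rule set_integrable_subset[OF int]; use R in auto)+
    have split: "Jt a \<sigma> ?h x = (LINT u:{0..<R}|lborel. \<kappa> u * gend j (zu u) x t)
       + (LINT u:{R..}|lborel. exp (- a * u) *\<^sub>R ?h (x - \<sigma> * u))"
    proof -
      have eq: "{0..} = {0..<R} \<union> {R..}" and dj: "{0..<R} \<inter> {R..} = {}" using R(1) by auto
      show ?thesis
        unfolding Jt_def shift[symmetric] eq by (rule set_integral_Un[OF dj i1 i2])
    qed
    have "lcomb j N d t x = (\<Sum>n<N. LINT u:{0..<R}|lborel. \<kappa> u * zu u ^ n / fact n * wn j n x t)"
      unfolding lcomb_def d_def by (simp only: set_integral_mult_left)
    also have "\<dots> = (LINT u:{0..<R}|lborel. \<Sum>n<N. \<kappa> u * zu u ^ n / fact n * wn j n x t)"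
      unfolding set_lebesgue_integral_def scaleR_sum_right
      by (rule Bochner_Integration.integral_sum[symmetric], fold set_integrable_def)
         (auto intro!: si continuous_intros zuc \<kappa>c)
    also have "\<dots> = (LINT u:{0..<R}|lborel. \<kappa> u * ?P u)"
      by (simp add: sum_distrib_left mult.assoc)
    finally have lc: "lcomb j N d t x = (LINT u:{0..<R}|lborel. \<kappa> u * ?P u)" .
    have iP: "set_integrable lborel {0..<R} (\<lambda>u. \<kappa> u * ?P u)"
      by (intro si continuous_intros zuc \<kappa>c) auto
    have iG: "set_integrable lborel {0..<R} (\<lambda>u. \<kappa> u * gend j (zu u) x t)"
      using i1 unfolding shift .
    have "cmod (lcomb j N d t x - (LINT u:{0..<R}|lborel. \<kappa> u * gend j (zu u) x t))
       = cmod (LINT u:{0..<R}|lborel. \<kappa> u * ?P u - \<kappa> u * gend j (zu u) x t)"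
      unfolding lc set_integral_diff(2)[OF iP iG] ..
    also have "\<dots> \<le> (LINT u:{0..<R}|lborel. cmod (\<kappa> u * ?P u - \<kappa> u * gend j (zu u) x t))"
      by (rule set_integral_norm_bound[OF set_integral_diff(1)[OF iP iG]])
    also have "\<dots> \<le> (LINT u:{0..<R}|lborel. cmod (\<kappa> u) * (D / 2 ^ N * exp (- (a/2) * \<bar>x\<bar>)))"
    proof (rule set_integral_mono)
      show "set_integrable lborel {0..<R} (\<lambda>u. cmod (\<kappa> u * ?P u - \<kappa> u * gend j (zu u) x t))"
        by (rule set_integrable_norm[OF set_integral_diff(1)[OF iP iG]])
      show "set_integrable lborel {0..<R} (\<lambda>u. cmod (\<kappa> u) * (D / 2 ^ N * exp (- (a/2) * \<bar>x\<bar>)))"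
        by (intro si' continuous_intros \<kappa>c)
      show "cmod (\<kappa> u * ?P u - \<kappa> u * gend j (zu u) x t) \<le> cmod (\<kappa> u) * (D / 2 ^ N * exp (- (a/2) * \<bar>x\<bar>))" if "u \<in> {0..<R}" for u
        unfolding right_diff_distrib[symmetric] norm_mult by (rule mult_left_mono[OF D(2)[OF zu\<rho>[OF that]]]) simp
    qed
    also have "\<dots> = I * D * (1/2) ^ N * exp (- (a/2) * \<bar>x\<bar>)"
      unfolding set_integral_mult_left I_def[symmetric] by (simp add: power_divide)
    also have "\<dots> \<le> \<epsilon> / 2 * exp (- (a/2) * \<bar>x\<bar>)"
      using N by (intro mult_right_mono) auto
    finally have A: "cmod (lcomb j N d t x - (LINT u:{0..<R}|lborel. \<kappa> u * gend j (zu u) x t)) \<le> \<epsilon> / 2 * exp (- (a/2) * \<bar>x\<bar>)" .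
    have "cmod (LINT u:{R..}|lborel. exp (- a * u) *\<^sub>R ?h (x - \<sigma> * u)) \<le> C * (2 / a) * exp (- (a/2) * R) * exp (- (a/2) * \<bar>x\<bar>)"
      by (rule Jt_bound) (use gend_continuous[OF j] C(2) assms R(1) in auto)
    also have "\<dots> \<le> \<epsilon> / 2 * exp (- (a/2) * \<bar>x\<bar>)"
      using R(2) by (intro mult_right_mono) auto
    finally have B: "cmod (LINT u:{R..}|lborel. exp (- a * u) *\<^sub>R ?h (x - \<sigma> * u)) \<le> \<epsilon> / 2 * exp (- (a/2) * \<bar>x\<bar>)" .
    show ?thesis
      unfolding split using A B
        norm_triangle_ineq4[of "lcomb j N d t x - (LINT u:{0..<R}|lborel. \<kappa> u * gend j (zu u) x t)" "LINT u:{R..}|lborel. exp (- a * u) *\<^sub>R ?h (x - \<sigma> * u)"]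
      by (simp only: diff_diff_eq)
  qed
  then show "\<exists>N d. \<forall>j\<le>2. \<forall>x. cmod (lcomb j N d t x - Jt a \<sigma> (\<lambda>x. gend j z x t) x) \<le> \<epsilon> * exp (- (a/2) * \<bar>x\<bar>)"
    by blast
qed

section \<open>The states eta\<close>

definition coh :: "nat \<Rightarrow> complex \<Rightarrow> real \<Rightarrow> real \<Rightarrow> complex" where
  "coh j z x t = complex_of_real (exp (- (cmod z)\<^sup>2 / 2)) * gend j z x t"

text \<open>\<open>exp (- a \<bar>y\<bar>) / (2 a)\<close> is the convolution kernel of the inverse of \<open>a\<^sup>2 - d\<^sup>2/dx\<^sup>2\<close>.\<close>

definition resolvent :: "real \<Rightarrow> (real \<Rightarrow> complex) \<Rightarrow> real \<Rightarrow> complex" where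
  "resolvent a h x = (Jt a 1 h x + Jt a (- 1) h x) / complex_of_real (2 * a)"

text \<open>This is L f_z for the resolvent f_z of psi_z, with the derivative of f_z written as the
  resolvent of the derivative.\<close>

definition eta :: "real \<Rightarrow> complex \<Rightarrow> real \<Rightarrow> real \<Rightarrow> complex" where
  "eta a z x t = resolvent a (\<lambda>x. coh 1 z x t) x
     - complex_of_real (a * tanh (a * x)) * resolvent a (\<lambda>x. coh 0 z x t) x"

text \<open>The variable x is moved into the integrand: \<open>Jt\<close> of h at x is
  \<open>Jt\<close> at 0 of the function translated by x, and the translation becomes the
  parameter.\<close>

lemma Jt_has_vector_derivative:
  assumes "a > 0" "\<bar>\<sigma>\<bar> = 1" and h: "edec (a/2) h" and h': "edec (a/2) h'"
    and der: "\<And>x. (h has_vector_derivative h' x) (at x)"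
  shows "(Jt a \<sigma> h has_vector_derivative Jt a \<sigma> h' x) (at x)"
proof -
  obtain C where C: "C \<ge> 0" "\<And>x. cmod (h x) \<le> C * exp (- (a/2) * \<bar>x\<bar>)" "continuous_on UNIV h"
    using h by (rule edecE) blast
  obtain D where D: "D \<ge> 0" "\<And>x. cmod (h' x) \<le> D * exp (- (a/2) * \<bar>x\<bar>)" "continuous_on UNIV h'"
    using h' by (rule edecE) blast
  \<comment> \<open>Translations by at most |x| + 1 cost this exponential factor in the weighted
    bound.\<close>
  define M where "M = (C + D) * exp (a/2 * (\<bar>x\<bar> + 1))"
  have M: "K * exp (- (a/2) * \<bar>y + \<tau>\<bar>) \<le> M * exp (- (a/2) * \<bar>y\<bar>)" if "\<bar>\<tau> - x\<bar> < 1" "0 \<le> K" "K \<le> C + D" for y \<tau> K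
  proof -
    have "exp (- (a/2) * \<bar>y + \<tau>\<bar>) \<le> exp (a/2 * (\<bar>x\<bar> + 1)) * exp (- (a/2) * \<bar>y\<bar>)"
      using that \<open>a > 0\<close> by (intro exp_abs_shift) auto
    then have "K * exp (- (a/2) * \<bar>y + \<tau>\<bar>) \<le> (C + D) * (exp (a/2 * (\<bar>x\<bar> + 1)) * exp (- (a/2) * \<bar>y\<bar>))"
      using that by (intro mult_mono) auto
    then show ?thesis by (simp add: M_def mult.assoc)
  qed
  have "((\<lambda>\<tau>. Jt a \<sigma> (\<lambda>y. h (y + \<tau>)) 0) has_vector_derivative Jt a \<sigma> (\<lambda>y. h' (y + x)) 0) (at x)"
  proof (rule Jt_param_derivative[where C=M])
    show "continuous_on UNIV (\<lambda>y. h (y + \<tau>))" for \<tau>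
      by (intro continuous_intros continuous_on_compose2[OF C(3)]) auto
    show "cmod (h (y + \<tau>)) \<le> M * exp (- (a/2) * \<bar>y\<bar>)" if "\<bar>\<tau> - x\<bar> < 1" for \<tau> y
      using order_trans[OF C(2) M[OF that C(1)]] D(1) by simp
    show "cmod (h' (y + \<tau>)) \<le> M * exp (- (a/2) * \<bar>y\<bar>)" if "\<bar>\<tau> - x\<bar> < 1" for \<tau> y
      using order_trans[OF D(2) M[OF that D(1)]] C(1) by simp
    show "((\<lambda>\<tau>. h (y + \<tau>)) has_vector_derivative h' (y + \<tau>)) (at \<tau>)" for \<tau> y
    proof -
      have "((\<lambda>\<tau>. y + \<tau>) has_vector_derivative 1) (at \<tau>)"
        by (auto intro!: derivative_eq_intros)
      from vector_diff_chain_at[OF this der] show ?thesis by (simp add: comp_def)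
    qed
  qed (use assms in auto)
  then show ?thesis by (simp add: Jt_def[abs_def] add.commute)
qed

lemma Jt_edec:
  assumes "a > 0" "\<bar>\<sigma>\<bar> = 1" "edec (a/2) h" "edec (a/2) h'"
    and der: "\<And>x. (h has_vector_derivative h' x) (at x)"
  shows "edec (a/2) (Jt a \<sigma> h)"
proof -
  obtain C where C: "C \<ge> 0" "\<And>x. cmod (h x) \<le> C * exp (- (a/2) * \<bar>x\<bar>)" "continuous_on UNIV h"
    using assms(3) by (rule edecE) blast
  show ?thesis
  proof (rule edecI)
    show "continuous_on UNIV (Jt a \<sigma> h)"
      using Jt_has_vector_derivative[OF assms]
      by (auto intro!: continuous_at_imp_continuous_on has_vector_derivative_continuous)
    show "cmod (Jt a \<sigma> h x) \<le> C * (2 / a) * exp (- (a/2) * \<bar>x\<bar>)" for x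
      using Jt_bound[OF C(3,2) assms(1,2), of 0 x] by (simp add: Jt_def)
  qed
qed

lemma coh_edec: "j \<le> 2 \<Longrightarrow> edec b (\<lambda>x. coh j z x t)"
  unfolding coh_def by (intro edec_cmult gend_edec)

lemma coh_has_vector_derivative:
  "((\<lambda>x. coh 0 z x t) has_vector_derivative coh 1 z x t) (at x)"
  "((\<lambda>x. coh 1 z x t) has_vector_derivative coh 2 z x t) (at x)"
  unfolding coh_def using gend_has_vector_derivative_space
  by (auto intro!: has_vector_derivative_mult_right simp: gend_simps(1))

lemma coh_time_derivative: "((\<lambda>t. coh 0 z x t) has_vector_derivative \<i> * coh 2 z x t) (at t)"
  unfolding coh_def gend_simps(1) mult.left_commute[of \<i>]
  by (intro has_vector_derivative_mult_right gen_has_vector_derivative_time)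

lemma psiz_eq_coh: "psiz z x t = coh 0 z x t"
  by (simp add: psiz_eq_gen coh_def gend_simps)

lemma tanh_has_vector_derivative:
  "((\<lambda>x. complex_of_real (a * tanh (a * x))) has_vector_derivative complex_of_real (a\<^sup>2 * (1 - (tanh (a * x))\<^sup>2))) (at x)"
proof -
  have "((\<lambda>x. a * tanh (a * x)) has_real_derivative a\<^sup>2 * (1 - (tanh (a * x))\<^sup>2)) (at x)"
    by (auto intro!: derivative_eq_intros simp: power2_eq_square cosh_real_nonzero)
  then show ?thesis
    by (intro has_vector_derivative_of_real) (simp add: has_real_derivative_iff_has_vector_derivative)
qed

lemma edec_a_tanh: "edec b f \<Longrightarrow> edec b (\<lambda>x. complex_of_real (a * tanh (a * x)) * f x)"
  using edec_cmult[OF edec_tanh, of b f a a] by (simp add: mult.assoc)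

section \<open>Derivatives of the resolvent and of the states eta in space and time\<close>

context
  fixes a :: real
  assumes a: "a > 0"
begin

lemma resolvent_coh_has_vector_derivative:
  "((resolvent a (\<lambda>x. coh 0 z x t)) has_vector_derivative resolvent a (\<lambda>x. coh 1 z x t) x) (at x)"
  "((resolvent a (\<lambda>x. coh 1 z x t)) has_vector_derivative resolvent a (\<lambda>x. coh 2 z x t) x) (at x)"
  unfolding resolvent_def[abs_def]
  by (intro has_vector_derivative_divide has_vector_derivative_add Jt_has_vector_derivative
      coh_edec coh_has_vector_derivative; use a in simp)+

lemma Jt_coh_1: "\<bar>\<sigma>\<bar> = 1 \<Longrightarrow> Jt a \<sigma> (\<lambda>x. coh 1 z x t) x = complex_of_real \<sigma> * (coh 0 z x t - complex_of_real a * Jt a \<sigma> (\<lambda>x. coh 0 z x t) x)"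
  using a by (intro Jt_derivative_eq coh_edec coh_has_vector_derivative) auto

lemma Jt_coh_2: "\<bar>\<sigma>\<bar> = 1 \<Longrightarrow> Jt a \<sigma> (\<lambda>x. coh 2 z x t) x = complex_of_real \<sigma> * (coh 1 z x t - complex_of_real a * Jt a \<sigma> (\<lambda>x. coh 1 z x t) x)"
  using a by (intro Jt_derivative_eq coh_edec coh_has_vector_derivative) auto

text \<open>Written with \<open>coh 0\<close> alone, so that the time derivative of this resolvent
  follows from that of \<open>coh 0\<close>, without a third space derivative.\<close>

lemma resolvent_coh_1: "resolvent a (\<lambda>x. coh 1 z x t) x = (Jt a (-1) (\<lambda>x. coh 0 z x t) x - Jt a 1 (\<lambda>x. coh 0 z x t) x) / 2"
  unfolding resolvent_def using a by (simp only: Jt_coh_1 abs_one abs_neg_one) (simp add: field_simps)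

text \<open>This is g_0 f_z = psi_z, the second derivative being taken under the convolution: the
  first-order equations of the two halves are applied twice.\<close>

lemma resolvent_coh_2: "resolvent a (\<lambda>x. coh 2 z x t) x = complex_of_real (a\<^sup>2) * resolvent a (\<lambda>x. coh 0 z x t) x - coh 0 z x t"
  unfolding resolvent_def using a by (simp only: Jt_coh_1 Jt_coh_2 abs_one abs_neg_one) (simp add: field_simps power2_eq_square)

lemma resolvent_coh_edec: "j \<le> 1 \<Longrightarrow> edec (a/2) (resolvent a (\<lambda>x. coh j z x t))"
proof -
  assume "j \<le> 1"
  have 0: "edec (a/2) (Jt a \<sigma> (\<lambda>x. coh 0 z x t))" and 1: "edec (a/2) (Jt a \<sigma> (\<lambda>x. coh 1 z x t))" if "\<bar>\<sigma>\<bar> = 1" for \<sigma>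
    using that a by (intro Jt_edec[where h'="\<lambda>x. coh 1 z x t"] Jt_edec[where h'="\<lambda>x. coh 2 z x t"] coh_edec coh_has_vector_derivative; simp)+
  have "edec (a/2) (Jt a 1 (\<lambda>x. coh j z x t))" "edec (a/2) (Jt a (-1) (\<lambda>x. coh j z x t))"
    using \<open>j \<le> 1\<close> 0 1 by (cases j; simp)+
  then show ?thesis
    unfolding resolvent_def[abs_def] divide_inverse mult.commute[of _ "inverse _"]
    by (intro edec_cmult edec_add)
qed

lemma Jt_coh_time_derivative:
  assumes "\<bar>\<sigma>\<bar> = 1"
  shows "((\<lambda>t. Jt a \<sigma> (\<lambda>x. coh 0 z x t) x) has_vector_derivative \<i> * Jt a \<sigma> (\<lambda>x. coh 2 z x t) x) (at t)"
proof -
  obtain C where C: "C \<ge> 0" "\<And>j w x s. cmod w \<le> cmod z \<Longrightarrow> \<bar>s\<bar> \<le> \<bar>t\<bar> + 1 \<Longrightarrow> cmod (gend j w x s) \<le> C * exp (- (a/2) * \<bar>x\<bar>)"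
    by (rule gend_bound) blast
  have bd: "cmod (coh j z x \<tau>) \<le> C * exp (- (a/2) * \<bar>x\<bar>)" if "\<bar>\<tau> - t\<bar> < 1" for j x \<tau>
  proof -
    have g: "cmod (gend j z x \<tau>) \<le> C * exp (- (a/2) * \<bar>x\<bar>)" using that by (intro C(2)) auto
    have "cmod (complex_of_real (exp (- (cmod z)\<^sup>2 / 2))) \<le> 1" by simp
    from mult_mono[OF this g] show ?thesis by (simp add: coh_def norm_mult)
  qed
  have "((\<lambda>t. Jt a \<sigma> (\<lambda>x. coh 0 z x t) x) has_vector_derivative Jt a \<sigma> (\<lambda>x. \<i> * coh 2 z x t) x) (at t)"
  proof (rule Jt_param_derivative[where C=C])
    show "continuous_on UNIV (\<lambda>x. coh 0 z x \<tau>)" for \<tau>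
      using coh_edec[of 0 1 z \<tau>] by (simp add: edec_def)
    show "cmod (\<i> * coh 2 z x \<tau>) \<le> C * exp (- (a/2) * \<bar>x\<bar>)" if "\<bar>\<tau> - t\<bar> < 1" for \<tau> x
      using bd[OF that, of 2 x] by (simp add: norm_mult)
  qed (use bd coh_time_derivative a assms in auto)
  also have "Jt a \<sigma> (\<lambda>x. \<i> * coh 2 z x t) x = \<i> * Jt a \<sigma> (\<lambda>x. coh 2 z x t) x"
    unfolding Jt_def by (simp only: mult_scaleR_right[symmetric] set_integral_mult_right)
  finally show ?thesis .
qed

lemma resolvent_coh_time_derivative:
  "((\<lambda>t. resolvent a (\<lambda>x. coh 0 z x t) x) has_vector_derivative
     \<i> * (complex_of_real (a\<^sup>2) * resolvent a (\<lambda>x. coh 0 z x t) x - coh 0 z x t)) (at t)"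
  "((\<lambda>t. resolvent a (\<lambda>x. coh 1 z x t) x) has_vector_derivative
     \<i> * (complex_of_real (a\<^sup>2) * resolvent a (\<lambda>x. coh 1 z x t) x - coh 1 z x t)) (at t)"
proof -
  have "((\<lambda>t. resolvent a (\<lambda>x. coh 0 z x t) x) has_vector_derivative \<i> * resolvent a (\<lambda>x. coh 2 z x t) x) (at t)"
    unfolding resolvent_def times_divide_eq_right distrib_left
    by (intro has_vector_derivative_divide has_vector_derivative_add Jt_coh_time_derivative) simp_all
  then show "((\<lambda>t. resolvent a (\<lambda>x. coh 0 z x t) x) has_vector_derivative
     \<i> * (complex_of_real (a\<^sup>2) * resolvent a (\<lambda>x. coh 0 z x t) x - coh 0 z x t)) (at t)"
    unfolding resolvent_coh_2 .
  have "((\<lambda>t. resolvent a (\<lambda>x. coh 1 z x t) x) has_vector_derivative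
      (\<i> * Jt a (-1) (\<lambda>x. coh 2 z x t) x - \<i> * Jt a 1 (\<lambda>x. coh 2 z x t) x) / 2) (at t)"
    unfolding resolvent_coh_1
    by (intro has_vector_derivative_divide has_vector_derivative_diff Jt_coh_time_derivative) simp_all
  moreover have "(\<i> * Jt a (-1) (\<lambda>x. coh 2 z x t) x - \<i> * Jt a 1 (\<lambda>x. coh 2 z x t) x) / 2 =
     \<i> * (complex_of_real (a\<^sup>2) * resolvent a (\<lambda>x. coh 1 z x t) x - coh 1 z x t)"
    unfolding resolvent_def using a by (simp only: Jt_coh_2 abs_one abs_neg_one) (simp add: field_simps power2_eq_square)
  ultimately show "((\<lambda>t. resolvent a (\<lambda>x. coh 1 z x t) x) has_vector_derivative
     \<i> * (complex_of_real (a\<^sup>2) * resolvent a (\<lambda>x. coh 1 z x t) x - coh 1 z x t)) (at t)"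
    by simp
qed

text \<open>This is L^+ eta_z = psi_z. The Riccati identity w' + w^2 = a^2 for w = a tanh (a x)
  gives L^+ L = g_0, and eta_z = L f_z.\<close>

lemma eta_has_vector_derivative:
  "((\<lambda>x. eta a z x t) has_vector_derivative - complex_of_real (a * tanh (a * x)) * eta a z x t - coh 0 z x t) (at x)"
proof -
  let ?T = "complex_of_real (tanh (a * x))" and ?F = "resolvent a (\<lambda>x. coh 0 z x t)" and ?G = "resolvent a (\<lambda>x. coh 1 z x t)"
  have "((\<lambda>x. eta a z x t) has_vector_derivative resolvent a (\<lambda>x. coh 2 z x t) x
     - (complex_of_real (a * tanh (a * x)) * ?G x + complex_of_real (a\<^sup>2 * (1 - (tanh (a * x))\<^sup>2)) * ?F x)) (at x)"
    unfolding eta_def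
    by (intro has_vector_derivative_diff has_vector_derivative_mult tanh_has_vector_derivative resolvent_coh_has_vector_derivative)
  moreover have "resolvent a (\<lambda>x. coh 2 z x t) x
     - (complex_of_real (a * tanh (a * x)) * ?G x + complex_of_real (a\<^sup>2 * (1 - (tanh (a * x))\<^sup>2)) * ?F x)
     = - complex_of_real (a * tanh (a * x)) * eta a z x t - coh 0 z x t"
    unfolding resolvent_coh_2 eta_def by (simp add: algebra_simps power2_eq_square)
  ultimately show ?thesis by simp
qed

lemma dx_eta: "dx (\<lambda>x. eta a z x t) = (\<lambda>x. - complex_of_real (a * tanh (a * x)) * eta a z x t - coh 0 z x t)"
  using vector_derivative_dx[OF eta_has_vector_derivative] by (rule ext)

lemma dx_eta_has_vector_derivative:
  "(dx (\<lambda>x. eta a z x t) has_vector_derivative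
     - complex_of_real (2 * a\<^sup>2 * (1 - (tanh (a * x))\<^sup>2)) * eta a z x t
     + complex_of_real (a\<^sup>2) * eta a z x t + complex_of_real (a * tanh (a * x)) * coh 0 z x t - coh 1 z x t) (at x)"
proof -
  let ?T = "complex_of_real (a * tanh (a * x))"
  have "(dx (\<lambda>x. eta a z x t) has_vector_derivative
     - (?T * (- ?T * eta a z x t - coh 0 z x t) + complex_of_real (a\<^sup>2 * (1 - (tanh (a * x))\<^sup>2)) * eta a z x t) - coh 1 z x t) (at x)"
    unfolding dx_eta minus_mult_left[symmetric]
    by (intro has_vector_derivative_diff has_vector_derivative_minus has_vector_derivative_mult
          tanh_has_vector_derivative eta_has_vector_derivative[unfolded minus_mult_left[symmetric]] coh_has_vector_derivative)
  then show ?thesis by (rule has_vector_derivative_eq_rhs) (simp add: algebra_simps power2_eq_square)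
qed

text \<open>The other order of the factors gives h_1 = L L^+ - a^2, and L^+ eta_z = psi_z; the right
  side is L psi_z - a^2 eta_z.\<close>

lemma h1_eta: "h1 a (\<lambda>x. eta a z x t) x = coh 1 z x t - complex_of_real (a * tanh (a * x)) * coh 0 z x t
    - complex_of_real (a\<^sup>2) * eta a z x t"
proof -
  have "(1 / cosh (a * x))\<^sup>2 = 1 - (tanh (a * x))\<^sup>2"
  proof -
    have "1 - (tanh (a * x))\<^sup>2 = ((cosh (a * x))\<^sup>2 - (sinh (a * x))\<^sup>2) / (cosh (a * x))\<^sup>2"
      by (simp add: tanh_def power_divide diff_divide_distrib)
    then show ?thesis by (simp add: cosh_square_eq power_divide)
  qed
  then show ?thesis
    unfolding h1_def vector_derivative_dx[OF dx_eta_has_vector_derivative] by (simp only:) (simp add: algebra_simps)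
qed

lemma eta_edec: "edec (a/2) (\<lambda>x. eta a z x t)"
  unfolding eta_def by (intro edec_diff edec_a_tanh resolvent_coh_edec) auto

text \<open>The coefficients of L do not depend on time, and the resolvent satisfies i df_z/dt =
  psi_z - a^2 f_z. Applying L gives exactly the value of h_1 eta_z.\<close>

lemma eta_solves: "solves_schroedinger1 a (eta a z)"
proof -
  have t: "((\<lambda>s. eta a z x s) has_vector_derivative
      \<i> * (complex_of_real (a\<^sup>2) * eta a z x t - coh 1 z x t + complex_of_real (a * tanh (a * x)) * coh 0 z x t)) (at t)" for x t
  proof -
    have "((\<lambda>s. eta a z x s) has_vector_derivative
      \<i> * (complex_of_real (a\<^sup>2) * resolvent a (\<lambda>x. coh 1 z x t) x - coh 1 z x t) - complex_of_real (a * tanh (a * x)) *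
      (\<i> * (complex_of_real (a\<^sup>2) * resolvent a (\<lambda>x. coh 0 z x t) x - coh 0 z x t))) (at t)"
      unfolding eta_def
      by (intro has_vector_derivative_diff has_vector_derivative_mult_right resolvent_coh_time_derivative)
    then show ?thesis by (rule has_vector_derivative_eq_rhs) (simp add: eta_def algebra_simps)
  qed
  have "\<i> * vector_derivative (\<lambda>s. eta a z x s) (at t) = h1 a (\<lambda>w. eta a z w t) x" for x t
  proof -
    have "\<i> * (\<i> * w) = - w" for w by (simp flip: mult.assoc)
    then show ?thesis
      unfolding vector_derivative_at[OF t] h1_eta by (simp only:) simp
  qed
  then show ?thesis
    unfolding solves_schroedinger1_def
    by (intro allI conjI differentiableI_vector[OF t] differentiableI_vector[OF eta_has_vector_derivative]
        differentiableI_vector[OF dx_eta_has_vector_derivative])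
qed

section \<open>Membership in the graph of \<open>M\<close>, in \<open>H1\<close> and in the domain
  of h_1\<close>

lemma resolvent_coh_approximable: "approximable (a/2) t (\<lambda>j. resolvent a (\<lambda>x. coh j z x t))"
proof -
  let ?k = "complex_of_real (exp (- (cmod z)\<^sup>2 / 2))"
  have J: "Jt a \<sigma> (\<lambda>x. coh j z x t) x = ?k * Jt a \<sigma> (\<lambda>x. gend j z x t) x" for \<sigma> j x
    unfolding Jt_def coh_def by (simp only: mult_scaleR_right[symmetric] set_integral_mult_right)
  have "approximable (a/2) t (\<lambda>j x. (?k / complex_of_real (2 * a)) * (Jt a 1 (\<lambda>x. gend j z x t) x + Jt a (-1) (\<lambda>x. gend j z x t) x))"
    by (rule approximable_cmult, rule approximable_add; rule Jt_gend_approximable) (use a in simp_all)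
  then show ?thesis
    by (simp add: resolvent_def[abs_def] J distrib_left add_divide_distrib)
qed

lemma l2conv_of_decay_bound:
  assumes bd: "\<And>k x. cmod (fs k x - f x) \<le> e k * exp (- b * \<bar>x\<bar>)" and e: "e \<longlonglongrightarrow> 0" and b: "b > 0"
  shows "l2conv fs f"
  unfolding l2conv_def
proof (rule real_tendsto_sandwich[where f="\<lambda>_. 0" and h="\<lambda>k. (e k)\<^sup>2 * (LINT x|lborel. exp (- (2 * b) * \<bar>x\<bar>))"])
  have i: "integrable lborel (\<lambda>x. exp (- (2 * b) * \<bar>x\<bar>))" by (rule integrable_exp_neg_abs) (use b in simp)
  have "(LINT x|lborel. (cmod (fs k x - f x))\<^sup>2) \<le> (LINT x|lborel. (e k)\<^sup>2 * exp (- (2 * b) * \<bar>x\<bar>))" for k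
  proof (rule integral_mono')
    show "integrable lborel (\<lambda>x. (e k)\<^sup>2 * exp (- (2 * b) * \<bar>x\<bar>))" using i by (rule integrable_mult_right)
    show "(cmod (fs k x - f x))\<^sup>2 \<le> (e k)\<^sup>2 * exp (- (2 * b) * \<bar>x\<bar>)" for x
    proof -
      have "(exp (- b * \<bar>x\<bar>))\<^sup>2 = exp (- (2 * b) * \<bar>x\<bar>)" by (simp add: exp_double[symmetric])
      then show ?thesis using power_mono[OF bd[of k x], of 2] by (simp add: power_mult_distrib)
    qed
  qed simp
  then show "\<forall>\<^sub>F k in sequentially. (LINT x|lborel. (cmod (fs k x - f x))\<^sup>2) \<le> (e k)\<^sup>2 * (LINT x|lborel. exp (- (2 * b) * \<bar>x\<bar>))"
    by simp
  have "(\<lambda>k. (e k)\<^sup>2 * (LINT x|lborel. exp (- (2 * b) * \<bar>x\<bar>))) \<longlonglongrightarrow> 0\<^sup>2 * (LINT x|lborel. exp (- (2 * b) * \<bar>x\<bar>))"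
    by (intro tendsto_intros e)
  then show "(\<lambda>k. (e k)\<^sup>2 * (LINT x|lborel. exp (- (2 * b) * \<bar>x\<bar>))) \<longlonglongrightarrow> 0" by simp
qed (auto intro!: always_eventually)

text \<open>One sequence \<open>fs\<close> certifies everything: the graph closure at f_z, the
  convergence in the form norm required by \<open>Lbar\<close>, and the L^2 convergence of
  \<open>Lop a (fs k)\<close> to eta_z.\<close>

lemma eta_Mrel_H1:
  "Mrel a t (\<lambda>x. psiz z x t) (\<lambda>x. eta a z x t)" "(\<lambda>x. eta a z x t) \<in> H1 a t"
proof -
  have a2: "a/2 > 0" using a by simp
  let ?f = "resolvent a (\<lambda>x. coh 0 z x t)"
  obtain N d where ap: "\<And>k j x. j \<le> 2 \<Longrightarrow>
     cmod (lcomb j (N k) (d k) t x - resolvent a (\<lambda>x. coh j z x t) x) \<le> 1 / Suc k * exp (- (a/2) * \<bar>x\<bar>)"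
    using approximable_sequence[OF resolvent_coh_approximable] by blast
  define fs where "fs k = lcomb 0 (N k) (d k) t" for k
  have fsL0: "fs k \<in> L0 t" for k unfolding fs_def by (rule lcomb_in_L0)
  have lim: "(\<lambda>k. c * (1 / Suc k)) \<longlonglongrightarrow> 0" for c :: real
    using tendsto_mult_right_zero[OF LIMSEQ_Suc[OF lim_1_over_n], of c] by simp
  have psi_edec: "edec (a/2) (\<lambda>x. psiz z x t)" unfolding psiz_eq_coh by (rule coh_edec) simp
  \<comment> \<open>This is - f_z''; its decay follows from the resolvent equation, which rewrites
    it as psi_z - a^2 f_z.\<close>
  let ?g = "\<lambda>x. - resolvent a (\<lambda>x. coh 2 z x t) x"
  have g_edec: "edec (a/2) ?g"
    unfolding resolvent_coh_2 minus_diff_eq by (intro edec_diff edec_cmult resolvent_coh_edec coh_edec) auto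
  have h0: "h0bar t ?f ?g"
    unfolding h0bar_def
  proof (intro conjI exI[of _ fs] allI fsL0)
    show "L2 ?f" by (rule edec_L2[OF resolvent_coh_edec a2]) simp
    show "L2 ?g" by (rule edec_L2[OF g_edec a2])
    show "l2conv fs ?f"
      unfolding fs_def by (rule l2conv_of_decay_bound[OF _ lim[of 1] a2]) (use ap[of 0] in simp)
    show "l2conv (\<lambda>k x. - dx (dx (fs k)) x) ?g"
    proof (rule l2conv_of_decay_bound[OF _ lim[of 1] a2])
      show "cmod (- dx (dx (fs k)) x - ?g x) \<le> 1 * (1 / real (Suc k)) * exp (- (a/2) * \<bar>x\<bar>)" for k x
        using ap[of 2 k x] unfolding fs_def dx_lcomb by (simp add: norm_minus_commute)
    qed
  qed
  have psi: "(\<lambda>x. psiz z x t) = (\<lambda>x. ?g x + complex_of_real (a\<^sup>2) * ?f x)"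
    by (simp add: psiz_eq_coh resolvent_coh_2 fun_eq_iff)
  have g0: "g0bar a t ?f (\<lambda>x. psiz z x t)"
    unfolding g0bar_def by (intro exI[of _ ?g] conjI h0 psi)
  have Lconv: "l2conv (\<lambda>k. Lop a (fs k)) (\<lambda>x. eta a z x t)"
  proof (rule l2conv_of_decay_bound[OF _ lim[of "1 + a"] a2])
    fix k x
    have T: "cmod (complex_of_real (a * tanh (a * x))) \<le> a"
    proof -
      have "\<bar>tanh (a * x)\<bar> \<le> 1" using tanh_real_bounds[of "a * x"] by auto
      from mult_left_mono[OF this, of a] show ?thesis using a unfolding norm_of_real by (simp add: abs_mult)
    qed
    have eq: "Lop a (fs k) x - eta a z x t = (lcomb 1 (N k) (d k) t x - resolvent a (\<lambda>x. coh 1 z x t) x)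
       - complex_of_real (a * tanh (a * x)) * (lcomb 0 (N k) (d k) t x - ?f x)"
      unfolding fs_def Lop_lcomb eta_def by (simp add: algebra_simps)
    have m2: "cmod (complex_of_real (a * tanh (a * x)) * (lcomb 0 (N k) (d k) t x - ?f x)) \<le> a * (1 / Suc k * exp (- (a/2) * \<bar>x\<bar>))"
      unfolding norm_mult using a by (intro mult_mono T ap) auto
    have m1: "cmod (lcomb 1 (N k) (d k) t x - resolvent a (\<lambda>x. coh 1 z x t) x) \<le> 1 / Suc k * exp (- (a/2) * \<bar>x\<bar>)"
      by (rule ap) simp
    have "cmod (Lop a (fs k) x - eta a z x t) \<le> 1 / Suc k * exp (- (a/2) * \<bar>x\<bar>) + a * (1 / Suc k * exp (- (a/2) * \<bar>x\<bar>))"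
      unfolding eq by (rule order_trans[OF norm_triangle_ineq4 add_mono[OF m1 m2]])
    then show "cmod (Lop a (fs k) x - eta a z x t) \<le> (1 + a) * (1 / real (Suc k)) * exp (- (a/2) * \<bar>x\<bar>)"
      by (simp only: distrib_right mult.assoc mult_1)
  qed
  have L2e: "L2 (\<lambda>x. eta a z x t)" by (rule edec_L2[OF eta_edec a2])
  have "Lop a (fs k) \<in> L1 a t" for k unfolding L1_eq_Lop_lcomb fs_def by (intro CollectI exI) (rule refl)
  then show "(\<lambda>x. eta a z x t) \<in> H1 a t"
    unfolding H1_def by (intro CollectI conjI exI[of _ "\<lambda>k. Lop a (fs k)"] allI L2e Lconv)
  \<comment> \<open>Both differences are small at rate a/2, so their product is integrable at rate
    a.\<close>
  have "(\<lambda>k. cmod (inner0 (\<lambda>x. fs k x - ?f x) (\<lambda>x. Defs.g0 a (fs k) x - psiz z x t))) \<longlonglongrightarrow> 0"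
  proof (rule real_tendsto_sandwich[where f="\<lambda>_. 0" and h="\<lambda>k. (1 + a\<^sup>2) * (LINT x|lborel. exp (- a * \<bar>x\<bar>)) * (1 / Suc k)"])
    have "cmod (inner0 (\<lambda>x. fs k x - ?f x) (\<lambda>x. Defs.g0 a (fs k) x - psiz z x t)) \<le> (1 + a\<^sup>2) * (LINT x|lborel. exp (- a * \<bar>x\<bar>)) * (1 / Suc k)" for k
    proof -
      have k1: "1 / real (Suc k) \<le> 1" by simp
      have "cmod (inner0 (\<lambda>x. fs k x - ?f x) (\<lambda>x. Defs.g0 a (fs k) x - psiz z x t))
        \<le> (LINT x|lborel. cmod (cnj (fs k x - ?f x) * (Defs.g0 a (fs k) x - psiz z x t)))"
        unfolding inner0_def by (rule integral_norm_bound)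
      also have "\<dots> \<le> (LINT x|lborel. (1 + a\<^sup>2) * (1 / Suc k) * exp (- a * \<bar>x\<bar>))"
      proof (rule integral_mono')
        show "integrable lborel (\<lambda>x. (1 + a\<^sup>2) * (1 / Suc k) * exp (- a * \<bar>x\<bar>))"
          by (intro integrable_mult_right integrable_exp_neg_abs a)
        fix x :: real
        let ?e = "1 / Suc k * exp (- (a/2) * \<bar>x\<bar>)"
        have eq: "Defs.g0 a (fs k) x - psiz z x t = - (lcomb 2 (N k) (d k) t x - resolvent a (\<lambda>x. coh 2 z x t) x)
            + complex_of_real (a\<^sup>2) * (lcomb 0 (N k) (d k) t x - ?f x)"
          unfolding Defs.g0_def fs_def dx_lcomb fun_cong[OF psi] by (simp add: algebra_simps)
        have "cmod (complex_of_real (a\<^sup>2) * (lcomb 0 (N k) (d k) t x - ?f x)) \<le> a\<^sup>2 * ?e"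
          unfolding norm_mult using ap[of 0 k x] by (intro mult_mono) (auto simp: norm_power)
        then have 2: "cmod (Defs.g0 a (fs k) x - psiz z x t) \<le> (1 + a\<^sup>2) * ?e"
          using norm_triangle_ineq[of "- (lcomb 2 (N k) (d k) t x - resolvent a (\<lambda>x. coh 2 z x t) x)" "complex_of_real (a\<^sup>2) * (lcomb 0 (N k) (d k) t x - ?f x)"]
            ap[of 2 k x] unfolding eq norm_minus_cancel distrib_right mult_1 by linarith
        have 1: "cmod (fs k x - ?f x) \<le> ?e" unfolding fs_def by (rule ap) simp
        \<comment> \<open>One of the two small factors is given up, which leaves a bound linear in 1
          / (k + 1).\<close>
        have 3: "?e \<le> exp (- (a/2) * \<bar>x\<bar>)" using mult_right_mono[OF k1, of "exp (- (a/2) * \<bar>x\<bar>)"] by (simp only: mult_1 exp_ge_zero)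
        have "cmod (cnj (fs k x - ?f x) * (Defs.g0 a (fs k) x - psiz z x t)) \<le> ?e * ((1 + a\<^sup>2) * exp (- (a/2) * \<bar>x\<bar>))"
          unfolding norm_mult complex_mod_cnj
        proof (rule mult_mono[OF 1])
          show "cmod (Defs.g0 a (fs k) x - psiz z x t) \<le> (1 + a\<^sup>2) * exp (- (a/2) * \<bar>x\<bar>)"
            by (rule order_trans[OF 2 mult_left_mono[OF 3]]) simp
        qed auto
        also have "\<dots> = (1 + a\<^sup>2) * (1 / Suc k) * exp (- a * \<bar>x\<bar>)"
        proof -
          have "exp (- a * \<bar>x\<bar>) = exp (- (a/2) * \<bar>x\<bar>) * exp (- (a/2) * \<bar>x\<bar>)" by (simp add: exp_add[symmetric])
          then show ?thesis by (simp only: mult_ac)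
        qed
        finally show "cmod (cnj (fs k x - ?f x) * (Defs.g0 a (fs k) x - psiz z x t)) \<le> (1 + a\<^sup>2) * (1 / Suc k) * exp (- a * \<bar>x\<bar>)" .
      qed simp
      also have "\<dots> = (1 + a\<^sup>2) * (LINT x|lborel. exp (- a * \<bar>x\<bar>)) * (1 / Suc k)"
        by simp
      finally show ?thesis .
    qed
    then show "\<forall>\<^sub>F k in sequentially. cmod (inner0 (\<lambda>x. fs k x - ?f x) (\<lambda>x. Defs.g0 a (fs k) x - psiz z x t)) \<le> (1 + a\<^sup>2) * (LINT x|lborel. exp (- a * \<bar>x\<bar>)) * (1 / Suc k)"
      by simp
  qed (use lim in auto)
  then have "Lbar a t ?f (\<lambda>x. eta a z x t)"
    unfolding Lbar_def by (intro conjI L2e exI[of _ "\<lambda>x. psiz z x t"] exI[of _ fs] allI g0 fsL0 Lconv)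
  then show "Mrel a t (\<lambda>x. psiz z x t) (\<lambda>x. eta a z x t)"
    unfolding Mrel_def by (intro exI[of _ ?f] conjI g0)
qed

lemma eta_dom_h1: "(\<lambda>x. eta a z x t) \<in> dom_h1 a t"
proof -
  have "edec (a/2) (h1 a (\<lambda>x. eta a z x t))"
    unfolding h1_eta[abs_def] using eta_edec by (intro edec_diff edec_a_tanh edec_cmult coh_edec) auto
  then have "L2 (h1 a (\<lambda>x. eta a z x t))" by (rule edec_L2) (use a in simp)
  then show ?thesis
    unfolding dom_h1_def
    by (intro CollectI conjI allI eta_Mrel_H1(2) differentiableI_vector[OF eta_has_vector_derivative]
        differentiableI_vector[OF dx_eta_has_vector_derivative])
qed

end

section \<open>Gaussian moments on the complex plane\<close>

lemma nn_integral_gaussian: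
  fixes c :: real
  assumes "c > 0"
  shows "(\<integral>\<^sup>+x. ennreal (exp (- c * x\<^sup>2)) \<partial>lborel) = ennreal (sqrt (pi / c))"
proof -
  define \<sigma> where "\<sigma> = sqrt (1 / (2 * c))"
  have s: "\<sigma> > 0" "\<sigma>\<^sup>2 = 1 / (2 * c)" using assms by (auto simp: \<sigma>_def)
  have "sqrt (2 * pi * \<sigma>\<^sup>2) = sqrt (pi / c)" using assms by (simp add: s)
  moreover have "(x - 0)\<^sup>2 / (2 * \<sigma>\<^sup>2) = c * x\<^sup>2" for x using assms by (simp add: s field_simps)
  ultimately have eq: "exp (- c * x\<^sup>2) = sqrt (pi / c) * normal_density 0 \<sigma> x" for x
    using assms by (simp add: normal_density_def)
  have "has_bochner_integral lborel (normal_density 0 \<sigma>) 1"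
    using integral_normal_density[OF s(1), of 0] integrable_normal_density[OF s(1), of 0]
    by (simp add: has_bochner_integral_iff)
  then have "has_bochner_integral lborel (\<lambda>x. exp (- c * x\<^sup>2)) (sqrt (pi / c))"
    unfolding eq using has_bochner_integral_mult_right[of "sqrt (pi / c)" lborel "normal_density 0 \<sigma>" 1] by simp
  then show ?thesis
    by (simp add: has_bochner_integral_iff nn_integral_eq_integral)
qed

lemma has_bochner_integral_complex_gaussian:
  fixes c :: real
  assumes "c > 0"
  shows "has_bochner_integral lborel (\<lambda>z::complex. exp (- c * (cmod z)\<^sup>2)) (pi / c)"
proof (rule has_bochner_integral_nn_integral)
  have "(\<integral>\<^sup>+z. (\<Prod>b\<in>Basis. ennreal (exp (- c * (z \<bullet> b)\<^sup>2))) \<partial>(lborel :: complex measure)) =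
      (\<Prod>b\<in>(Basis :: complex set). (\<integral>\<^sup>+x. ennreal (exp (- c * x\<^sup>2)) \<partial>lborel))"
    by (rule nn_integral_lborel_prod) auto
  also have "\<dots> = ennreal (pi / c)"
    unfolding nn_integral_gaussian[OF assms] using assms
    by (simp add: Basis_complex_def ennreal_mult[symmetric])
  also have "(\<lambda>z::complex. \<Prod>b\<in>Basis. ennreal (exp (- c * (z \<bullet> b)\<^sup>2))) = (\<lambda>z. ennreal (exp (- c * (cmod z)\<^sup>2)))"
    by (simp add: fun_eq_iff Basis_complex_def ennreal_mult[symmetric] exp_add[symmetric] cmod_power2 algebra_simps)
  finally show "(\<integral>\<^sup>+z. ennreal (exp (- c * (cmod z)\<^sup>2)) \<partial>(lborel :: complex measure)) = ennreal (pi / c)" .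
qed (use assms in auto)

lemma power_le_exp:
  fixes r :: real
  assumes "r \<ge> 0"
  shows "r ^ m \<le> real m ^ m * exp r"
proof (cases "m = 0")
  case False
  have "r / m \<le> exp (r / m)" using exp_ge_add_one_self[of "r / m"] by linarith
  then have "r \<le> m * exp (r / m)" using False by (simp add: field_simps)
  then have "r ^ m \<le> (m * exp (r / m)) ^ m" using assms by (rule power_mono)
  also have "\<dots> = real m ^ m * exp r"
    using False by (simp add: power_mult_distrib exp_of_nat_mult[symmetric])
  finally show ?thesis .
qed (use assms in simp)

text \<open>exp r absorbs the power, and half of the Gaussian absorbs exp r because (r - 1)^2 \<ge>
  0. The constant is crude; it only has to give integrability.\<close>

lemma power_gaussian_bound:
  fixes r :: real
  assumes "r \<ge> 0"
  shows "r ^ m * exp (- r\<^sup>2) \<le> real m ^ m * exp 1 * exp (- (1/2) * r\<^sup>2)"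
proof -
  have "0 \<le> (r - 1)\<^sup>2" by simp
  then have "r - r\<^sup>2 \<le> 1 + - (1/2) * r\<^sup>2" by (simp add: power2_diff)
  then have "exp (r - r\<^sup>2) \<le> exp (1 + - (1/2) * r\<^sup>2)" by simp
  then have e: "exp r * exp (- r\<^sup>2) \<le> exp 1 * exp (- (1/2) * r\<^sup>2)"
    by (simp only: exp_add[symmetric] diff_conv_add_uminus)
  have "r ^ m * exp (- r\<^sup>2) \<le> real m ^ m * exp r * exp (- r\<^sup>2)"
    by (rule mult_right_mono[OF power_le_exp[OF assms]]) simp
  also have "\<dots> \<le> real m ^ m * (exp 1 * exp (- (1/2) * r\<^sup>2))"
    unfolding mult.assoc by (rule mult_left_mono[OF e]) simp
  finally show ?thesis by (simp only: mult.assoc)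
qed

definition mono_gauss :: "nat \<Rightarrow> nat \<Rightarrow> complex \<Rightarrow> complex" where
  "mono_gauss n k z = complex_of_real (exp (- (cmod z)\<^sup>2)) * z ^ n * cnj z ^ k"

lemma norm_mono_gauss: "cmod (mono_gauss n k z) \<le> real (n + k) ^ (n + k) * exp 1 * exp (- (1/2) * (cmod z)\<^sup>2)"
proof -
  have "cmod (mono_gauss n k z) = cmod z ^ (n + k) * exp (- (cmod z)\<^sup>2)"
    by (simp add: mono_gauss_def norm_mult norm_power power_add mult_ac)
  then show ?thesis using power_gaussian_bound[of "cmod z" "n + k"] by simp
qed

lemma integrable_mono_gauss: "integrable lborel (mono_gauss n k)"
proof (rule Bochner_Integration.integrable_bound)
  have "integrable lborel (\<lambda>z::complex. exp (- (1/2) * (cmod z)\<^sup>2))"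
    using has_bochner_integral_complex_gaussian[of "1/2"] by (simp add: has_bochner_integral_iff)
  then show "integrable lborel (\<lambda>z::complex. real (n + k) ^ (n + k) * exp 1 * exp (- (1/2) * (cmod z)\<^sup>2))"
    by (rule integrable_mult_right)
  show "AE z in lborel. cmod (mono_gauss n k z) \<le> norm (real (n + k) ^ (n + k) * exp 1 * exp (- (1/2) * (cmod z)\<^sup>2))"
  proof (rule AE_I2)
    fix z
    have "real (n + k) ^ (n + k) * exp 1 * exp (- (1/2) * (cmod z)\<^sup>2) \<le> norm (real (n + k) ^ (n + k) * exp 1 * exp (- (1/2) * (cmod z)\<^sup>2))"
      unfolding real_norm_def by (rule abs_ge_self)
    with norm_mono_gauss show "cmod (mono_gauss n k z) \<le> norm (real (n + k) ^ (n + k) * exp 1 * exp (- (1/2) * (cmod z)\<^sup>2))"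
      by (rule order_trans)
  qed
  have "continuous_on UNIV (mono_gauss n k)"
    unfolding mono_gauss_def by (intro continuous_intros)
  then show "mono_gauss n k \<in> borel_measurable lborel"
    using borel_measurable_continuous_onI by simp
qed

text \<open>Replaces polar coordinates: the integral of a derivative in direction v vanishes, and
  the directions 1 and i together give both Wirtinger derivatives, hence recurrences for the
  moments.\<close>

lemma integral_mono_gauss_derivative:
  assumes v: "cmod v = 1"
  shows "v * (of_nat n * integral\<^sup>L lborel (mono_gauss (n - 1) k) - integral\<^sup>L lborel (mono_gauss n (Suc k)))
       + cnj v * (of_nat k * integral\<^sup>L lborel (mono_gauss n (k - 1)) - integral\<^sup>L lborel (mono_gauss (Suc n) k)) = 0"
proof -
  define F' where "F' z = v * (of_nat n * mono_gauss (n - 1) k z - mono_gauss n (Suc k) z)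
       + cnj v * (of_nat k * mono_gauss n (k - 1) z - mono_gauss (Suc n) k z)" for z
  define K where "K = real n * (real (n - 1 + k) ^ (n - 1 + k) * exp 1) + real (n + Suc k) ^ (n + Suc k) * exp 1
    + real k * (real (n + (k - 1)) ^ (n + (k - 1)) * exp 1) + real (Suc n + k) ^ (Suc n + k) * exp 1"
  have K: "cmod (F' z) \<le> K * exp (- (1/2) * (cmod z)\<^sup>2)" for z
  proof -
    let ?E = "exp (- (1/2) * (cmod z)\<^sup>2)"
    have tri: "cmod (v * (a - b) + cnj v * (c - d)) \<le> cmod a + cmod b + cmod c + cmod d" for a b c d
    proof -
      have "cmod (v * (a - b) + cnj v * (c - d)) \<le> cmod (v * (a - b)) + cmod (cnj v * (c - d))"
        by (rule norm_triangle_ineq)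
      also have "\<dots> = cmod (a - b) + cmod (c - d)" by (simp add: norm_mult v)
      finally show ?thesis using norm_triangle_ineq4[of a b] norm_triangle_ineq4[of c d] by linarith
    qed
    have 1: "cmod (of_nat n * mono_gauss (n - 1) k z) \<le> real n * (real (n - 1 + k) ^ (n - 1 + k) * exp 1 * ?E)"
      unfolding norm_mult norm_of_nat by (rule mult_left_mono[OF norm_mono_gauss]) simp
    have 2: "cmod (of_nat k * mono_gauss n (k - 1) z) \<le> real k * (real (n + (k - 1)) ^ (n + (k - 1)) * exp 1 * ?E)"
      unfolding norm_mult norm_of_nat by (rule mult_left_mono[OF norm_mono_gauss]) simp
    have "cmod (F' z) \<le> real n * (real (n - 1 + k) ^ (n - 1 + k) * exp 1 * ?E) + real (n + Suc k) ^ (n + Suc k) * exp 1 * ?E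
      + real k * (real (n + (k - 1)) ^ (n + (k - 1)) * exp 1 * ?E) + real (Suc n + k) ^ (Suc n + k) * exp 1 * ?E"
      unfolding F'_def by (rule order_trans[OF tri]) (intro add_mono 1 2 norm_mono_gauss)
    also have "\<dots> = K * ?E" by (simp only: K_def distrib_right mult.assoc)
    finally show ?thesis .
  qed
  have K0: "K \<ge> 0" by (simp add: K_def)
  have "(LINT z|lborel. F' z) = 0"
  proof (rule integral_directional_derivative_eq_0[where F="mono_gauss n k" and v=v and g="\<lambda>z. K * exp (1/2) * exp (- (1/4) * (cmod z)\<^sup>2)"])
    show "integrable lborel (mono_gauss n k)" by (rule integrable_mono_gauss)
    show "((\<lambda>h. mono_gauss n k (y + h *\<^sub>R v)) has_vector_derivative F' (y + h *\<^sub>R v)) (at h)" for y h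
    proof -
      \<comment> \<open>For real w the second expression is the conjugate of the first. For complex
        w both are affine, so the restriction of \<open>mono_gauss\<close> to a line extends to an
        entire function and the complex rules of differentiation apply.\<close>
      let ?z = "\<lambda>w. y + w * v" and ?c = "\<lambda>w. cnj y + w * cnj v"
      have d: "((\<lambda>w. exp (- (?z w * ?c w)) * ?z w ^ n * ?c w ^ k) has_field_derivative
         v * (of_nat n * (exp (- (?z w * ?c w)) * ?z w ^ (n - 1) * ?c w ^ k) - exp (- (?z w * ?c w)) * ?z w ^ n * ?c w ^ Suc k) +
         cnj v * (of_nat k * (exp (- (?z w * ?c w)) * ?z w ^ n * ?c w ^ (k - 1)) - exp (- (?z w * ?c w)) * ?z w ^ Suc n * ?c w ^ k)) (at w)" for w
        by (auto intro!: derivative_eq_intros simp: algebra_simps)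
      have e: "complex_of_real (exp (- (cmod z)\<^sup>2)) = exp (- (z * cnj z))" for z
        by (simp add: complex_norm_square[symmetric] exp_of_real[symmetric])
      show ?thesis
        using has_vector_derivative_real_field[OF d, of h]
        by (simp add: F'_def mono_gauss_def e scaleR_conv_of_real)
    qed
    show "norm (F' (y + h *\<^sub>R v)) \<le> K * exp (1/2) * exp (- (1/4) * (cmod y)\<^sup>2)" if "\<bar>h\<bar> < 1" for y h
    proof -
      let ?w = "y + h *\<^sub>R v"
      \<comment> \<open>A shift by less than 1 gives |y|^2 \<le> 2 |w|^2 + 2: the Gaussian rate
        drops from 1/2 to 1/4 at the cost of exp (1/2).\<close>
      have "cmod y \<le> cmod ?w + cmod (h *\<^sub>R v)" using norm_triangle_ineq4[of ?w "h *\<^sub>R v"] by simp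
      then have "cmod y \<le> cmod ?w + 1" using that v by simp
      then have "(cmod y)\<^sup>2 \<le> (cmod ?w + 1)\<^sup>2" by (rule power_mono) simp
      also have "\<dots> \<le> 2 * (cmod ?w)\<^sup>2 + 2" using zero_le_power2[of "cmod ?w - 1"] by (simp add: power2_eq_square algebra_simps)
      finally have "exp (- (1/2) * (cmod ?w)\<^sup>2) \<le> exp (1/2 + - (1/4) * (cmod y)\<^sup>2)" by simp
      then have "K * exp (- (1/2) * (cmod ?w)\<^sup>2) \<le> K * (exp (1/2) * exp (- (1/4) * (cmod y)\<^sup>2))"
        unfolding exp_add by (rule mult_left_mono[OF _ K0])
      then show ?thesis using K[of ?w] by (simp only: mult.assoc)
    qed
    show "integrable lborel (\<lambda>z::complex. K * exp (1/2) * exp (- (1/4) * (cmod z)\<^sup>2))"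
      using has_bochner_integral_complex_gaussian[of "1/4"] by (intro integrable_mult_right) (simp add: has_bochner_integral_iff)
  qed
  moreover have "(LINT z|lborel. F' z) = v * (of_nat n * integral\<^sup>L lborel (mono_gauss (n - 1) k) - integral\<^sup>L lborel (mono_gauss n (Suc k)))
       + cnj v * (of_nat k * integral\<^sup>L lborel (mono_gauss n (k - 1)) - integral\<^sup>L lborel (mono_gauss (Suc n) k))"
    unfolding F'_def by (simp add: integrable_mono_gauss)
  ultimately show ?thesis by simp
qed

lemma integral_mono_gauss: "integral\<^sup>L lborel (mono_gauss n k) = (if n = k then complex_of_real (pi * fact n) else 0)"
proof -
  let ?M = "\<lambda>n k. integral\<^sup>L lborel (mono_gauss n k)"
  have rec: "?M n (Suc k) = of_nat n * ?M (n - 1) k" "?M (Suc n) k = of_nat k * ?M n (k - 1)" for n k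
  proof -
    have "(of_nat n * ?M (n - 1) k - ?M n (Suc k)) + (of_nat k * ?M n (k - 1) - ?M (Suc n) k) = 0"
      using integral_mono_gauss_derivative[of 1 n k] by simp
    moreover have "\<i> * ((of_nat n * ?M (n - 1) k - ?M n (Suc k)) - (of_nat k * ?M n (k - 1) - ?M (Suc n) k)) = 0"
      using integral_mono_gauss_derivative[of \<i> n k] by (simp add: algebra_simps)
    then have "(of_nat n * ?M (n - 1) k - ?M n (Suc k)) - (of_nat k * ?M n (k - 1) - ?M (Suc n) k) = 0"
      by (simp only: mult_eq_0_iff complex_i_not_zero simp_thms)
    moreover have "X = 0 \<and> Y = 0" if "X + Y = 0" "X - Y = 0" for X Y :: complex
      using that by (auto simp: complex_eq_iff)
    ultimately show "?M n (Suc k) = of_nat n * ?M (n - 1) k" "?M (Suc n) k = of_nat k * ?M n (k - 1)"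
      by (metis eq_iff_diff_eq_0)+
  qed
  show ?thesis
  proof (induction n arbitrary: k)
    case 0
    show ?case
    proof (cases k)
      case 0
      have "?M 0 0 = complex_of_real (LINT z|lborel. exp (- 1 * (cmod z)\<^sup>2))"
        unfolding mono_gauss_def by (simp flip: integral_complex_of_real)
      also have "\<dots> = pi" using has_bochner_integral_complex_gaussian[of 1] by (simp add: has_bochner_integral_iff)
      finally show ?thesis using 0 by simp
    qed (simp add: rec(1))
  next
    case (Suc n)
    show ?case unfolding rec(2) using Suc[of "k - 1"] by (cases k) auto
  qed
qed

text \<open>The matrix elements of \<open>g0\<close> between the states \<open>wn 0 n\<close>, i.e. without the normalization of \<open>psi n\<close>.\<close>

definition sw :: "real \<Rightarrow> nat \<Rightarrow> nat \<Rightarrow> complex" where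
  "sw a n k = (if n = k then fact n * (complex_of_real (a\<^sup>2) + (2 * of_nat n + 1) / 4) else 0)
     + (if n = k + 2 then fact n / 4 else 0) + (if k = n + 2 then fact k / 4 else 0)"

text \<open>Re z = (z + cnj z) / 2 splits the density into monomials. On the diagonal (Re z)^2
  contributes n! (n + 1) / 2, and subtracting n! / 4 leaves n! (2 n + 1) / 4, the diagonal of -
  d^2/dx^2: this is the origin of the 1/4 in \<open>omega\<close>.\<close>

lemma has_bochner_integral_omega_moment:
  "has_bochner_integral lborel (\<lambda>z. complex_of_real (omega a z * exp (- (cmod z)\<^sup>2)) * z ^ n * cnj z ^ k) (sw a n k)"
proof -
  have om: "complex_of_real (omega a z * exp (- (cmod z)\<^sup>2)) * z ^ n * cnj z ^ k =
    complex_of_real (1 / (4 * pi)) * (mono_gauss (n + 2) k z + mono_gauss n (k + 2) z + 2 * mono_gauss (Suc n) (Suc k) z)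
      + complex_of_real ((a\<^sup>2 - 1/4) / pi) * mono_gauss n k z" for z
  proof -
    have r: "complex_of_real (Re z) = (z + cnj z) / 2" by (simp add: complex_add_cnj)
    have "complex_of_real (omega a z) = complex_of_real (1 / (4 * pi)) * (z + cnj z)\<^sup>2 + complex_of_real ((a\<^sup>2 - 1/4) / pi)"
      unfolding omega_def of_real_divide of_real_add of_real_diff of_real_power r by (simp add: field_simps power2_eq_square)
    then show ?thesis
      by (simp add: mono_gauss_def power_add power2_eq_square algebra_simps)
  qed
  have hb: "has_bochner_integral lborel (mono_gauss n k) (if n = k then complex_of_real (pi * fact n) else 0)" for n k
    using integrable_mono_gauss integral_mono_gauss by (simp add: has_bochner_integral_iff)
  have "has_bochner_integral lborel (\<lambda>z. complex_of_real (omega a z * exp (- (cmod z)\<^sup>2)) * z ^ n * cnj z ^ k)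
    (complex_of_real (1 / (4 * pi)) * ((if n + 2 = k then complex_of_real (pi * fact (n + 2)) else 0)
       + (if n = k + 2 then complex_of_real (pi * fact n) else 0) + 2 * (if Suc n = Suc k then complex_of_real (pi * fact (Suc n)) else 0))
      + complex_of_real ((a\<^sup>2 - 1/4) / pi) * (if n = k then complex_of_real (pi * fact n) else 0))"
    unfolding om by (intro has_bochner_integral_add has_bochner_integral_mult_right hb)
  also have "(complex_of_real (1 / (4 * pi)) * ((if n + 2 = k then complex_of_real (pi * fact (n + 2)) else 0)
       + (if n = k + 2 then complex_of_real (pi * fact n) else 0) + 2 * (if Suc n = Suc k then complex_of_real (pi * fact (Suc n)) else 0))
      + complex_of_real ((a\<^sup>2 - 1/4) / pi) * (if n = k then complex_of_real (pi * fact n) else 0)) = sw a n k"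
  proof -
    consider "n = k" | "n = k + 2" | "k = n + 2" | "n \<noteq> k" "n \<noteq> k + 2" "k \<noteq> n + 2" by blast
    then show ?thesis
      by cases (simp_all add: sw_def field_simps)
  qed
  finally show ?thesis .
qed

section \<open>Matrix elements of g_0 and overlaps with the generating function\<close>

lemma inner0_wn_g0: "inner0 (\<lambda>x. wn 0 n x t) (\<lambda>x. complex_of_real (a\<^sup>2) * wn 0 k x t - wn 2 k x t) = sw a n k"
proof -
  have int: "integrable lborel (\<lambda>x. cnj (wn 0 n x t) * wn 0 k x t)" for k
    by (rule edec_integrable[of 1]) (auto intro!: edec_mult edec_cnj wn_edec)
  have hb: "has_bochner_integral lborel (\<lambda>x. cnj (wn 0 n x t) * wn 0 k x t) (if n = k then fact n else 0)" for k
    using int inner0_wn by (simp add: has_bochner_integral_iff inner0_def)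
  have eq: "cnj (wn 0 n x t) * (complex_of_real (a\<^sup>2) * wn 0 k x t - wn 2 k x t) =
     (complex_of_real (a\<^sup>2) + (2 * of_nat k + 1) / 4) * (cnj (wn 0 n x t) * wn 0 k x t)
     + 1 / 4 * (cnj (wn 0 n x t) * wn 0 (k + 2) x t) + of_nat k * of_nat (k - 1) / 4 * (cnj (wn 0 n x t) * wn 0 (k - 2) x t)" for x
  proof -
    have w2: "wn 2 k x t = - (wn 0 (k + 2) x t + (2 * of_nat k + 1) * wn 0 k x t + of_nat k * of_nat (k - 1) * wn 0 (k - 2) x t) / 4"
      unfolding wn_derivative_ladder2[symmetric] by simp
    have "C * (A * w - - (p + (2 * K + 1) * w + K * l * r) / 4) = (A + (2 * K + 1) / 4) * (C * w) + 1 / 4 * (C * p) + K * l / 4 * (C * r)"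
      for A C K l p r w :: complex by (simp add: field_simps)
    then show ?thesis unfolding w2 .
  qed
  have "has_bochner_integral lborel (\<lambda>x. cnj (wn 0 n x t) * (complex_of_real (a\<^sup>2) * wn 0 k x t - wn 2 k x t))
     ((complex_of_real (a\<^sup>2) + (2 * of_nat k + 1) / 4) * (if n = k then fact n else 0)
     + 1 / 4 * (if n = k + 2 then fact n else 0) + of_nat k * of_nat (k - 1) / 4 * (if n = k - 2 then fact n else 0))"
    unfolding eq by (intro has_bochner_integral_add has_bochner_integral_mult_right hb)
  also have "((complex_of_real (a\<^sup>2) + (2 * of_nat k + 1) / 4) * (if n = k then fact n else 0)
     + 1 / 4 * (if n = k + 2 then fact n else 0) + of_nat k * of_nat (k - 1) / 4 * (if n = k - 2 then fact n else 0)) = sw a n k"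
  proof -
    \<comment> \<open>For k = 0 and k = 1 the truncated index k - 2 comes with the factor k (k - 1)
      = 0.\<close>
    consider "k = 0" | "k = 1" | m where "k = Suc (Suc m)" by (metis One_nat_def not0_implies_Suc)
    then have "of_nat k * of_nat (k - 1) / 4 * (if n = k - 2 then fact n else 0) = (if k = n + 2 then fact k / 4 else 0 :: complex)"
      by cases (auto simp: algebra_simps)
    then show ?thesis unfolding sw_def by (simp only:) simp
  qed
  finally show ?thesis by (simp add: inner0_def has_bochner_integral_iff)
qed

lemma S_eq_sw: "S a t n k = complex_of_real (1 / sqrt (fact n) * (1 / sqrt (fact k))) * sw a n k"
proof -
  have d1: "dx (\<lambda>x. psi k x t) = (\<lambda>x. wn 1 k x t / complex_of_real (sqrt (fact k)))"
    unfolding psi_eq_wn by (rule ext, rule vector_derivative_dx) (intro has_vector_derivative_divide wn_has_vector_derivative_0)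
  have d2: "dx (dx (\<lambda>x. psi k x t)) = (\<lambda>x. wn 2 k x t / complex_of_real (sqrt (fact k)))"
    unfolding d1 by (rule ext, rule vector_derivative_dx) (intro has_vector_derivative_divide wn_has_vector_derivative_1)
  have "cnj (psi n x t) * g0 a (\<lambda>x. psi k x t) x = complex_of_real (1 / sqrt (fact n) * (1 / sqrt (fact k))) *
     (cnj (wn 0 n x t) * (complex_of_real (a\<^sup>2) * wn 0 k x t - wn 2 k x t))" for x
    unfolding g0_def d2 unfolding psi_eq_wn by (simp add: field_simps)
  then show ?thesis
    unfolding S_def inner0_wn_g0[of n t a k, symmetric] by (simp add: inner0_def)
qed

text \<open>By orthogonality every partial sum with more than n terms already has the overlap z^n:
  the coefficient z^n / n! meets the squared norm n!. The weighted convergence carries this to the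
  limit.\<close>

lemma inner0_wn_gen: "inner0 (\<lambda>x. wn 0 n x t) (\<lambda>x. gend 0 z x t) = z ^ n"
proof -
  have z1: "cmod z + 1 > 0" by (rule add_nonneg_pos) auto
  obtain C where C: "C \<ge> 0" "\<And>j w x N. cmod w \<le> cmod z + 1 \<Longrightarrow>
    cmod ((\<Sum>n<N. w ^ n / fact n * wn j n x t) - gend j w x t) \<le> C / 2 ^ N * exp (- 1 * \<bar>x\<bar>)"
    using wn_partial_sum_bound[OF z1, of t 1] by blast
  obtain D where D: "D \<ge> 0" "\<And>x. cmod (wn 0 n x t) \<le> D * exp (- 1 * \<bar>x\<bar>)"
    using wn_edec[of 0 1 n t] by (rule edecE) auto
  define P where "P N x = (\<Sum>m<N. z ^ m / fact m * wn 0 m x t)" for N x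
  have int: "integrable lborel (\<lambda>x. cnj (wn 0 n x t) * wn 0 k x t)" for k
    by (rule edec_integrable[of 1]) (auto intro!: edec_mult edec_cnj wn_edec)
  have Pe: "edec 1 (P N)" for N unfolding P_def by (intro edec_sum edec_cmult wn_edec) simp
  have intP: "integrable lborel (\<lambda>x. cnj (wn 0 n x t) * P N x)" for N
    by (rule edec_integrable[of 1]) (auto intro!: edec_mult edec_cnj wn_edec Pe)
  have intG: "integrable lborel (\<lambda>x. cnj (wn 0 n x t) * gend 0 z x t)"
    by (rule edec_integrable[of 1]) (auto intro!: edec_mult edec_cnj wn_edec gend_edec)
  have PN: "inner0 (\<lambda>x. wn 0 n x t) (P N) = z ^ n" if "N > n" for N
  proof -
    have "inner0 (\<lambda>x. wn 0 n x t) (P N) = (LINT x|lborel. (\<Sum>m<N. z ^ m / fact m * (cnj (wn 0 n x t) * wn 0 m x t)))"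
      by (simp add: inner0_def P_def sum_distrib_left mult.left_commute)
    also have "\<dots> = (\<Sum>m<N. z ^ m / fact m * inner0 (\<lambda>x. wn 0 n x t) (\<lambda>x. wn 0 m x t))"
      unfolding inner0_def by (subst Bochner_Integration.integral_sum) (rule integrable_mult_right[OF int], simp only: integral_mult_right_zero)
    also have "\<dots> = (\<Sum>m<N. if n = m then z ^ m else 0)"
      unfolding inner0_wn by (intro sum.cong) auto
    also have "\<dots> = z ^ n" using that by simp
    finally show ?thesis .
  qed
  have "(\<lambda>N. inner0 (\<lambda>x. wn 0 n x t) (P N) - inner0 (\<lambda>x. wn 0 n x t) (\<lambda>x. gend 0 z x t)) \<longlonglongrightarrow> 0"
  proof (rule Lim_null_comparison)
    let ?I = "LINT x|lborel. exp (- 2 * \<bar>x\<bar>)"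
    have "norm (inner0 (\<lambda>x. wn 0 n x t) (P N) - inner0 (\<lambda>x. wn 0 n x t) (\<lambda>x. gend 0 z x t)) \<le> D * C * ?I * (1/2) ^ N" for N
    proof -
      have "inner0 (\<lambda>x. wn 0 n x t) (P N) - inner0 (\<lambda>x. wn 0 n x t) (\<lambda>x. gend 0 z x t) =
         (LINT x|lborel. cnj (wn 0 n x t) * P N x - cnj (wn 0 n x t) * gend 0 z x t)"
        unfolding inner0_def by (rule Bochner_Integration.integral_diff[OF intP intG, symmetric])
      also have "norm \<dots> \<le> (LINT x|lborel. norm (cnj (wn 0 n x t) * P N x - cnj (wn 0 n x t) * gend 0 z x t))"
        by (rule integral_norm_bound)
      also have "\<dots> \<le> (LINT x|lborel. D * C * (1/2) ^ N * exp (- 2 * \<bar>x\<bar>))"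
      proof (rule integral_mono')
        show "integrable lborel (\<lambda>x. D * C * (1/2) ^ N * exp (- 2 * \<bar>x\<bar>))"
          by (intro integrable_mult_right integrable_exp_neg_abs) simp
        show "norm (cnj (wn 0 n x t) * P N x - cnj (wn 0 n x t) * gend 0 z x t) \<le> D * C * (1/2) ^ N * exp (- 2 * \<bar>x\<bar>)" for x
        proof -
          have "norm (cnj (wn 0 n x t) * P N x - cnj (wn 0 n x t) * gend 0 z x t) = cmod (wn 0 n x t) * cmod (P N x - gend 0 z x t)"
            by (simp add: right_diff_distrib[symmetric] norm_mult)
          also have "\<dots> \<le> (D * exp (- 1 * \<bar>x\<bar>)) * (C / 2 ^ N * exp (- 1 * \<bar>x\<bar>))"
            unfolding P_def by (intro mult_mono D(2) C(2)) (use D in auto)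
          also have "exp (- 2 * \<bar>x\<bar>) = exp (- 1 * \<bar>x\<bar>) * exp (- 1 * \<bar>x\<bar>)" by (simp add: exp_add[symmetric])
          then have "(D * exp (- 1 * \<bar>x\<bar>)) * (C / 2 ^ N * exp (- 1 * \<bar>x\<bar>)) = D * C * (1/2) ^ N * exp (- 2 * \<bar>x\<bar>)"
            by (simp add: power_divide)
          finally show ?thesis .
        qed
      qed (use C(1) D(1) in simp)
      finally show ?thesis by (simp add: mult_ac)
    qed
    then show "\<forall>\<^sub>F N in sequentially. norm (inner0 (\<lambda>x. wn 0 n x t) (P N) - inner0 (\<lambda>x. wn 0 n x t) (\<lambda>x. gend 0 z x t)) \<le> D * C * ?I * (1/2) ^ N"
      by simp
    show "(\<lambda>N. D * C * ?I * (1/2) ^ N) \<longlonglongrightarrow> 0"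
      by (intro tendsto_mult_right_zero LIMSEQ_power_zero) simp
  qed
  moreover have "(\<lambda>N. inner0 (\<lambda>x. wn 0 n x t) (P N) - inner0 (\<lambda>x. wn 0 n x t) (\<lambda>x. gend 0 z x t)) \<longlonglongrightarrow> z ^ n - inner0 (\<lambda>x. wn 0 n x t) (\<lambda>x. gend 0 z x t)"
  proof (rule tendsto_diff[OF _ tendsto_const])
    have "\<forall>\<^sub>F N in sequentially. z ^ n = inner0 (\<lambda>x. wn 0 n x t) (P N)"
      using eventually_gt_at_top[of n] by eventually_elim (simp add: PN)
    then show "(\<lambda>N. inner0 (\<lambda>x. wn 0 n x t) (P N)) \<longlonglongrightarrow> z ^ n"
      by (rule Lim_transform_eventually[OF tendsto_const])
  qed
  ultimately have "z ^ n - inner0 (\<lambda>x. wn 0 n x t) (\<lambda>x. gend 0 z x t) = 0"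
    by (rule LIMSEQ_unique[symmetric])
  then show ?thesis by simp
qed

section \<open>Resolution of the identity\<close>

text \<open>Stated for a general measure, since it is applied on the line to states and on the plane
  to overlaps.\<close>

definition sqint :: "'a measure \<Rightarrow> ('a \<Rightarrow> complex) \<Rightarrow> bool" where
  "sqint M f \<longleftrightarrow> f \<in> borel_measurable M \<and> integrable M (\<lambda>x. (cmod (f x))\<^sup>2)"

lemma L2_eq_sqint: "L2 f \<longleftrightarrow> sqint lborel f"
  by (simp add: L2_def sqint_def)

lemma norm_add_square_le: "(cmod (u + v))\<^sup>2 \<le> 2 * (cmod u)\<^sup>2 + 2 * (cmod v)\<^sup>2"
proof -
  have "(cmod (u + v))\<^sup>2 \<le> (cmod u + cmod v)\<^sup>2" by (intro power_mono norm_triangle_ineq) simp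
  also have "\<dots> \<le> 2 * (cmod u)\<^sup>2 + 2 * (cmod v)\<^sup>2"
    using zero_le_power2[of "cmod u - cmod v"] by (simp add: power2_eq_square algebra_simps)
  finally show ?thesis .
qed

lemma sqint_add:
  assumes "sqint M f" "sqint M g"
  shows "sqint M (\<lambda>x. f x + g x)"
proof -
  have i: "integrable M (\<lambda>x. 2 * (cmod (f x))\<^sup>2 + 2 * (cmod (g x))\<^sup>2)"
    using assms by (simp add: sqint_def)
  have m: "(\<lambda>x. f x + g x) \<in> borel_measurable M"
    using assms unfolding sqint_def by (intro borel_measurable_add) auto
  have "integrable M (\<lambda>x. (cmod (f x + g x))\<^sup>2)"
  proof (rule Bochner_Integration.integrable_bound[OF i])
    show "(\<lambda>x. (cmod (f x + g x))\<^sup>2) \<in> borel_measurable M" using m by measurable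
    show "AE x in M. norm ((cmod (f x + g x))\<^sup>2) \<le> norm (2 * (cmod (f x))\<^sup>2 + 2 * (cmod (g x))\<^sup>2)"
      using norm_add_square_le by (intro AE_I2) (simp add: abs_of_nonneg)
  qed
  then show ?thesis using m by (simp add: sqint_def)
qed

lemma sqint_minus: "sqint M f \<Longrightarrow> sqint M (\<lambda>x. - f x)"
  by (simp add: sqint_def)

lemma sqint_diff: "sqint M f \<Longrightarrow> sqint M g \<Longrightarrow> sqint M (\<lambda>x. f x - g x)"
  using sqint_add[of M f "\<lambda>x. - g x"] sqint_minus[of M g] by simp

lemma sqint_mult_integrable:
  assumes "sqint M f" "sqint M g" "m \<in> borel_measurable M" "\<And>x. cmod (m x) \<le> C"
  shows "integrable M (\<lambda>x. m x * (cnj (f x) * g x))"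
proof -
  have i: "integrable M (\<lambda>x. C * ((cmod (f x))\<^sup>2 + (cmod (g x))\<^sup>2))"
    using assms by (simp add: sqint_def)
  show ?thesis
  proof (rule Bochner_Integration.integrable_bound[OF i])
    have fg: "f \<in> borel_measurable M" "g \<in> borel_measurable M" using assms by (auto simp: sqint_def)
    have "(\<lambda>x. cnj (f x)) \<in> borel_measurable M"
      by (rule borel_measurable_continuous_on[OF continuous_on_cnj[OF continuous_on_id] fg(1)])
    then show "(\<lambda>x. m x * (cnj (f x) * g x)) \<in> borel_measurable M"
      using fg(2) assms(3) by (intro borel_measurable_times)
    show "AE x in M. norm (m x * (cnj (f x) * g x)) \<le> norm (C * ((cmod (f x))\<^sup>2 + (cmod (g x))\<^sup>2))"
    proof (rule AE_I2)
      fix x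
      have C: "0 \<le> C" using assms(4)[of x] by (rule order_trans[OF norm_ge_zero])
      have "cmod (f x) * cmod (g x) \<le> (cmod (f x))\<^sup>2 + (cmod (g x))\<^sup>2"
        using zero_le_power2[of "cmod (f x) - cmod (g x)"] zero_le_power2[of "cmod (f x)"] zero_le_power2[of "cmod (g x)"]
        unfolding power2_diff by linarith
      then have "cmod (m x) * (cmod (f x) * cmod (g x)) \<le> C * ((cmod (f x))\<^sup>2 + (cmod (g x))\<^sup>2)"
        using C by (intro mult_mono assms(4)) auto
      then show "norm (m x * (cnj (f x) * g x)) \<le> norm (C * ((cmod (f x))\<^sup>2 + (cmod (g x))\<^sup>2))"
        using C by (simp add: norm_mult)
    qed
  qed
qed

text \<open>Joint continuity of a sesquilinear form with a bounded multiplier: 1 on the line, the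
  quotient of two densities on the plane. The mixed terms are estimated by u v \<le> u^2 / s + s
  v^2, with s the square root of the error.\<close>

lemma tendsto_integral_sqint:
  assumes F: "sqint M F" "\<And>k. sqint M (Fs k)" "(\<lambda>k. LINT x|M. (cmod (Fs k x - F x))\<^sup>2) \<longlonglongrightarrow> 0"
    and G: "sqint M G" "\<And>k. sqint M (Gs k)" "(\<lambda>k. LINT x|M. (cmod (Gs k x - G x))\<^sup>2) \<longlonglongrightarrow> 0"
    and m: "m \<in> borel_measurable M" "\<And>x. cmod (m x) \<le> C"
  shows "(\<lambda>k. LINT x|M. m x * (cnj (Fs k x) * Gs k x)) \<longlonglongrightarrow> (LINT x|M. m x * (cnj (F x) * G x))"
proof -
  let ?A = "\<lambda>k. LINT x|M. (cmod (Fs k x - F x))\<^sup>2" and ?B = "\<lambda>k. LINT x|M. (cmod (Gs k x - G x))\<^sup>2"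
  let ?f = "LINT x|M. (cmod (F x))\<^sup>2" and ?g = "LINT x|M. (cmod (G x))\<^sup>2"
  have C: "0 \<le> \<bar>C\<bar>" by simp
  \<comment> \<open>The summand 1 / (k + 1) keeps the error positive, so that one may divide by its
    square root.\<close>
  define e where "e k = ?A k + ?B k + 1 / Suc k" for k
  have e: "e k > 0" for k unfolding e_def by (intro add_nonneg_pos add_nonneg_nonneg Bochner_Integration.integral_nonneg) auto
  have elim: "e \<longlonglongrightarrow> 0"
    unfolding e_def using tendsto_add[OF tendsto_add[OF F(3) G(3)] LIMSEQ_Suc[OF lim_1_over_n]] by simp
  have bound: "norm ((LINT x|M. m x * (cnj (Fs k x) * Gs k x)) - (LINT x|M. m x * (cnj (F x) * G x)))
      \<le> \<bar>C\<bar> * (e k + sqrt (e k) + (?f + ?g) * sqrt (e k))" for k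
  proof -
    define s where "s = sqrt (e k)"
    have s: "s > 0" "s * s = e k" using e[of k] by (auto simp: s_def)
    have i: "integrable M (\<lambda>x. (cmod (Fs k x - F x))\<^sup>2)" "integrable M (\<lambda>x. (cmod (Gs k x - G x))\<^sup>2)"
      "integrable M (\<lambda>x. (cmod (F x))\<^sup>2)" "integrable M (\<lambda>x. (cmod (G x))\<^sup>2)"
      using sqint_diff[OF F(2) F(1)] sqint_diff[OF G(2) G(1)] F(1) G(1) by (auto simp: sqint_def)
    let ?h = "\<lambda>x. \<bar>C\<bar> * ((1 + 1 / s) * (cmod (Fs k x - F x))\<^sup>2 + (1 + 1 / s) * (cmod (Gs k x - G x))\<^sup>2 + s * (cmod (F x))\<^sup>2 + s * (cmod (G x))\<^sup>2)"
    have ih: "integrable M ?h" using i by simp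
    have "(LINT x|M. m x * (cnj (Fs k x) * Gs k x)) - (LINT x|M. m x * (cnj (F x) * G x)) =
       (LINT x|M. m x * (cnj (Fs k x) * Gs k x) - m x * (cnj (F x) * G x))"
      by (rule Bochner_Integration.integral_diff[symmetric])
         (rule sqint_mult_integrable[OF F(2) G(2) m] sqint_mult_integrable[OF F(1) G(1) m])+
    also have "norm \<dots> \<le> (LINT x|M. norm (m x * (cnj (Fs k x) * Gs k x) - m x * (cnj (F x) * G x)))"
      by (rule integral_norm_bound)
    also have "\<dots> \<le> (LINT x|M. ?h x)"
    proof (rule integral_mono'[OF ih])
      fix x
      let ?a = "cmod (Fs k x - F x)" and ?b = "cmod (Gs k x - G x)"
      have amgm: "u * v \<le> u\<^sup>2 / s + s * v\<^sup>2" "u * v \<le> u\<^sup>2 + v\<^sup>2" if "u \<ge> 0" "v \<ge> 0" for u v :: real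
      proof -
        have "0 \<le> (u - s * v)\<^sup>2 / s" using s by simp
        also have "\<dots> = u\<^sup>2 / s + s * v\<^sup>2 - 2 * (u * v)" using s by (simp add: power2_eq_square field_simps)
        finally show "u * v \<le> u\<^sup>2 / s + s * v\<^sup>2" using mult_nonneg_nonneg[OF that] by linarith
        show "u * v \<le> u\<^sup>2 + v\<^sup>2"
          using zero_le_power2[of "u - v"] zero_le_power2[of u] zero_le_power2[of v] unfolding power2_diff by linarith
      qed
      have "m x * (cnj (Fs k x) * Gs k x) - m x * (cnj (F x) * G x) =
        m x * (cnj (Fs k x - F x) * (Gs k x - G x) + cnj (Fs k x - F x) * G x + cnj (F x) * (Gs k x - G x))"
        by (simp add: algebra_simps)
      then have "norm (m x * (cnj (Fs k x) * Gs k x) - m x * (cnj (F x) * G x)) =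
         cmod (m x) * cmod (cnj (Fs k x - F x) * (Gs k x - G x) + cnj (Fs k x - F x) * G x + cnj (F x) * (Gs k x - G x))"
        by (simp only: norm_mult)
      also have "\<dots> \<le> \<bar>C\<bar> * (?a * ?b + ?a * cmod (G x) + cmod (F x) * ?b)"
      proof (rule mult_mono)
        show "cmod (m x) \<le> \<bar>C\<bar>" using m(2)[of x] by linarith
        show "cmod (cnj (Fs k x - F x) * (Gs k x - G x) + cnj (Fs k x - F x) * G x + cnj (F x) * (Gs k x - G x)) \<le> ?a * ?b + ?a * cmod (G x) + cmod (F x) * ?b"
          using norm_triangle_ineq[of "cnj (Fs k x - F x) * (Gs k x - G x) + cnj (Fs k x - F x) * G x" "cnj (F x) * (Gs k x - G x)"]
            norm_triangle_ineq[of "cnj (Fs k x - F x) * (Gs k x - G x)" "cnj (Fs k x - F x) * G x"]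
          unfolding norm_mult complex_mod_cnj by linarith
      qed auto
      also have "\<dots> \<le> ?h x"
      proof (rule mult_left_mono[OF _ C])
        have "?a * ?b \<le> ?a\<^sup>2 + ?b\<^sup>2" "?a * cmod (G x) \<le> ?a\<^sup>2 / s + s * (cmod (G x))\<^sup>2" "?b * cmod (F x) \<le> ?b\<^sup>2 / s + s * (cmod (F x))\<^sup>2"
          by (rule amgm; simp)+
        then show "?a * ?b + ?a * cmod (G x) + cmod (F x) * ?b \<le> (1 + 1 / s) * ?a\<^sup>2 + (1 + 1 / s) * ?b\<^sup>2 + s * (cmod (F x))\<^sup>2 + s * (cmod (G x))\<^sup>2"
          by (simp add: distrib_right mult.commute[of "cmod (F x)"])
      qed
      finally show "norm (m x * (cnj (Fs k x) * Gs k x) - m x * (cnj (F x) * G x)) \<le> ?h x" .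
    qed (use s C in \<open>auto intro!: mult_nonneg_nonneg add_nonneg_nonneg\<close>)
    also have "\<dots> = \<bar>C\<bar> * ((1 + 1 / s) * ?A k + (1 + 1 / s) * ?B k + s * ?f + s * ?g)"
      using i by simp
    also have "\<dots> \<le> \<bar>C\<bar> * (e k + sqrt (e k) + (?f + ?g) * sqrt (e k))"
    proof (rule mult_left_mono[OF _ C])
      have AB: "?A k + ?B k \<le> e k" by (simp add: e_def)
      then have "(?A k + ?B k) / s \<le> e k / s" using s by (intro divide_right_mono) auto
      also have "\<dots> = s" unfolding s(2)[symmetric] using s(1) by simp
      finally have "(?A k + ?B k) / s \<le> s" .
      with AB show "(1 + 1 / s) * ?A k + (1 + 1 / s) * ?B k + s * ?f + s * ?g \<le> e k + sqrt (e k) + (?f + ?g) * sqrt (e k)"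
        unfolding s_def[symmetric] by (simp add: algebra_simps add_divide_distrib)
    qed
    finally show ?thesis .
  qed
  have "(\<lambda>k. \<bar>C\<bar> * (e k + sqrt (e k) + (?f + ?g) * sqrt (e k))) \<longlonglongrightarrow> \<bar>C\<bar> * (0 + sqrt 0 + (?f + ?g) * sqrt 0)"
    by (intro tendsto_intros elim)
  then have lim: "(\<lambda>k. \<bar>C\<bar> * (e k + sqrt (e k) + (?f + ?g) * sqrt (e k))) \<longlonglongrightarrow> 0"
    by simp
  have "(\<lambda>k. (LINT x|M. m x * (cnj (Fs k x) * Gs k x)) - (LINT x|M. m x * (cnj (F x) * G x))) \<longlonglongrightarrow> 0"
    by (rule Lim_null_comparison[OF always_eventually[OF allI[OF bound]] lim])
  then show ?thesis by (simp only: LIM_zero_iff)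
qed

text \<open>Fatou's lemma sends l to infinity in an L^2 Cauchy estimate and so identifies the
  pointwise limit with the L^2 limit.\<close>

lemma Fatou_square:
  assumes m: "\<And>l. Fs l \<in> borel_measurable M" "G \<in> borel_measurable M"
    and lim: "\<And>x. (\<lambda>l. Fs l x) \<longlonglongrightarrow> F x"
    and int: "\<And>l. integrable M (\<lambda>x. (cmod (G x - Fs l x))\<^sup>2)"
    and bd: "\<And>l. (LINT x|M. (cmod (G x - Fs l x))\<^sup>2) \<le> c l" and c: "c \<longlonglongrightarrow> (d::real)"
  shows "integrable M (\<lambda>x. (cmod (G x - F x))\<^sup>2)" "(LINT x|M. (cmod (G x - F x))\<^sup>2) \<le> d"
proof -
  have "0 \<le> c l" for l
    by (rule order_trans[OF Bochner_Integration.integral_nonneg bd]) simp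
  then have d0: "0 \<le> d"
    by (intro LIMSEQ_le_const[OF c] exI allI impI)
  have mF: "F \<in> borel_measurable M" by (rule borel_measurable_LIMSEQ_metric[OF m(1) lim])
  note m[measurable] mF[measurable]
  have "(\<integral>\<^sup>+x. ennreal ((cmod (G x - F x))\<^sup>2) \<partial>M) = (\<integral>\<^sup>+x. liminf (\<lambda>l. ennreal ((cmod (G x - Fs l x))\<^sup>2)) \<partial>M)"
  proof (rule nn_integral_cong)
    fix x
    have "(\<lambda>l. ennreal ((cmod (G x - Fs l x))\<^sup>2)) \<longlonglongrightarrow> ennreal ((cmod (G x - F x))\<^sup>2)"
      by (intro tendsto_ennrealI tendsto_intros lim)
    then show "ennreal ((cmod (G x - F x))\<^sup>2) = liminf (\<lambda>l. ennreal ((cmod (G x - Fs l x))\<^sup>2))"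
      by (rule lim_imp_Liminf[OF sequentially_bot, symmetric])
  qed
  also have "\<dots> \<le> liminf (\<lambda>l. \<integral>\<^sup>+x. ennreal ((cmod (G x - Fs l x))\<^sup>2) \<partial>M)"
    by (rule nn_integral_liminf) measurable
  also have "\<dots> \<le> liminf (\<lambda>l. ennreal (c l))"
  proof (rule Liminf_mono[OF always_eventually], rule allI)
    fix l
    have "(\<integral>\<^sup>+x. ennreal ((cmod (G x - Fs l x))\<^sup>2) \<partial>M) = ennreal (LINT x|M. (cmod (G x - Fs l x))\<^sup>2)"
      by (rule nn_integral_eq_integral[OF int]) simp
    then show "(\<integral>\<^sup>+x. ennreal ((cmod (G x - Fs l x))\<^sup>2) \<partial>M) \<le> ennreal (c l)"
      using bd[of l] by (simp add: ennreal_leI)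
  qed
  also have "\<dots> = ennreal d"
    by (rule lim_imp_Liminf[OF sequentially_bot tendsto_ennrealI[OF c]])
  finally have le: "(\<integral>\<^sup>+x. ennreal ((cmod (G x - F x))\<^sup>2) \<partial>M) \<le> ennreal d" .
  show i: "integrable M (\<lambda>x. (cmod (G x - F x))\<^sup>2)"
  proof (rule integrableI_bounded)
    show "(\<integral>\<^sup>+x. ennreal (norm ((cmod (G x - F x))\<^sup>2)) \<partial>M) < \<infinity>"
      using le by (simp add: order_le_less_trans[OF _ ennreal_less_top])
  qed measurable
  have "(\<integral>\<^sup>+x. ennreal ((cmod (G x - F x))\<^sup>2) \<partial>M) = ennreal (LINT x|M. (cmod (G x - F x))\<^sup>2)"
    by (rule nn_integral_eq_integral[OF i]) simp
  then show "(LINT x|M. (cmod (G x - F x))\<^sup>2) \<le> d" using le d0 by simp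
qed

section \<open>Inner products on \<open>L1\<close> and overlaps with the states eta\<close>

lemma Lop_lcomb_edec: "edec b (Lop a (lcomb 0 N d t))"
  unfolding Lop_lcomb by (intro edec_diff edec_a_tanh lcomb_edec) auto

text \<open>Integration by parts moves L across as L^+, and L^+ L = g_0: the L^2 product on
  \<open>L1\<close> is the prescribed one. The identity holds for every real \<open>a\<close>,
  including 0, where L is d/dx.\<close>

lemma inner1_Lop_lcomb:
  "inner1 (Lop a (lcomb 0 N d t)) (Lop a (lcomb 0 M e t)) = (\<Sum>n<N. \<Sum>k<M. cnj (d n) * e k * sw a n k)"
proof -
  let ?u = "\<lambda>j. lcomb j N d t" and ?v = "\<lambda>j. lcomb j M e t"
  let ?T = "\<lambda>x. complex_of_real (a * tanh (a * x))"
  define Lv' where "Lv' x = ?v 2 x - (?T x * ?v 1 x + complex_of_real (a\<^sup>2 * (1 - (tanh (a * x))\<^sup>2)) * ?v 0 x)" for x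
  have dL: "(Lop a (?v 0) has_vector_derivative Lv' x) (at x)" for x
    unfolding Lop_lcomb Lv'_def
    by (intro has_vector_derivative_diff has_vector_derivative_mult tanh_has_vector_derivative lcomb_has_vector_derivative)
  have eLv': "edec 1 Lv'"
  proof -
    have "edec 1 (\<lambda>x. complex_of_real (a\<^sup>2) * ?v 0 x - ?T x * (?T x * ?v 0 x))"
      by (intro edec_diff edec_cmult edec_a_tanh lcomb_edec) auto
    then have "edec 1 (\<lambda>x. complex_of_real (a\<^sup>2 * (1 - (tanh (a * x))\<^sup>2)) * ?v 0 x)"
      by (simp add: algebra_simps power2_eq_square)
    then show ?thesis unfolding Lv'_def by (intro edec_diff edec_add edec_a_tanh lcomb_edec) auto
  qed
  have "(LINT x|lborel. cnj (?u 0 x) * Lv' x + cnj (?u 1 x) * Lop a (?v 0) x) = 0"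
  proof (rule edec_integral_derivative[of 1 "\<lambda>x. cnj (?u 0 x) * Lop a (?v 0) x"])
    show "edec 1 (\<lambda>x. cnj (?u 0 x) * Lop a (?v 0) x)"
      by (intro edec_mult edec_cnj lcomb_edec Lop_lcomb_edec) simp_all
    show "edec 1 (\<lambda>x. cnj (?u 0 x) * Lv' x + cnj (?u 1 x) * Lop a (?v 0) x)"
      by (intro edec_mult edec_add edec_cnj lcomb_edec Lop_lcomb_edec eLv') simp_all
    show "((\<lambda>x. cnj (?u 0 x) * Lop a (?v 0) x) has_vector_derivative cnj (?u 0 x) * Lv' x + cnj (?u 1 x) * Lop a (?v 0) x) (at x)" for x
      by (intro has_vector_derivative_mult has_vector_derivative_cnj lcomb_has_vector_derivative dL)
  qed simp
  moreover have "cnj (Lop a (?u 0) x) * Lop a (?v 0) x = (cnj (?u 0 x) * Lv' x + cnj (?u 1 x) * Lop a (?v 0) x)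
      + cnj (?u 0 x) * (complex_of_real (a\<^sup>2) * ?v 0 x - ?v 2 x)" for x
    unfolding Lop_lcomb Lv'_def by (simp add: algebra_simps power2_eq_square)
  moreover have "integrable lborel (\<lambda>x. cnj (?u 0 x) * Lv' x + cnj (?u 1 x) * Lop a (?v 0) x)"
    by (rule edec_integrable[of 1]) (auto intro!: edec_mult edec_add edec_cnj lcomb_edec Lop_lcomb_edec eLv')
  moreover have "integrable lborel (\<lambda>x. cnj (?u 0 x) * (complex_of_real (a\<^sup>2) * ?v 0 x - ?v 2 x))"
    by (rule edec_integrable[of 1]) (auto intro!: edec_mult edec_diff edec_cmult edec_cnj lcomb_edec)
  ultimately have 1: "inner1 (Lop a (?u 0)) (Lop a (?v 0)) = (LINT x|lborel. cnj (?u 0 x) * (complex_of_real (a\<^sup>2) * ?v 0 x - ?v 2 x))"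
    unfolding inner1_def by simp
  let ?h = "\<lambda>n k x. cnj (wn 0 n x t) * (complex_of_real (a\<^sup>2) * wn 0 k x t - wn 2 k x t)"
  have hb: "has_bochner_integral lborel (?h n k) (sw a n k)" for n k
  proof -
    have "integrable lborel (?h n k)"
      by (rule edec_integrable[of 1]) (auto intro!: edec_mult edec_diff edec_cmult edec_cnj wn_edec)
    then show ?thesis
      using inner0_wn_g0[of n t a k] by (simp add: has_bochner_integral_iff inner0_def)
  qed
  have eq: "cnj (?u 0 x) * (complex_of_real (a\<^sup>2) * ?v 0 x - ?v 2 x) = (\<Sum>n<N. \<Sum>k<M. (cnj (d n) * e k) * ?h n k x)" for x
  proof -
    have "complex_of_real (a\<^sup>2) * ?v 0 x - ?v 2 x = (\<Sum>k<M. e k * (complex_of_real (a\<^sup>2) * wn 0 k x t - wn 2 k x t))"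
      unfolding lcomb_def sum_distrib_left sum_subtractf[symmetric]
      by (intro sum.cong refl) (simp add: algebra_simps)
    moreover have "cnj (?u 0 x) = (\<Sum>n<N. cnj (d n) * cnj (wn 0 n x t))" by (simp add: lcomb_def)
    ultimately show ?thesis by (simp only: sum_product) (intro sum.cong refl, simp only: mult_ac)
  qed
  have "has_bochner_integral lborel (\<lambda>x. \<Sum>n<N. \<Sum>k<M. (cnj (d n) * e k) * ?h n k x) (\<Sum>n<N. \<Sum>k<M. cnj (d n) * e k * sw a n k)"
    by (intro has_bochner_integral_sum has_bochner_integral_mult_right hb)
  then show ?thesis unfolding 1 eq by (rule has_bochner_integral_integral_eq)
qed

lemma inner1_cnj: "inner1 f g = cnj (inner1 g f)"
  using Bochner_Integration.integral_cnj[of lborel "\<lambda>x. cnj (g x) * f x"]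
  by (simp add: inner1_def mult.commute del: Bochner_Integration.integral_cnj)

lemma inner1_self: "inner1 f f = complex_of_real (LINT x|lborel. (cmod (f x))\<^sup>2)"
  unfolding inner1_def complex_norm_square mult.commute[of "cnj _"] integral_complex_of_real[symmetric] ..

text \<open>eta_z enters the integration by parts only through its first-order equation. The overlap
  is a polynomial in z times a Gaussian, and \<open>a\<close> has disappeared from it.\<close>

lemma lcomb_overlap:
  assumes a: "a > 0"
  shows "inner1 (Lop a (lcomb 0 N d t)) (\<lambda>x. eta a z x t) =
    complex_of_real (exp (- (cmod z)\<^sup>2 / 2)) * (\<Sum>n<N. cnj (d n) * z ^ n)"
proof -
  let ?u = "\<lambda>j. lcomb j N d t"
  let ?T = "\<lambda>x. complex_of_real (a * tanh (a * x))"
  define e' where "e' x = - ?T x * eta a z x t - coh 0 z x t" for x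
  have a2: "a/2 > 0" "a/2 \<ge> 0" using a by auto
  have ee': "edec (a/2) e'"
  proof -
    have "edec (a/2) (\<lambda>x. (-1) * (?T x * eta a z x t) - coh 0 z x t)"
      by (intro edec_diff edec_cmult edec_a_tanh eta_edec[OF a] coh_edec) simp
    then show ?thesis by (simp add: e'_def[abs_def])
  qed
  have "(LINT x|lborel. cnj (?u 0 x) * e' x + cnj (?u 1 x) * eta a z x t) = 0"
  proof (rule edec_integral_derivative[of "a/2" "\<lambda>x. cnj (?u 0 x) * eta a z x t"])
    show "edec (a/2) (\<lambda>x. cnj (?u 0 x) * eta a z x t)"
      by (intro edec_mult edec_cnj lcomb_edec eta_edec[OF a]) (use a in simp_all)
    show "edec (a/2) (\<lambda>x. cnj (?u 0 x) * e' x + cnj (?u 1 x) * eta a z x t)"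
      by (intro edec_mult edec_add edec_cnj lcomb_edec ee' eta_edec[OF a]) (use a in simp_all)
    show "((\<lambda>x. cnj (?u 0 x) * eta a z x t) has_vector_derivative cnj (?u 0 x) * e' x + cnj (?u 1 x) * eta a z x t) (at x)" for x
      unfolding e'_def
      by (intro has_vector_derivative_mult has_vector_derivative_cnj lcomb_has_vector_derivative eta_has_vector_derivative[OF a])
  qed (rule a2)
  moreover have "cnj (Lop a (?u 0) x) * eta a z x t = (cnj (?u 0 x) * e' x + cnj (?u 1 x) * eta a z x t) + cnj (?u 0 x) * coh 0 z x t" for x
    unfolding Lop_lcomb e'_def by (simp add: algebra_simps)
  moreover have "integrable lborel (\<lambda>x. cnj (?u 0 x) * e' x + cnj (?u 1 x) * eta a z x t)"
    by (rule edec_integrable[of "a/2"]) (use a2 in \<open>auto intro!: edec_mult edec_add edec_cnj lcomb_edec ee' eta_edec[OF a]\<close>)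
  moreover have "integrable lborel (\<lambda>x. cnj (?u 0 x) * coh 0 z x t)"
    by (rule edec_integrable[of 1]) (auto intro!: edec_mult edec_cnj lcomb_edec coh_edec)
  ultimately have 1: "inner1 (Lop a (?u 0)) (\<lambda>x. eta a z x t) = (LINT x|lborel. cnj (?u 0 x) * coh 0 z x t)"
    unfolding inner1_def by simp
  let ?k = "complex_of_real (exp (- (cmod z)\<^sup>2 / 2))"
  have hb: "has_bochner_integral lborel (\<lambda>x. cnj (wn 0 n x t) * gend 0 z x t) (z ^ n)" for n
  proof -
    have "integrable lborel (\<lambda>x. cnj (wn 0 n x t) * gend 0 z x t)"
      by (rule edec_integrable[of 1]) (auto intro!: edec_mult edec_cnj wn_edec gend_edec)
    then show ?thesis using inner0_wn_gen[of n t z] by (simp add: has_bochner_integral_iff inner0_def)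
  qed
  have eq: "cnj (?u 0 x) * coh 0 z x t = (\<Sum>n<N. (?k * cnj (d n)) * (cnj (wn 0 n x t) * gend 0 z x t))" for x
    unfolding coh_def lcomb_def cnj_sum complex_cnj_mult sum_distrib_right
    by (intro sum.cong refl) (simp only: mult_ac)
  have "has_bochner_integral lborel (\<lambda>x. \<Sum>n<N. (?k * cnj (d n)) * (cnj (wn 0 n x t) * gend 0 z x t)) (\<Sum>n<N. (?k * cnj (d n)) * z ^ n)"
    by (intro has_bochner_integral_sum has_bochner_integral_mult_right hb)
  then show ?thesis unfolding 1 eq sum_distrib_left mult.assoc by (rule has_bochner_integral_integral_eq)
qed

text \<open>The parameter \<open>b\<close> of the density may differ from the \<open>a\<close> of
  the states because the overlaps do not involve \<open>a\<close>. Taking b = a gives the resolution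
  on \<open>L1\<close>, and b = sqrt (a^2 + 1/4) the positive density used for estimates.\<close>

lemma overlap_resolution:
  assumes a: "a > 0"
  shows "has_bochner_integral lborel (\<lambda>z. complex_of_real (omega b z)
      * inner1 (Lop a (lcomb 0 N d t)) (\<lambda>x. eta a z x t) * inner1 (\<lambda>x. eta a z x t) (Lop a (lcomb 0 M e t)))
    (\<Sum>n<N. \<Sum>k<M. cnj (d n) * e k * sw b n k)"
proof -
  have eq: "complex_of_real (omega b z) * inner1 (Lop a (lcomb 0 N d t)) (\<lambda>x. eta a z x t) * inner1 (\<lambda>x. eta a z x t) (Lop a (lcomb 0 M e t)) =
    (\<Sum>n<N. \<Sum>k<M. (cnj (d n) * e k) * (complex_of_real (omega b z * exp (- (cmod z)\<^sup>2)) * z ^ n * cnj z ^ k))" for z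
  proof -
    let ?k = "complex_of_real (exp (- (cmod z)\<^sup>2 / 2))"
    have kk: "?k * ?k = complex_of_real (exp (- (cmod z)\<^sup>2))"
      by (simp add: exp_add[symmetric] flip: of_real_mult)
    have "inner1 (\<lambda>x. eta a z x t) (Lop a (lcomb 0 M e t)) = ?k * (\<Sum>k<M. e k * cnj z ^ k)"
      by (subst inner1_cnj) (simp add: lcomb_overlap[OF a])
    then have "complex_of_real (omega b z) * inner1 (Lop a (lcomb 0 N d t)) (\<lambda>x. eta a z x t) * inner1 (\<lambda>x. eta a z x t) (Lop a (lcomb 0 M e t)) =
      complex_of_real (omega b z) * (?k * ?k) * ((\<Sum>n<N. cnj (d n) * z ^ n) * (\<Sum>k<M. e k * cnj z ^ k))"
      by (simp add: lcomb_overlap[OF a])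
    also have "\<dots> = (\<Sum>n<N. \<Sum>k<M. (cnj (d n) * e k) * (complex_of_real (omega b z * exp (- (cmod z)\<^sup>2)) * z ^ n * cnj z ^ k))"
      unfolding kk sum_product unfolding sum_distrib_left by (intro sum.cong refl) (simp only: of_real_mult mult_ac)
    finally show ?thesis .
  qed
  show ?thesis
    unfolding eq
    by (intro has_bochner_integral_sum has_bochner_integral_mult_right has_bochner_integral_omega_moment)
qed

lemma omega_shift: "omega (sqrt (a\<^sup>2 + 1/4)) z = ((Re z)\<^sup>2 + a\<^sup>2) / pi"
  by (simp add: omega_def add_nonneg_nonneg)

text \<open>With \<open>b\<^sup>2 = a\<^sup>2 + 1/4\<close> the density \<open>omega b\<close> is positive, while \<open>omega a\<close> may change sign for \<open>a < 1/2\<close>.\<close>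

lemma overlap_bound:
  assumes a: "a > 0" and f: "f \<in> L1 a t"
  shows "has_bochner_integral lborel (\<lambda>z. omega (sqrt (a\<^sup>2 + 1/4)) z * (cmod (inner1 f (\<lambda>x. eta a z x t)))\<^sup>2)
      (LINT z|lborel. omega (sqrt (a\<^sup>2 + 1/4)) z * (cmod (inner1 f (\<lambda>x. eta a z x t)))\<^sup>2)"
    "(LINT z|lborel. omega (sqrt (a\<^sup>2 + 1/4)) z * (cmod (inner1 f (\<lambda>x. eta a z x t)))\<^sup>2)
      \<le> (1 + 1 / (4 * a\<^sup>2)) * (LINT x|lborel. (cmod (f x))\<^sup>2)"
proof -
  let ?b = "sqrt (a\<^sup>2 + 1/4)"
  obtain N d where f: "f = Lop a (lcomb 0 N d t)" using f unfolding L1_eq_Lop_lcomb by blast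
  \<comment> \<open>For the function u with coefficients \<open>d\<close>, \<open>Q c\<close> is the
    form <u|g_0|u> with \<open>c\<close> in place of a. It depends on \<open>c\<close> only through
    c^2 W, where W is the squared norm of u.\<close>
  define Q where "Q c = (\<Sum>n<N. \<Sum>k<N. cnj (d n) * d k * sw c n k)" for c
  define W where "W = (\<Sum>n<N. (cmod (d n))\<^sup>2 * fact n)"
  have W: "W \<ge> 0" unfolding W_def by (intro sum_nonneg) simp
  have sw: "sw c n k = sw 0 n k + (if n = k then fact n * complex_of_real (c\<^sup>2) else 0)" for c n k
    by (simp add: sw_def distrib_left)
  have Q: "Q c = Q 0 + complex_of_real (c\<^sup>2 * W)" for c
  proof -
    have "Q c = (\<Sum>n<N. \<Sum>k<N. cnj (d n) * d k * sw 0 n k + (if n = k then cnj (d n) * d k * (fact n * complex_of_real (c\<^sup>2)) else 0))"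
      unfolding Q_def by (subst sw) (intro sum.cong refl, simp add: distrib_left)
    also have "\<dots> = Q 0 + (\<Sum>n<N. cnj (d n) * d n * (fact n * complex_of_real (c\<^sup>2)))"
      unfolding Q_def by (simp add: sum.distrib)
    also have "(\<Sum>n<N. cnj (d n) * d n * (fact n * complex_of_real (c\<^sup>2))) = complex_of_real (c\<^sup>2 * W)"
      unfolding W_def of_real_mult of_real_sum sum_distrib_left complex_norm_square of_real_fact by (intro sum.cong refl) (simp add: mult_ac)
    finally show ?thesis .
  qed
  \<comment> \<open>With parameter 0 the operator L is d/dx, so \<open>Q 0\<close> is the squared
    norm of u' and in particular nonnegative.\<close>
  define q where "q = (LINT x|lborel. (cmod (Lop 0 (lcomb 0 N d t) x))\<^sup>2)"
  have q: "q \<ge> 0" "Q 0 = complex_of_real q"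
    unfolding q_def Q_def inner1_Lop_lcomb[of 0 N d t N d, symmetric] inner1_self
    by (auto intro!: Bochner_Integration.integral_nonneg)
  have nf: "(LINT x|lborel. (cmod (f x))\<^sup>2) = q + a\<^sup>2 * W"
  proof -
    have "complex_of_real (LINT x|lborel. (cmod (f x))\<^sup>2) = Q a"
      unfolding f inner1_self[symmetric] Q_def by (rule inner1_Lop_lcomb)
    also have "\<dots> = complex_of_real (q + a\<^sup>2 * W)" unfolding Q[of a] q(2) by simp
    finally show ?thesis by (simp only: of_real_eq_iff)
  qed
  have "(\<lambda>z. complex_of_real (omega ?b z) * inner1 f (\<lambda>x. eta a z x t) * inner1 (\<lambda>x. eta a z x t) f) =
      (\<lambda>z. complex_of_real (omega ?b z * (cmod (inner1 f (\<lambda>x. eta a z x t)))\<^sup>2))"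
  proof
    fix z
    show "complex_of_real (omega ?b z) * inner1 f (\<lambda>x. eta a z x t) * inner1 (\<lambda>x. eta a z x t) f =
      complex_of_real (omega ?b z * (cmod (inner1 f (\<lambda>x. eta a z x t)))\<^sup>2)"
      by (subst inner1_cnj[of "\<lambda>x. eta a z x t" f]) (simp add: complex_norm_square mult.assoc del: of_real_power)
  qed
  then have "has_bochner_integral lborel (\<lambda>z. complex_of_real (omega ?b z * (cmod (inner1 f (\<lambda>x. eta a z x t)))\<^sup>2)) (Q ?b)"
    using overlap_resolution[OF a, of ?b N d t N d] unfolding f Q_def by simp
  then have "has_bochner_integral lborel (\<lambda>z. Re (complex_of_real (omega ?b z * (cmod (inner1 f (\<lambda>x. eta a z x t)))\<^sup>2))) (Re (Q ?b))"
    by (rule has_bochner_integral_bounded_linear[OF bounded_linear_Re])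
  then have hb: "has_bochner_integral lborel (\<lambda>z. omega ?b z * (cmod (inner1 f (\<lambda>x. eta a z x t)))\<^sup>2) (q + (a\<^sup>2 + 1/4) * W)"
    unfolding Q[of ?b] q(2) Re_complex_of_real plus_complex.sel by (simp add: add_nonneg_nonneg)
  then show "has_bochner_integral lborel (\<lambda>z. omega ?b z * (cmod (inner1 f (\<lambda>x. eta a z x t)))\<^sup>2)
      (LINT z|lborel. omega ?b z * (cmod (inner1 f (\<lambda>x. eta a z x t)))\<^sup>2)"
    by (simp add: has_bochner_integral_iff)
  \<comment> \<open>The squared norm of f is q + a^2 W, so the surplus W / 4 is at most this norm
    divided by 4 a^2.\<close>
  have "q + (a\<^sup>2 + 1/4) * W \<le> (1 + 1 / (4 * a\<^sup>2)) * (q + a\<^sup>2 * W)"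
  proof -
    have "(1 + 1 / (4 * a\<^sup>2)) * (q + a\<^sup>2 * W) = q + (a\<^sup>2 + 1/4) * W + q / (4 * a\<^sup>2)"
      using a by (simp add: field_simps power2_eq_square)
    moreover have "0 \<le> q / (4 * a\<^sup>2)" using q by simp
    ultimately show ?thesis by linarith
  qed
  then show "(LINT z|lborel. omega ?b z * (cmod (inner1 f (\<lambda>x. eta a z x t)))\<^sup>2)
      \<le> (1 + 1 / (4 * a\<^sup>2)) * (LINT x|lborel. (cmod (f x))\<^sup>2)"
    unfolding nf has_bochner_integral_integral_eq[OF hb] .
qed

lemma L1_diff:
  assumes "f \<in> L1 a t" "g \<in> L1 a t"
  shows "(\<lambda>x. f x - g x) \<in> L1 a t"
proof -
  obtain N d where f: "f = Lop a (lcomb 0 N d t)" using assms(1) unfolding L1_eq_Lop_lcomb by blast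
  obtain M e where g: "g = Lop a (lcomb 0 M e t)" using assms(2) unfolding L1_eq_Lop_lcomb by blast
  have neg: "lcomb j M (\<lambda>n. - e n) t x = - lcomb j M e t x" for j x
    by (simp add: lcomb_def sum_negf)
  obtain K c where c: "\<And>j x. lcomb j K c t x = lcomb j N d t x + lcomb j M (\<lambda>n. - e n) t x"
    using lcomb_add by blast
  have "(\<lambda>x. f x - g x) = Lop a (lcomb 0 K c t)"
    unfolding f g Lop_lcomb c neg by (simp add: fun_eq_iff algebra_simps)
  then show ?thesis unfolding L1_eq_Lop_lcomb by blast
qed

lemma L1_sqint: "f \<in> L1 a t \<Longrightarrow> sqint lborel f"
  unfolding L1_eq_Lop_lcomb using edec_L2[OF Lop_lcomb_edec, of 1] by (auto simp: L2_eq_sqint)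

text \<open>Absorbing the square root of the positive density makes the overlap map one into L^2 of
  the plane with Lebesgue measure.\<close>

definition woverlap :: "real \<Rightarrow> real \<Rightarrow> (real \<Rightarrow> complex) \<Rightarrow> complex \<Rightarrow> complex" where
  "woverlap a t f z = complex_of_real (sqrt (omega (sqrt (a\<^sup>2 + 1/4)) z)) * inner1 f (\<lambda>x. eta a z x t)"

context
  fixes a :: real
  assumes a: "a > 0"
begin

lemma omega_shift_pos: "0 < omega (sqrt (a\<^sup>2 + 1/4)) z"
  unfolding omega_shift using a by (intro divide_pos_pos add_nonneg_pos) auto

lemma norm_woverlap_square:
  "(cmod (woverlap a t f z))\<^sup>2 = omega (sqrt (a\<^sup>2 + 1/4)) z * (cmod (inner1 f (\<lambda>x. eta a z x t)))\<^sup>2"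
  using omega_shift_pos[of z] by (simp add: woverlap_def norm_mult power_mult_distrib)

lemma woverlap_measurable:
  assumes "f \<in> L1 a t"
  shows "woverlap a t f \<in> borel_measurable lborel"
proof -
  obtain N d where f: "f = Lop a (lcomb 0 N d t)" using assms unfolding L1_eq_Lop_lcomb by blast
  have "continuous_on UNIV (woverlap a t f)"
    unfolding woverlap_def[abs_def] f lcomb_overlap[OF a] omega_def
    by (intro continuous_intros) auto
  then show ?thesis using borel_measurable_continuous_onI by simp
qed

lemma woverlap_L1:
  assumes "f \<in> L1 a t"
  shows "sqint lborel (woverlap a t f)"
    "(LINT z|lborel. (cmod (woverlap a t f z))\<^sup>2) \<le> (1 + 1 / (4 * a\<^sup>2)) * (LINT x|lborel. (cmod (f x))\<^sup>2)"
  using overlap_bound[OF a assms] woverlap_measurable[OF assms]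
  unfolding sqint_def norm_woverlap_square by (auto simp: has_bochner_integral_iff)

lemma eta_sqint: "sqint lborel (\<lambda>x. eta a z x t)"
  using edec_L2[OF eta_edec[OF a], of z t] a by (simp add: L2_eq_sqint)

text \<open>Overlaps converge pointwise in z because eta_z is square integrable, and they form a
  Cauchy sequence in L^2 of the plane by linearity and the bound on \<open>L1\<close>.
  \<open>Fatou_square\<close> identifies the two limits.\<close>

lemma woverlap_H1:
  assumes f: "f \<in> H1 a t"
  obtains fs where "\<And>k. fs k \<in> L1 a t" "l2conv fs f"
    "sqint lborel (woverlap a t f)"
    "(\<lambda>k. LINT z|lborel. (cmod (woverlap a t (fs k) z - woverlap a t f z))\<^sup>2) \<longlonglongrightarrow> 0"
proof -
  define K where "K = 1 + 1 / (4 * a\<^sup>2)"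
  have K: "K \<ge> 0" by (simp add: K_def)
  obtain fs where fs: "\<And>k. fs k \<in> L1 a t" and conv: "l2conv fs f" and L2f: "sqint lborel f"
    using f unfolding H1_def L2_eq_sqint by blast
  define e where "e k = (LINT x|lborel. (cmod (fs k x - f x))\<^sup>2)" for k
  have e: "e \<longlonglongrightarrow> 0" using conv by (simp add: l2conv_def e_def[abs_def])
  have sq: "sqint lborel (\<lambda>x. fs k x - f x)" for k
    by (rule sqint_diff[OF L1_sqint[OF fs] L2f])
  have lim: "(\<lambda>l. woverlap a t (fs l) z) \<longlonglongrightarrow> woverlap a t f z" for z
  proof -
    have "(\<lambda>l. LINT x|lborel. 1 * (cnj (fs l x) * eta a z x t)) \<longlonglongrightarrow> (LINT x|lborel. 1 * (cnj (f x) * eta a z x t))"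
      by (rule tendsto_integral_sqint[where C=1])
         (use L2f L1_sqint[OF fs] conv eta_sqint in \<open>auto simp: l2conv_def\<close>)
    then show ?thesis unfolding woverlap_def inner1_def by (intro tendsto_mult tendsto_const) simp
  qed
  have diff: "woverlap a t (fs k) z - woverlap a t (fs l) z = woverlap a t (\<lambda>x. fs k x - fs l x) z" for k l z
  proof -
    have i: "integrable lborel (\<lambda>x. cnj (fs k x) * eta a z x t)" for k
      using sqint_mult_integrable[OF L1_sqint[OF fs] eta_sqint, of "\<lambda>_. 1" 1 k z t] by simp
    have "inner1 (\<lambda>x. fs k x - fs l x) (\<lambda>x. eta a z x t) = inner1 (fs k) (\<lambda>x. eta a z x t) - inner1 (fs l) (\<lambda>x. eta a z x t)"
      unfolding inner1_def complex_cnj_diff left_diff_distrib by (rule Bochner_Integration.integral_diff[OF i i])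
    then show ?thesis by (simp add: woverlap_def right_diff_distrib)
  qed
  have e_le: "(LINT x|lborel. (cmod (fs k x - fs l x))\<^sup>2) \<le> 2 * e k + 2 * e l" for k l
  proof -
    have i: "integrable lborel (\<lambda>x. (cmod (fs k x - f x))\<^sup>2)" for k using sq by (simp add: sqint_def)
    have "(LINT x|lborel. (cmod (fs k x - fs l x))\<^sup>2) \<le> (LINT x|lborel. 2 * (cmod (fs k x - f x))\<^sup>2 + 2 * (cmod (fs l x - f x))\<^sup>2)"
    proof (rule integral_mono')
      show "integrable lborel (\<lambda>x. 2 * (cmod (fs k x - f x))\<^sup>2 + 2 * (cmod (fs l x - f x))\<^sup>2)" using i by simp
      show "(cmod (fs k x - fs l x))\<^sup>2 \<le> 2 * (cmod (fs k x - f x))\<^sup>2 + 2 * (cmod (fs l x - f x))\<^sup>2" for x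
        using norm_add_square_le[of "fs k x - f x" "f x - fs l x"] by (simp add: norm_minus_commute)
    qed simp
    also have "\<dots> = 2 * e k + 2 * e l" using i by (simp add: e_def)
    finally show ?thesis .
  qed
  have Fa: "integrable lborel (\<lambda>z. (cmod (woverlap a t (fs k) z - woverlap a t f z))\<^sup>2)"
      "(LINT z|lborel. (cmod (woverlap a t (fs k) z - woverlap a t f z))\<^sup>2) \<le> 2 * K * e k" for k
  proof -
    have d: "integrable lborel (\<lambda>z. (cmod (woverlap a t (fs k) z - woverlap a t (fs l) z))\<^sup>2)" for l
      unfolding diff using woverlap_L1(1)[OF L1_diff[OF fs fs]] by (simp add: sqint_def)
    have b: "(LINT z|lborel. (cmod (woverlap a t (fs k) z - woverlap a t (fs l) z))\<^sup>2) \<le> K * (2 * e k + 2 * e l)" for l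
      unfolding diff K_def
      by (rule order_trans[OF woverlap_L1(2)[OF L1_diff[OF fs fs]] mult_left_mono[OF e_le]]) simp
    have c: "(\<lambda>l. K * (2 * e k + 2 * e l)) \<longlonglongrightarrow> K * (2 * e k + 2 * 0)"
      by (intro tendsto_intros e)
    note F = Fatou_square[OF woverlap_measurable[OF fs] woverlap_measurable[OF fs] lim d b c]
    show "integrable lborel (\<lambda>z. (cmod (woverlap a t (fs k) z - woverlap a t f z))\<^sup>2)" by (rule F(1))
    show "(LINT z|lborel. (cmod (woverlap a t (fs k) z - woverlap a t f z))\<^sup>2) \<le> 2 * K * e k"
      using F(2) by (simp add: mult_ac)
  qed
  have mf: "woverlap a t f \<in> borel_measurable lborel"
    by (rule borel_measurable_LIMSEQ_metric[OF woverlap_measurable[OF fs] lim])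
  have "sqint lborel (\<lambda>z. woverlap a t (fs 0) z - woverlap a t f z)"
    unfolding sqint_def using Fa(1)[of 0] borel_measurable_diff[OF woverlap_measurable[OF fs] mf] by blast
  from sqint_diff[OF woverlap_L1(1)[OF fs[of 0]] this] have "sqint lborel (woverlap a t f)" by simp
  moreover have "(\<lambda>k. LINT z|lborel. (cmod (woverlap a t (fs k) z - woverlap a t f z))\<^sup>2) \<longlonglongrightarrow> 0"
  proof (rule real_tendsto_sandwich[where f="\<lambda>_. 0" and h="\<lambda>k. 2 * K * e k"])
    show "(\<lambda>k. 2 * K * e k) \<longlonglongrightarrow> 0" by (rule tendsto_mult_right_zero[OF e])
  qed (use Fa(2) in \<open>auto intro!: always_eventually\<close>)
  ultimately show thesis using that fs conv by blast
qed

text \<open>The positive density is hidden in the two weighted overlaps; what remains of the signed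
  one is the quotient, to be treated as a bounded multiplier.\<close>

lemma omega_overlap_eq:
  "complex_of_real (omega a z) * inner1 f (\<lambda>x. eta a z x t) * inner1 (\<lambda>x. eta a z x t) g =
    complex_of_real (omega a z / omega (sqrt (a\<^sup>2 + 1/4)) z) * (cnj (woverlap a t g z) * woverlap a t f z)"
proof -
  let ?w = "omega (sqrt (a\<^sup>2 + 1/4)) z"
  have w: "complex_of_real (sqrt ?w) * complex_of_real (sqrt ?w) = complex_of_real ?w"
    using omega_shift_pos[of z] by (simp flip: of_real_mult)
  have "cnj (woverlap a t g z) * woverlap a t f z =
    (complex_of_real (sqrt ?w) * complex_of_real (sqrt ?w)) * (inner1 f (\<lambda>x. eta a z x t) * inner1 (\<lambda>x. eta a z x t) g)"
    unfolding woverlap_def inner1_cnj[of "\<lambda>x. eta a z x t" g] by (simp add: mult_ac)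
  then show ?thesis unfolding w using omega_shift_pos[of z] by simp
qed

lemma omega_ratio_measurable: "(\<lambda>z. complex_of_real (omega a z / omega (sqrt (a\<^sup>2 + 1/4)) z)) \<in> borel_measurable lborel"
proof -
  have "continuous_on UNIV (omega c)" for c unfolding omega_def by (intro continuous_intros) auto
  then have "continuous_on UNIV (\<lambda>z. complex_of_real (omega a z / omega (sqrt (a\<^sup>2 + 1/4)) z))"
    using omega_shift_pos by (intro continuous_on_of_real continuous_on_divide) (auto simp: less_le)
  then show ?thesis using borel_measurable_continuous_onI by simp
qed

text \<open>With y = (Re z)^2 + a^2 the quotient is (y - 1/4) / y, and y \<ge> a^2 bounds 1 / (4
  y).\<close>

lemma omega_ratio_bound: "cmod (complex_of_real (omega a z / omega (sqrt (a\<^sup>2 + 1/4)) z)) \<le> 1 + 1 / (4 * a\<^sup>2)"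
proof -
  let ?y = "(Re z)\<^sup>2 + a\<^sup>2"
  have y: "?y > 0" using a by (intro add_nonneg_pos) auto
  have "a\<^sup>2 \<le> ?y" by simp
  then have "1 / (4 * a\<^sup>2) * a\<^sup>2 \<le> 1 / (4 * a\<^sup>2) * ?y" by (rule mult_left_mono) simp
  moreover have "1 / (4 * a\<^sup>2) * a\<^sup>2 = 1/4" using a by simp
  moreover have "\<bar>?y - 1/4\<bar> \<le> ?y + 1/4" using y by linarith
  ultimately have "\<bar>?y - 1/4\<bar> \<le> (1 + 1 / (4 * a\<^sup>2)) * ?y" unfolding distrib_right[of 1] mult_1 by linarith
  then have "\<bar>?y - 1/4\<bar> / ?y \<le> 1 + 1 / (4 * a\<^sup>2)" using y by (simp add: pos_divide_le_eq)
  moreover have "omega a z / omega (sqrt (a\<^sup>2 + 1/4)) z = (?y - 1/4) / ?y"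
    unfolding omega_shift omega_def by simp
  ultimately show ?thesis unfolding norm_of_real using y by (simp add: abs_divide)
qed

text \<open>On \<open>L1\<close> the identity is a finite sum of moments. Both sides are continuous
  along the approximations of f and g, the left one because the weighted overlaps converge in L^2 of
  the plane.\<close>

lemma eta_resolution:
  assumes f: "f \<in> H1 a t" and g: "g \<in> H1 a t"
  shows "integrable lborel (\<lambda>z. complex_of_real (omega a z) * inner1 f (\<lambda>x. eta a z x t) * inner1 (\<lambda>x. eta a z x t) g)"
    "(LINT z|lborel. complex_of_real (omega a z) * inner1 f (\<lambda>x. eta a z x t) * inner1 (\<lambda>x. eta a z x t) g) = inner1 f g"
proof -
  obtain fs where fs: "\<And>k. fs k \<in> L1 a t" "l2conv fs f" "sqint lborel (woverlap a t f)"
    "(\<lambda>k. LINT z|lborel. (cmod (woverlap a t (fs k) z - woverlap a t f z))\<^sup>2) \<longlonglongrightarrow> 0"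
    using woverlap_H1[OF f] by blast
  obtain gs where gs: "\<And>k. gs k \<in> L1 a t" "l2conv gs g" "sqint lborel (woverlap a t g)"
    "(\<lambda>k. LINT z|lborel. (cmod (woverlap a t (gs k) z - woverlap a t g z))\<^sup>2) \<longlonglongrightarrow> 0"
    using woverlap_H1[OF g] by blast
  have L2: "sqint lborel f" "sqint lborel g" using f g by (auto simp: H1_def L2_eq_sqint)
  show "integrable lborel (\<lambda>z. complex_of_real (omega a z) * inner1 f (\<lambda>x. eta a z x t) * inner1 (\<lambda>x. eta a z x t) g)"
    unfolding omega_overlap_eq
    by (rule sqint_mult_integrable[OF gs(3) fs(3) omega_ratio_measurable omega_ratio_bound])
  have k: "(LINT z|lborel. complex_of_real (omega a z) * inner1 (fs k) (\<lambda>x. eta a z x t) * inner1 (\<lambda>x. eta a z x t) (gs k)) = inner1 (fs k) (gs k)" for k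
  proof -
    obtain N d where F: "fs k = Lop a (lcomb 0 N d t)" using fs(1)[of k] unfolding L1_eq_Lop_lcomb by blast
    obtain M e where G: "gs k = Lop a (lcomb 0 M e t)" using gs(1)[of k] unfolding L1_eq_Lop_lcomb by blast
    show ?thesis
      unfolding F G inner1_Lop_lcomb by (rule has_bochner_integral_integral_eq[OF overlap_resolution[OF a]])
  qed
  have "(\<lambda>k. LINT z|lborel. complex_of_real (omega a z) * inner1 (fs k) (\<lambda>x. eta a z x t) * inner1 (\<lambda>x. eta a z x t) (gs k))
     \<longlonglongrightarrow> (LINT z|lborel. complex_of_real (omega a z) * inner1 f (\<lambda>x. eta a z x t) * inner1 (\<lambda>x. eta a z x t) g)"
    unfolding omega_overlap_eq
    by (rule tendsto_integral_sqint[OF gs(3) woverlap_L1(1)[OF gs(1)] gs(4) fs(3) woverlap_L1(1)[OF fs(1)] fs(4)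
          omega_ratio_measurable omega_ratio_bound])
  moreover have "(\<lambda>k. inner1 (fs k) (gs k)) \<longlonglongrightarrow> inner1 f g"
  proof -
    have "(\<lambda>k. LINT x|lborel. 1 * (cnj (fs k x) * gs k x)) \<longlonglongrightarrow> (LINT x|lborel. 1 * (cnj (f x) * g x))"
      by (rule tendsto_integral_sqint[OF L2(1) L1_sqint[OF fs(1)] fs(2)[unfolded l2conv_def]
            L2(2) L1_sqint[OF gs(1)] gs(2)[unfolded l2conv_def], of _ 1]) simp_all
    then show ?thesis by (simp add: inner1_def)
  qed
  ultimately show "(LINT z|lborel. complex_of_real (omega a z) * inner1 f (\<lambda>x. eta a z x t) * inner1 (\<lambda>x. eta a z x t) g) = inner1 f g"
    unfolding k by (rule LIMSEQ_unique)
qed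

end

text \<open>The operator identity is expressed by matrix elements between arbitrary f and g in
  \<open>H1\<close>. As the density changes sign for a < 1/2, it appears as a factor in integrals
  over Lebesgue measure.\<close>

theorem theorem2:
  fixes a :: real
  assumes "a > 0"
  shows "\<exists>eta :: complex \<Rightarrow> real \<Rightarrow> real \<Rightarrow> complex.
    (\<forall>z t. Mrel a t (\<lambda>x. psiz z x t) (\<lambda>x. eta z x t)) \<and>
    (\<forall>z t. (\<lambda>x. eta z x t) \<in> H1 a t) \<and>
    (\<forall>z t. (\<lambda>x. eta z x t) \<in> dom_h1 a t) \<and>
    (\<forall>z. solves_schroedinger1 a (eta z)) \<and>
    (\<forall>t f g. f \<in> H1 a t \<longrightarrow> g \<in> H1 a t \<longrightarrow>
       integrable lborel (\<lambda>z. complex_of_real (omega a z)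
          * inner1 f (\<lambda>x. eta z x t) * inner1 (\<lambda>x. eta z x t) g) \<and>
       (LINT z|lborel. complex_of_real (omega a z)
          * inner1 f (\<lambda>x. eta z x t) * inner1 (\<lambda>x. eta z x t) g) = inner1 f g) \<and>
    (\<forall>t n k.
       integrable lborel (\<lambda>z. complex_of_real (omega a z * exp (- (cmod z)\<^sup>2)) * z ^ n * cnj z ^ k) \<and>
       complex_of_real (1 / sqrt (fact n) * (1 / sqrt (fact k)))
         * (LINT z|lborel. complex_of_real (omega a z * exp (- (cmod z)\<^sup>2)) * z ^ n * cnj z ^ k)
       = S a t n k)"
proof (intro exI[of _ "eta a"] conjI allI impI)
  show "Mrel a t (\<lambda>x. psiz z x t) (\<lambda>x. eta a z x t)" for z t
    by (rule eta_Mrel_H1(1)[OF assms])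
  show "(\<lambda>x. eta a z x t) \<in> H1 a t" for z t
    by (rule eta_Mrel_H1(2)[OF assms])
  show "(\<lambda>x. eta a z x t) \<in> dom_h1 a t" for z t
    by (rule eta_dom_h1[OF assms])
  show "solves_schroedinger1 a (eta a z)" for z
    by (rule eta_solves[OF assms])
next
  fix t f g
  assume "f \<in> H1 a t" "g \<in> H1 a t"
  note eta_resolution[OF assms this]
  then show "integrable lborel (\<lambda>z. complex_of_real (omega a z)
      * inner1 f (\<lambda>x. eta a z x t) * inner1 (\<lambda>x. eta a z x t) g)"
    and "(LINT z|lborel. complex_of_real (omega a z)
      * inner1 f (\<lambda>x. eta a z x t) * inner1 (\<lambda>x. eta a z x t) g) = inner1 f g"
    by blast+
next
  fix t n k
  note has_bochner_integral_omega_moment[of a n k]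
  then show "integrable lborel (\<lambda>z. complex_of_real (omega a z * exp (- (cmod z)\<^sup>2)) * z ^ n * cnj z ^ k)"
    and "complex_of_real (1 / sqrt (fact n) * (1 / sqrt (fact k)))
         * (LINT z|lborel. complex_of_real (omega a z * exp (- (cmod z)\<^sup>2)) * z ^ n * cnj z ^ k)
       = S a t n k"
    by (auto simp only: S_eq_sw has_bochner_integral_iff)
qed

end
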